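(* Let $\ell\ge 1$ and let $A=(A_{11},A_{12},A_{22})$ be a formal positive elliptic tuple of real symmetric $\ell\times\ell$ matrices. For $0<\alpha\le 2\pi$ define $$\Lambda_\alpha:=\{\lambda\in\mathbb{C}\setminus\{0\}: \text{there exists } r^\lambda v\neq 0 \text{ solving the model problem for } A \text{ in the angle } \mathcal{K}_\alpha \text{ with Neumann boundary conditions}\}.$$ Then: (i) $\Lambda_\alpha\subset\{\lambda\in\mathbb{C}: |\operatorname{Re}\lambda|>1\}$ for $0<\alpha<\pi$. (ii) $\Lambda_\pi=\mathbb{Z}\setminus\{0\}$. (iii) $\Lambda_\alpha\subset\{\lambda\in\mathbb{C}: |\operatorname{Re}\lambda|>\tfrac12\}$ for $\pi<\alpha<2\pi$. (iv) $\Lambda_{2\pi}=\tfrac12\mathbb{Z}\setminus\{0\}$.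
   Context: A tuple $A=(A_{11},A_{12},A_{22})$ of real symmetric $\ell\times\ell$ matrices is elliptic if $\xi_1^2A_{11}+2\xi_1\xi_2A_{12}+\xi_2^2A_{22}$ is positive definite for all $(\xi_1,\xi_2)\in\mathbb{R}^2\setminus\{0\}$. It is formal positive if the symmetric $2\ell\times 2\ell$ block matrix $\begin{pmatrix} A_{11} & A_{12} \\ A_{12} & A_{22} \end{pmatrix}$ is positive definite. Let $(r,\theta)$ be polar coordinates and $\mathcal{K}_\alpha=\{(r\cos\theta,r\sin\theta): r>0,\ 0<\theta<\alpha\}$ for $0<\alpha\le 2\pi$ (for $\alpha=2\pi$ this is the plane slit along the positive $x_1$-axis, whose two sides $\theta=0$ and $\theta=2\pi$ are treated as distinct boundary rays). For $\lambda\in\mathbb{C}$ and $v\in C^\infty([0,\alpha];\mathbb{C}^\ell)$, write $r^\lambda v$ for the function $u(r,\theta)=r^\lambda v(\theta)$, where $r^\lambda=\exp(\lambda\log r)$. The function $u=r^\lambda v$ solves the model problem for $A$ in $\mathcal{K}_\alpha$ with Neumann boundary conditions if $$A_{11}\partial_1^2u+2A_{12}\partial_1\partial_2u+A_{22}\partial_2^2u=0\quad\text{in }\mathcal{K}_\alpha,$$ and, on each of the two boundary rays $\theta=0$ and $\theta=\alpha$ ($r>0$), $$n_1(A_{11}\partial_1u+A_{12}\partial_2u)+n_2(A_{12}\partial_1u+A_{22}\partial_2u)=0,$$ where $n=(n_1,n_2)$ is the unit normal to that ray and derivatives are taken as limits from inside $\mathcal{K}_\alpha$ (for $\alpha=2\pi$,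 from the respective side). *)

theory Defs
  imports "HOL-Analysis.Analysis"
begin

section \<open>Coefficient tuples\<close>

definition symmetric_mat :: "real^'n^'n \<Rightarrow> bool" where
  "symmetric_mat M \<longleftrightarrow> transpose M = M"

definition positive_definite :: "real^'n^'n \<Rightarrow> bool" where
  "positive_definite M \<longleftrightarrow> symmetric_mat M \<and> (\<forall>x. x \<noteq> 0 \<longrightarrow> x \<bullet> (M *v x) > 0)"

definition elliptic :: "real^'l^'l \<Rightarrow> real^'l^'l \<Rightarrow> real^'l^'l \<Rightarrow> bool" where
  "elliptic A11 A12 A22 \<longleftrightarrow>
     (\<forall>\<xi> :: real^2. \<xi> \<noteq> 0 \<longrightarrow>
        positive_definite ((\<xi>$1)\<^sup>2 *\<^sub>R A11 + (2 * \<xi>$1 * \<xi>$2) *\<^sub>R A12 + (\<xi>$2)\<^sup>2 *\<^sub>R A22))"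

definition block_mat ::
  "real^'l^'l \<Rightarrow> real^'l^'l \<Rightarrow> real^'l^'l \<Rightarrow> real^'l^'l \<Rightarrow> real^('l + 'l)^('l + 'l)" where
  "block_mat A B C D =
     (\<chi> i j. case (i, j) of
        (Inl p, Inl q) \<Rightarrow> A $ p $ q
      | (Inl p, Inr q) \<Rightarrow> B $ p $ q
      | (Inr p, Inl q) \<Rightarrow> C $ p $ q
      | (Inr p, Inr q) \<Rightarrow> D $ p $ q)"

definition formal_positive :: "real^'l^'l \<Rightarrow> real^'l^'l \<Rightarrow> real^'l^'l \<Rightarrow> bool" where
  "formal_positive A11 A12 A22 \<longleftrightarrow> positive_definite (block_mat A11 A12 A12 A22)"

abbreviation complex_mat :: "real^'n^'m \<Rightarrow> complex^'n^'m" where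
  "complex_mat \<equiv> map_matrix complex_of_real"

section \<open>Angles and functions of the form r to the power mu times v\<close>

definition polar :: "real \<Rightarrow> real \<Rightarrow> real^2" where
  "polar r \<theta> = vector [r * cos \<theta>, r * sin \<theta>]"

definition sector :: "real \<Rightarrow> (real^2) set" where
  "sector \<alpha> = {polar r \<theta> | r \<theta>. 0 < r \<and> 0 < \<theta> \<and> \<theta> < \<alpha>}"

text \<open>Smoothness up to the end points: one-sided derivatives of every order exist there.
  Only the values of v on the closed interval matter.\<close>

definition smooth_on_interval :: "real \<Rightarrow> real \<Rightarrow> (real \<Rightarrow> 'b::real_normed_vector) \<Rightarrow> bool" where
  "smooth_on_interval a b v \<longleftrightarrow>
     (\<forall>k. ((\<lambda>f t. vector_derivative f (at t within {a..b})) ^^ k) v differentiable_on {a..b})"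

text \<open>The angular coordinate Arg2pi takes values in [0, 2 pi), so on the sector (opening at
  most 2 pi) it is the angle strictly between 0 and the opening.\<close>

definition power_fun :: "complex \<Rightarrow> (real \<Rightarrow> complex^'l) \<Rightarrow> real^2 \<Rightarrow> complex^'l" where
  "power_fun \<mu> v x = (complex_of_real (norm x) powr \<mu>) *s v (Arg2pi (Complex (x$1) (x$2)))"

section \<open>The model problem\<close>

definition partial_deriv :: "2 \<Rightarrow> (real^2 \<Rightarrow> 'b::real_normed_vector) \<Rightarrow> real^2 \<Rightarrow> 'b" where
  "partial_deriv j u x = vector_derivative (\<lambda>t. u (x + t *\<^sub>R axis j 1)) (at 0)"

definition solves_equation ::
  "real^'l^'l \<Rightarrow> real^'l^'l \<Rightarrow> real^'l^'l \<Rightarrow> real \<Rightarrow> (real^2 \<Rightarrow> complex^'l) \<Rightarrow> bool" where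
  "solves_equation A11 A12 A22 \<alpha> u \<longleftrightarrow>
     (\<forall>x \<in> sector \<alpha>.
        complex_mat A11 *v partial_deriv 1 (partial_deriv 1 u) x
      + 2 *\<^sub>R (complex_mat A12 *v partial_deriv 1 (partial_deriv 2 u) x)
      + complex_mat A22 *v partial_deriv 2 (partial_deriv 2 u) x = 0)"

text \<open>Limit of w from inside the sector at the point with polar coordinates r and phi, where phi
  is 0 or the opening. It is taken in polar coordinates so that for opening 2 pi the two sides of
  the slit are distinguished.\<close>

definition has_inner_limit ::
  "real \<Rightarrow> (real^2 \<Rightarrow> 'b::topological_space) \<Rightarrow> 'b \<Rightarrow> real \<Rightarrow> real \<Rightarrow> bool" where
  "has_inner_limit \<alpha> w l r \<phi> \<longleftrightarrow>
     ((\<lambda>(\<rho>, \<theta>). w (polar \<rho> \<theta>)) \<longlongrightarrow> l) (at (r, \<phi>) within ({0<..} \<times> {0<..<\<alpha>}))"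

text \<open>The normal is determined up to sign, and the condition does not depend on the sign.\<close>

definition neumann_on_ray ::
  "real^'l^'l \<Rightarrow> real^'l^'l \<Rightarrow> real^'l^'l \<Rightarrow> real \<Rightarrow> real \<Rightarrow> (real^2 \<Rightarrow> complex^'l) \<Rightarrow> bool" where
  "neumann_on_ray A11 A12 A22 \<alpha> \<phi> u \<longleftrightarrow>
     (let n = (vector [- sin \<phi>, cos \<phi>] :: real^2) in
      \<forall>r > 0. \<exists>d1 d2.
        has_inner_limit \<alpha> (partial_deriv 1 u) d1 r \<phi> \<and>
        has_inner_limit \<alpha> (partial_deriv 2 u) d2 r \<phi> \<and>
        n$1 *\<^sub>R (complex_mat A11 *v d1 + complex_mat A12 *v d2)
      + n$2 *\<^sub>R (complex_mat A12 *v d1 + complex_mat A22 *v d2) = 0)"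

definition solves_neumann_problem ::
  "real^'l^'l \<Rightarrow> real^'l^'l \<Rightarrow> real^'l^'l \<Rightarrow> real \<Rightarrow> (real^2 \<Rightarrow> complex^'l) \<Rightarrow> bool" where
  "solves_neumann_problem A11 A12 A22 \<alpha> u \<longleftrightarrow>
     solves_equation A11 A12 A22 \<alpha> u \<and>
     neumann_on_ray A11 A12 A22 \<alpha> 0 u \<and>
     neumann_on_ray A11 A12 A22 \<alpha> \<alpha> u"

definition Lambda :: "real^'l^'l \<Rightarrow> real^'l^'l \<Rightarrow> real^'l^'l \<Rightarrow> real \<Rightarrow> complex set" where
  "Lambda A11 A12 A22 \<alpha> =
     {\<mu>. \<mu> \<noteq> 0 \<and>
        (\<exists>v. smooth_on_interval 0 \<alpha> v \<and>
             (\<exists>x \<in> sector \<alpha>. power_fun \<mu> v x \<noteq> 0) \<and>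
             solves_neumann_problem A11 A12 A22 \<alpha> (power_fun \<mu> v))}"

end

theory Submission
  imports Defs
begin

text \<open>Let u be homogeneous of degree \<open>\<mu> \<noteq> 0\<close> and let \<open>\<phi>\<close> be a stress function of u, homogeneous of degree
  \<open>\<mu>\<close> as well. The equation says that the pair W of u and \<open>\<phi>\<close> satisfies \<open>\<partial>\<^sub>2 W = N \<partial>\<^sub>1 W\<close> with a constant
  real operator N (Stroh formalism), and the Neumann conditions say that \<open>\<phi>\<close> vanishes on both rays.
  With \<open>Q z = Re z + Im z N\<close> this becomes \<open>W' = \<mu> Q\<^sup>-\<^sup>1 Q' W\<close> along \<open>z = cis \<theta>\<close>, where everything commutes, so
  \<open>W(\<theta>) = exp(\<mu> K(\<theta>)) W(0)\<close> with K the logarithm of Q. Since \<open>exp(K(\<pi>)) = Q(- 1) = - 1\<close>, the spectrum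
  for the opening \<open>\<pi>\<close> is invariant under integer shifts, and since \<open>K(2 \<pi>) = 2 K(\<pi>)\<close>, the one for the
  opening \<open>2 \<pi>\<close> is its half.

  N is symmetric with respect to the pairing of u and \<open>\<phi>\<close>. For vectors x = (u, 0), formal positivity
  gives the sign of the pairing of x with \<open>Q(w) Q(z)\<^sup>-\<^sup>1 x\<close>, namely that of the angle from z to w. The integral
  formula for fractional powers carries this over to \<open>exp(s (K(b) - K(a)))\<close> for \<open>0 < \<bar>s\<bar> \<le> 1\<close> and
  \<open>0 < b - a < \<pi>\<close>. A solution with \<open>0 < \<bar>Re \<mu>\<bar> \<le> 1 / 2\<close> is excluded by comparing the pairing of W
  with itself at the bisector of the angle, computed from either ray. For \<open>1 / 2 < \<bar>Re \<mu>\<bar> \<le> 1\<close> and an opening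
  \<open>\<alpha> < \<pi>\<close>, the pairing of \<open>W(\<alpha>)\<close> with the image of \<open>W(\<alpha>)\<close> under \<open>exp(\<plusminus> K(\<alpha>))\<close> has two different signs. For
  \<open>Re \<mu> = 0\<close>, the imaginary part of the Hermitian product of u and \<open>\<phi>\<close> is strictly monotone in \<open>\<theta>\<close>.\<close>

section \<open>The Banach algebra of bounded operators\<close>

text \<open>A type of its own with a single parameter, so that composition can be the ring
  multiplication and \<open>exp\<close> is available for operators.\<close>

typedef (overloaded) 'a endo = "UNIV :: ('a::real_normed_vector \<Rightarrow>\<^sub>L 'a) set"
  morphisms blinfun_of_endo Endo by simp

setup_lifting type_definition_endo

instantiation endo :: (real_normed_vector) ab_group_add
begin

lift_definition zero_endo :: "'a endo" is 0 .
lift_definition plus_endo :: "'a endo \<Rightarrow> 'a endo \<Rightarrow> 'a endo" is "(+)" .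
lift_definition minus_endo :: "'a endo \<Rightarrow> 'a endo \<Rightarrow> 'a endo" is "(-)" .
lift_definition uminus_endo :: "'a endo \<Rightarrow> 'a endo" is uminus .

instance
proof
  fix X Y Z :: "'a endo"
  show "X + Y + Z = X + (Y + Z)" by transfer (rule add.assoc)
  show "X + Y = Y + X" by transfer (rule add.commute)
  show "0 + X = X" by transfer simp
  show "- X + X = 0" by transfer simp
  show "X - Y = X + - Y" by transfer simp
qed

end

instantiation endo :: (real_normed_vector) real_vector
begin

lift_definition scaleR_endo :: "real \<Rightarrow> 'a endo \<Rightarrow> 'a endo" is scaleR .

instance
proof
  fix X Y :: "'a endo" and a b :: real
  show "a *\<^sub>R (X + Y) = a *\<^sub>R X + a *\<^sub>R Y" by transfer (rule scaleR_right_distrib)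
  show "(a + b) *\<^sub>R X = a *\<^sub>R X + b *\<^sub>R X" by transfer (rule scaleR_left_distrib)
  show "a *\<^sub>R b *\<^sub>R X = (a * b) *\<^sub>R X" by transfer simp
  show "1 *\<^sub>R X = X" by transfer simp
qed

end

instantiation endo :: (real_normed_vector) real_normed_vector
begin

lift_definition norm_endo :: "'a endo \<Rightarrow> real" is norm .
definition dist_endo :: "'a endo \<Rightarrow> 'a endo \<Rightarrow> real" where
  "dist_endo X Y = norm (X - Y)"
definition sgn_endo :: "'a endo \<Rightarrow> 'a endo" where
  "sgn_endo X = X /\<^sub>R norm X"
definition uniformity_endo :: "('a endo \<times> 'a endo) filter" where
  "uniformity_endo = (INF e\<in>{0 <..}. principal {(x, y). dist x y < e})"
definition open_endo :: "'a endo set \<Rightarrow> bool" where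
  "open_endo S = (\<forall>x\<in>S. \<forall>\<^sub>F (x', y) in uniformity. x' = x \<longrightarrow> y \<in> S)"

instance
proof
  fix X Y :: "'a endo" and a :: real
  show "norm X = 0 \<longleftrightarrow> X = 0" by transfer simp
  show "norm (X + Y) \<le> norm X + norm Y" by transfer (rule norm_triangle_ineq)
  show "norm (a *\<^sub>R X) = \<bar>a\<bar> * norm X" by transfer simp
qed (rule dist_endo_def sgn_endo_def uniformity_endo_def open_endo_def)+

end

text \<open>The sort \<open>perfect_space\<close> rules out the zero space, on which the identity
  would have norm 0 instead of 1.\<close>

instantiation endo :: ("{real_normed_vector, perfect_space}") real_normed_algebra_1
begin

lift_definition one_endo :: "'a endo" is id_blinfun .
lift_definition times_endo :: "'a endo \<Rightarrow> 'a endo \<Rightarrow> 'a endo" is blinfun_compose .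

instance
proof
  fix X Y Z :: "'a endo" and c :: real
  show "X * Y * Z = X * (Y * Z)" by transfer (rule blinfun_eqI, simp)
  show "(X + Y) * Z = X * Z + Y * Z" by transfer (rule blinfun_eqI, simp add: blinfun.add_left)
  show "X * (Y + Z) = X * Y + X * Z"
    by transfer (rule blinfun_eqI, simp add: blinfun.add_left blinfun.add_right)
  show "1 * X = X" by transfer (rule blinfun_eqI, simp)
  show "X * 1 = X" by transfer (rule blinfun_eqI, simp)
  show "c *\<^sub>R X * Y = c *\<^sub>R (X * Y)" by transfer (rule blinfun_eqI, simp add: blinfun.scaleR_left)
  show "X * c *\<^sub>R Y = c *\<^sub>R (X * Y)"
    by transfer (rule blinfun_eqI, simp add: blinfun.scaleR_left blinfun.scaleR_right)
  show "norm (X * Y) \<le> norm X * norm Y" by transfer (rule norm_blinfun_compose)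
  show "norm (1 :: 'a endo) = 1" by transfer (rule norm_blinfun_id)
  then show "(0 :: 'a endo) \<noteq> 1"
    by (metis norm_zero zero_neq_one)
qed

end

instance endo :: (banach) banach
proof
  fix X :: "nat \<Rightarrow> 'a endo"
  assume X: "Cauchy X"
  have dist_eq: "dist (blinfun_of_endo a) (blinfun_of_endo b) = dist a b" for a b :: "'a endo"
    unfolding dist_norm by transfer simp
  from X have "Cauchy (\<lambda>n. blinfun_of_endo (X n))"
    by (simp add: Cauchy_def dist_eq)
  then obtain L where "(\<lambda>n. blinfun_of_endo (X n)) \<longlonglongrightarrow> L"
    using Cauchy_convergent convergent_def by blast
  then have "X \<longlonglongrightarrow> Endo L"
    by (simp add: LIMSEQ_def Endo_inverse flip: dist_eq)
  then show "convergent X"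
    by (auto simp: convergent_def)
qed

lift_definition endo_apply :: "'a::real_normed_vector endo \<Rightarrow> 'a \<Rightarrow> 'a" (infixr "\<cdot>" 75)
  is blinfun_apply .

lift_definition endo_of :: "('a::real_normed_vector \<Rightarrow> 'a) \<Rightarrow> 'a endo" is Blinfun .

lemma endo_apply_endo_of: "bounded_linear f \<Longrightarrow> endo_of f \<cdot> x = f x"
  by transfer (simp add: bounded_linear_Blinfun_apply)

lemma endo_eqI: "(\<And>x. X \<cdot> x = Y \<cdot> x) \<Longrightarrow> X = Y"
  by transfer (rule blinfun_eqI)

lemma endo_apply_add_left: "(X + Y) \<cdot> x = X \<cdot> x + Y \<cdot> x"
  by transfer (simp add: blinfun.add_left)

lemma endo_apply_add_right: "X \<cdot> (x + y) = X \<cdot> x + X \<cdot> y"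
  by transfer (simp add: blinfun.add_right)

lemma endo_apply_scaleR_left: "(c *\<^sub>R X) \<cdot> x = c *\<^sub>R (X \<cdot> x)"
  by transfer (simp add: blinfun.scaleR_left)

lemma endo_apply_scaleR_right: "X \<cdot> (c *\<^sub>R x) = c *\<^sub>R (X \<cdot> x)"
  by transfer (simp add: blinfun.scaleR_right)

lemma bounded_bilinear_endo_apply: "bounded_bilinear (\<cdot>)"
proof
  show "\<exists>c. \<forall>(X :: 'a endo) x. norm (X \<cdot> x) \<le> norm X * norm x * c"
  proof (intro exI[of _ 1] allI)
    show "norm (X \<cdot> x) \<le> norm X * norm x * 1" for X and x :: 'a
      by transfer (simp add: norm_blinfun)
  qed
qed (simp_all add: endo_apply_add_left endo_apply_add_right endo_apply_scaleR_left endo_apply_scaleR_right)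

interpretation endo: bounded_bilinear "(\<cdot>)"
  by (rule bounded_bilinear_endo_apply)

lemma endo_apply_times [simp]: "(X * Y) \<cdot> x = X \<cdot> Y \<cdot> x"
  by transfer simp

lemma endo_apply_one [simp]: "1 \<cdot> x = x"
  by transfer simp

lemma norm_endo_le: "0 \<le> c \<Longrightarrow> (\<And>x. norm (X \<cdot> x) \<le> c * norm x) \<Longrightarrow> norm X \<le> c"
  by transfer (rule norm_blinfun_bound)

section \<open>Calculus of curves in Banach algebras\<close>

lemma has_vector_derivative_cis: "(cis has_vector_derivative \<i> * cis t) (at t within S)"
  by (auto simp: cis_conv_exp[abs_def] intro!: derivative_eq_intros has_vector_derivative_real_field)

lemma continuous_on_if_has_vector_derivative:
  "(\<And>t. t \<in> S \<Longrightarrow> (f has_vector_derivative f' t) (at t within S)) \<Longrightarrow> continuous_on S f"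
  using has_vector_derivative_continuous continuous_on_eq_continuous_within by blast

lemma constant_if_derivative_0:
  fixes f :: "real \<Rightarrow> 'a::banach"
  assumes "continuous_on {a..b} f" "\<And>t. a < t \<Longrightarrow> t < b \<Longrightarrow> (f has_vector_derivative 0) (at t within {a..b})"
    and "x \<in> {a..b}"
  shows "f x = f a"
  using assms
  by (intro has_derivative_zero_unique_strong_interval[of "{a, b}" a b f "f a" x])
    (auto simp: has_vector_derivative_def)

text \<open>Compactness of the parameter interval. It keeps curves at a positive distance from 0,
  where the inverse operators blow up.\<close>

lemma curve_lower_bound:
  fixes f :: "real \<Rightarrow> complex"
  assumes "continuous_on {a..b} f" "\<And>s. s \<in> {a..b} \<Longrightarrow> f s \<noteq> 0" "a \<le> b"
  obtains m where "m > 0" "\<And>s. s \<in> {a..b} \<Longrightarrow> m \<le> norm (f s)"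
proof -
  have "continuous_on {a..b} (\<lambda>s. norm (f s))"
    using assms(1) by (rule continuous_on_norm)
  then obtain s where "s \<in> {a..b}" "\<And>t. t \<in> {a..b} \<Longrightarrow> norm (f s) \<le> norm (f t)"
    using continuous_attains_inf[of "{a..b}" "\<lambda>s. norm (f s)"] assms(3) by auto
  with assms(2) show thesis
    by (intro that[of "norm (f s)"]) auto
qed

lemma has_vector_derivative_at_interior:
  fixes f :: "real \<Rightarrow> 'a::real_normed_vector"
  assumes "(f has_vector_derivative f') (at t within {a..b})" "a < t" "t < b"
  shows "(f has_vector_derivative f') (at t)"
  using assms at_within_interior[of t "{a..b}"] by simp

lemma exp_commute:
  fixes X Y :: "'a::{real_normed_algebra_1,banach}"
  assumes "X * Y = Y * X"
  shows "X * exp Y = exp Y * X"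
proof -
  have "X * Y ^ n = Y ^ n * X" for n
    using assms by (induction n) (simp_all, metis mult.assoc)
  then show ?thesis
    by (simp add: exp_def suminf_mult[symmetric] suminf_mult2 summable_exp_generic)
qed

text \<open>The terms of degree at least 2 are dominated by the same series at the norm of
  \<open>h\<close>, so the claim reduces to the scalar exponential.\<close>

lemma exp_has_derivative_0:
  "(exp has_derivative (\<lambda>h. h)) (at (0 :: 'a::{real_normed_algebra_1,banach}))"
proof -
  let ?r = "\<lambda>x :: real. exp x - 1 - x"
  have remainder: "norm (exp h - 1 - h) \<le> ?r (norm h)" for h :: 'a
  proof -
    have split: "exp y - 1 - y = (\<Sum>n. y ^ (n + 2) /\<^sub>R fact (n + 2))"
      for y :: "'b::{real_normed_algebra_1,banach}"
      using suminf_split_initial_segment[OF summable_exp_generic[of y], of 2]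
      by (simp add: exp_def eval_nat_numeral algebra_simps)
    have summ: "summable (\<lambda>n. norm h ^ (n + 2) /\<^sub>R fact (n + 2))"
      using summable_exp_generic[of "norm h"] by (rule summable_ignore_initial_segment)
    have "norm (\<Sum>n. h ^ (n + 2) /\<^sub>R fact (n + 2)) \<le> (\<Sum>n. norm h ^ (n + 2) /\<^sub>R fact (n + 2))"
      by (rule norm_suminf_le[OF _ summ])
        (auto intro!: mult_left_mono norm_power_ineq simp del: power_Suc)
    then show ?thesis
      unfolding split[of h] split[of "norm h"] .
  qed
  have "((\<lambda>h :: 'a. ?r (norm h) / norm h) \<longlongrightarrow> 0) (at 0)"
  proof -
    have "(exp has_real_derivative 1) (at (0 :: real))"
      by (auto intro!: derivative_eq_intros)
    then have "((\<lambda>x :: real. (exp x - 1) / x) \<longlongrightarrow> 1) (at 0)"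
      by (simp add: has_field_derivative_iff)
    from tendsto_diff[OF this tendsto_const[of 1]]
    have "((\<lambda>x :: real. (exp x - 1) / x - 1) \<longlongrightarrow> 0) (at 0)"
      by simp
    then have "((\<lambda>x :: real. ?r x / x) \<longlongrightarrow> 0) (at 0)"
      by (rule Lim_transform_eventually)
        (auto simp: eventually_at_filter field_simps)
    moreover have "filterlim norm (at 0) (at (0 :: 'a))"
      by (auto simp: filterlim_at eventually_at_filter intro!: tendsto_norm_zero)
    ultimately show ?thesis
      by (rule filterlim_compose)
  qed
  then have "((\<lambda>h :: 'a. norm (exp h - 1 - h) / norm h) \<longlongrightarrow> 0) (at 0)"
    by (rule Lim_null_comparison[rotated])
      (auto simp: remainder intro!: always_eventually divide_right_mono)
  then show ?thesis
    by (simp add: has_derivative_at bounded_linear_ident)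
qed

text \<open>Commutation gives \<open>exp (X s) = exp (X t) * exp (X s - X t)\<close>, which leaves
  only the derivative of \<open>exp\<close> at 0.\<close>

lemma has_vector_derivative_exp:
  fixes X :: "real \<Rightarrow> 'a::{real_normed_algebra_1,banach}"
  assumes X: "(X has_vector_derivative X') (at t within S)"
    and comm: "\<And>s. s \<in> S \<Longrightarrow> X s * X t = X t * X s"
    and t: "t \<in> S"
  shows "((\<lambda>s. exp (X s)) has_vector_derivative exp (X t) * X') (at t within S)"
proof -
  have "((\<lambda>s. X s - X t) has_derivative (\<lambda>h. h *\<^sub>R X')) (at t within S)"
    using X by (auto simp: has_vector_derivative_def intro!: derivative_eq_intros)
  then have "((\<lambda>s. exp (X s - X t)) has_derivative (\<lambda>h. h *\<^sub>R X')) (at t within S)"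
    using exp_has_derivative_0
    by (intro has_derivative_compose[where f = "\<lambda>s. X s - X t" and g = exp and g' = "\<lambda>h. h"]) simp_all
  then have "((\<lambda>s. exp (X s - X t)) has_vector_derivative X') (at t within S)"
    by (simp add: has_vector_derivative_def)
  then have "((\<lambda>s. exp (X t) * exp (X s - X t)) has_vector_derivative exp (X t) * X') (at t within S)"
    by (rule bounded_linear.has_vector_derivative[OF bounded_linear_mult_right])
  moreover have "exp (X t) * exp (X s - X t) = exp (X s)" if "s \<in> S" for s
  proof -
    have "X t * (X s - X t) = (X s - X t) * X t"
      using comm[OF that] by (simp add: algebra_simps)
    from exp_add_commuting[OF this] show ?thesis by simp
  qed
  ultimately show ?thesis
    using t by - (rule has_vector_derivative_transform[rotated 2], assumption+, simp)
qed

lemma has_vector_derivative_within_iff_quotient: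
  "(f has_vector_derivative f') (at t within S) \<longleftrightarrow>
     ((\<lambda>s. (f s - f t) /\<^sub>R (s - t)) \<longlongrightarrow> f') (at t within S)"
proof -
  have "norm ((f s - f t) /\<^sub>R (s - t) - f') = norm (f s - f t - (s - t) *\<^sub>R f') / norm (s - t)"
    if "s \<noteq> t" for s
  proof -
    have "(f s - f t) /\<^sub>R (s - t) - f' = (f s - f t - (s - t) *\<^sub>R f') /\<^sub>R (s - t)"
      using that by (simp add: scaleR_diff_right)
    then show ?thesis
      by (simp add: divide_inverse mult.commute)
  qed
  then have "\<forall>\<^sub>F s in at t within S. norm ((f s - f t) /\<^sub>R (s - t) - f')
      = norm (f s - f t - (s - t) *\<^sub>R f') / norm (s - t)"
    by (auto simp: eventually_at_filter)
  from tendsto_cong[OF this, of 0] show ?thesis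
    by (simp add: has_vector_derivative_def has_derivative_iff_norm bounded_linear_scaleR_left
        tendsto_norm_zero_iff LIM_zero_iff)
qed

text \<open>Rests on \<open>g s - g t = - (g s * (f s - f t) * g t)\<close>. The bound on
  \<open>g\<close> first yields continuity of \<open>g\<close> at \<open>t\<close>; then the
  difference quotient converges.\<close>

lemma has_vector_derivative_right_inverse:
  fixes f g :: "real \<Rightarrow> 'a::real_normed_algebra_1"
  assumes f: "(f has_vector_derivative f') (at t within S)"
    and inv: "\<And>s. s \<in> S \<Longrightarrow> f s * g s = 1" "\<And>s. s \<in> S \<Longrightarrow> g s * f s = 1"
    and bnd: "\<And>s. s \<in> S \<Longrightarrow> norm (g s) \<le> c"
    and t: "t \<in> S"
  shows "(g has_vector_derivative - (g t * f' * g t)) (at t within S)"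
proof -
  have quot: "((\<lambda>s. (f s - f t) /\<^sub>R (s - t)) \<longlongrightarrow> f') (at t within S)"
    using f by (simp add: has_vector_derivative_within_iff_quotient)
  have diff: "g s - g t = - (g s * (f s - f t) * g t)" if "s \<in> S" for s
    using inv[OF that] inv[OF t] by (simp add: algebra_simps mult.assoc)
  have ev: "\<forall>\<^sub>F s in at t within S. s \<in> S"
    by (simp add: eventually_at_filter)
  have "(f \<longlongrightarrow> f t) (at t within S)"
    using has_vector_derivative_continuous[OF f] by (simp add: continuous_within)
  then have "((\<lambda>s. c * norm (f s - f t) * norm (g t)) \<longlongrightarrow> c * norm (f t - f t) * norm (g t)) (at t within S)"
    by (intro tendsto_intros)
  then have "((\<lambda>s. c * norm (f s - f t) * norm (g t)) \<longlongrightarrow> 0) (at t within S)"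
    by simp
  then have "((\<lambda>s. g s - g t) \<longlongrightarrow> 0) (at t within S)"
  proof (rule Lim_null_comparison[rotated], intro eventually_mono[OF ev])
    fix s assume s: "s \<in> S"
    have "norm (g s - g t) \<le> norm (g s) * norm (f s - f t) * norm (g t)"
      unfolding diff[OF s] norm_minus_cancel
      by (intro order_trans[OF norm_mult_ineq] mult_right_mono norm_mult_ineq norm_ge_zero)
    also have "\<dots> \<le> c * norm (f s - f t) * norm (g t)"
      by (intro mult_right_mono bnd s norm_ge_zero)
    finally show "norm (g s - g t) \<le> c * norm (f s - f t) * norm (g t)" .
  qed
  then have g: "(g \<longlongrightarrow> g t) (at t within S)"
    by (simp add: LIM_zero_iff)
  have "((\<lambda>s. - (g s * ((f s - f t) /\<^sub>R (s - t)) * g t)) \<longlongrightarrow> - (g t * f' * g t)) (at t within S)"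
    by (intro tendsto_intros g quot)
  then show ?thesis
    unfolding has_vector_derivative_within_iff_quotient
    by (rule Lim_transform_eventually) (rule eventually_mono[OF ev], simp add: diff)
qed

section \<open>The Stroh operator\<close>

text \<open>Pairs of a displacement and a stress function, regarded as a real vector space on which
  complex scalars act as operators.\<close>

type_synonym 'l state = "(complex^'l) \<times> (complex^'l)"

section \<open>Real matrices acting on complex vectors\<close>

abbreviation cmul :: "real^'n^'m \<Rightarrow> complex^'n \<Rightarrow> complex^'m" where
  "cmul A x \<equiv> complex_mat A *v x"

lemma bounded_linear_cmul: "bounded_linear (cmul A)"
proof -
  have "linear (cmul A)"
    by (rule linearI)
      (simp_all add: matrix_vector_mult_def vec_eq_iff scaleR_sum_right algebra_simps sum.distrib)
  then show ?thesis
    by (rule linear_conv_bounded_linear[THEN iffD1])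
qed

lemmas linear_cmul = bounded_linear.linear[OF bounded_linear_cmul]

lemmas cmul_simps =
  linear_0[OF linear_cmul] linear_neg[OF linear_cmul] linear_add[OF linear_cmul]
  linear_diff[OF linear_cmul] linear_scale[OF linear_cmul]

lemma cmul_scale: "cmul A (c *s x) = c *s cmul A x"
  by (rule vector_scalar_commute)

definition Re_vec :: "complex^'n \<Rightarrow> real^'n" where "Re_vec x = (\<chi> i. Re (x $ i))"
definition Im_vec :: "complex^'n \<Rightarrow> real^'n" where "Im_vec x = (\<chi> i. Im (x $ i))"

lemma inner_Re_Im: "x \<bullet> y = Re_vec x \<bullet> Re_vec y + Im_vec x \<bullet> Im_vec y"
  by (simp add: inner_vec_def Re_vec_def Im_vec_def inner_complex_def sum.distrib)

lemma Re_Im_cmul [simp]: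
  "Re_vec (cmul A x) = A *v Re_vec x" "Im_vec (cmul A x) = A *v Im_vec x"
  by (simp_all add: Re_vec_def Im_vec_def matrix_vector_mult_def vec_eq_iff)

lemma Re_Im_add [simp]:
  "Re_vec (x + y) = Re_vec x + Re_vec y" "Im_vec (x + y) = Im_vec x + Im_vec y"
  by (simp_all add: Re_vec_def Im_vec_def vec_eq_iff)

lemma Re_Im_eq_0: "Re_vec x = 0 \<Longrightarrow> Im_vec x = 0 \<Longrightarrow> x = 0"
  by (simp add: Re_vec_def Im_vec_def vec_eq_iff complex_eq_iff)

lemma inner_cmul_symmetric:
  assumes "symmetric_mat A"
  shows "cmul A x \<bullet> y = x \<bullet> cmul A y"
proof -
  have "(A *v a) \<bullet> b = a \<bullet> (A *v b)" for a b
    using assms dot_lmul_matrix[of a A b] by (simp add: symmetric_mat_def flip: transpose_matrix_vector)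
  then show ?thesis
    by (simp add: inner_Re_Im)
qed

text \<open>Unfolds the block form on the stacked vector \<open>y\<close>; the existential keeps the
  sum type of indices out of the sequel.\<close>

lemma block_mat_form:
  fixes g h :: "real^'l"
  shows "\<exists>y. (y = 0 \<longleftrightarrow> g = 0 \<and> h = 0) \<and>
    y \<bullet> (block_mat A B C D *v y) = g \<bullet> (A *v g + B *v h) + h \<bullet> (C *v g + D *v h)"
proof (intro exI conjI)
  let ?y = "(\<chi> i. case i of Inl p \<Rightarrow> g $ p | Inr p \<Rightarrow> h $ p) :: real^('l + 'l)"
  have sum_UNIV: "(\<Sum>i\<in>UNIV. f i) = (\<Sum>i\<in>UNIV. f (Inl i)) + (\<Sum>i\<in>UNIV. f (Inr i))"
    for f :: "'l + 'l \<Rightarrow> real"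
    by (simp add: sum.Plus flip: UNIV_Plus_UNIV)
  show "?y = 0 \<longleftrightarrow> g = 0 \<and> h = 0"
    by (auto simp: vec_eq_iff split: sum.splits)
  show "?y \<bullet> (block_mat A B C D *v ?y) = g \<bullet> (A *v g + B *v h) + h \<bullet> (C *v g + D *v h)"
    by (simp add: inner_vec_def matrix_vector_mult_def block_mat_def sum_UNIV)
qed

lemma bijective_endo:
  fixes X :: "'a::euclidean_space endo"
  assumes "\<And>x. X \<cdot> x = 0 \<Longrightarrow> x = 0"
  shows "\<exists>Y. Y * X = 1 \<and> X * Y = 1"
proof -
  have lin: "linear ((\<cdot>) X)"
    by (rule bounded_linear.linear) (rule endo.bounded_linear_right)
  then have "inj ((\<cdot>) X)"
    using assms by (simp add: linear_injective_0)
  with lin obtain g where g: "linear g" "\<And>x. g (X \<cdot> x) = x" "\<And>x. X \<cdot> g x = x"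
    using linear_injective_isomorphism[OF lin] by metis
  then have "endo_of g \<cdot> x = g x" for x
    by (simp add: endo_apply_endo_of linear_conv_bounded_linear)
  then have "endo_of g * X = 1" "X * endo_of g = 1"
    using g by (auto intro!: endo_eqI)
  then show ?thesis by blast
qed

definition iendo :: "'l::finite state endo" where
  "iendo = endo_of (\<lambda>x. (\<i> *s fst x, \<i> *s snd x))"

lemma bounded_linear_scale: "bounded_linear (\<lambda>x :: complex^'l. c *s x)"
  by (rule linear_conv_bounded_linear[THEN iffD1], rule linearI)
    (simp_all add: vec_eq_iff algebra_simps)

lemma iendo_apply [simp]: "iendo \<cdot> x = (\<i> *s fst x, \<i> *s snd x)"
  unfolding iendo_def
  by (intro endo_apply_endo_of bounded_linear_Pair bounded_linear_compose[OF bounded_linear_scale]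
      bounded_linear_fst bounded_linear_snd)

text \<open>Complex scalars as elements of the real operator algebra, so that they can be multiplied
  with \<open>K\<close> inside \<open>exp\<close>.\<close>

definition cscale :: "complex \<Rightarrow> 'l::finite state endo" where
  "cscale c = Re c *\<^sub>R 1 + Im c *\<^sub>R iendo"

lemma scaleR_eq_scale: "r *\<^sub>R x = complex_of_real r *s (x :: complex^'l)"
  by (simp add: vec_eq_iff scaleR_conv_of_real[where 'a = complex])

lemma cscale_apply [simp]: "cscale c \<cdot> x = (c *s fst x, c *s snd x)" for x :: "'l::finite state"
proof -
  have "of_real (Re c) *s y + of_real (Im c) *s (\<i> *s y) = c *s y" for y :: "complex^'l"
    by (simp add: complex_eq_iff vec_eq_iff)
  then show ?thesis
    by (simp add: cscale_def endo.add_left endo.scaleR_left prod_eq_iff scaleR_eq_scale)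
qed

text \<open>The inner product is the real one, so this is the real part of a Hermitian form. It is
  indefinite, and it vanishes when \<open>(u, 0)\<close> is paired with itself.\<close>

definition pairing :: "'l::finite state \<Rightarrow> 'l state \<Rightarrow> real" where
  "pairing x y = fst x \<bullet> snd y + snd x \<bullet> fst y"

lemma bounded_bilinear_pairing:
  "bounded_bilinear (pairing :: 'l::finite state \<Rightarrow> 'l state \<Rightarrow> real)"
proof -
  have "bounded_bilinear (\<lambda>x y :: 'l state. x \<bullet> (snd y, fst y))"
    by (intro bounded_bilinear.comp[OF bounded_bilinear_inner] bounded_linear_Pair
        bounded_linear_fst bounded_linear_snd bounded_linear_ident)
  then show ?thesis
    by (simp add: pairing_def[abs_def] inner_prod_def)
qed

interpretation pairing: bounded_bilinear pairing
  by (rule bounded_bilinear_pairing)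

section \<open>The energy form and the Stroh operator\<close>

locale formally_positive_tuple =
  fixes A11 A12 A22 :: "real^'l^'l"
  assumes sym: "symmetric_mat A11" "symmetric_mat A12" "symmetric_mat A22"
    and pos: "formal_positive A11 A12 A22"
begin

definition energy :: "complex^'l \<Rightarrow> complex^'l \<Rightarrow> real" where
  "energy g h = g \<bullet> (cmul A11 g + cmul A12 h) + h \<bullet> (cmul A12 g + cmul A22 h)"

text \<open>The matrices are real, so the form splits into the block form at the real parts plus the
  block form at the imaginary parts.\<close>

lemma energy_pos:
  assumes "g \<noteq> 0 \<or> h \<noteq> 0"
  shows "energy g h > 0"
proof -
  define E where "E a b = a \<bullet> (A11 *v a + A12 *v b) + b \<bullet> (A12 *v a + A22 *v b)" for a b
  have E: "E a b > 0" if "a \<noteq> 0 \<or> b \<noteq> 0" for a b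
    using pos block_mat_form[of a b A11 A12 A12 A22] that
    unfolding formal_positive_def positive_definite_def E_def by metis
  have E0: "E 0 0 = 0"
    by (simp add: E_def)
  have "energy g h = E (Re_vec g) (Re_vec h) + E (Im_vec g) (Im_vec h)"
    by (simp add: energy_def E_def inner_Re_Im)
  moreover have "Re_vec g \<noteq> 0 \<or> Re_vec h \<noteq> 0 \<or> Im_vec g \<noteq> 0 \<or> Im_vec h \<noteq> 0"
    using assms Re_Im_eq_0 by blast
  ultimately show ?thesis
    using E[of "Re_vec g" "Re_vec h"] E[of "Im_vec g" "Im_vec h"] E0 by fastforce
qed

text \<open>If (g, h) is the gradient of u and \<open>\<phi>\<close> is a stress function, that is, the stresses A11 g + A12 h
  and A12 g + A22 h are \<open>\<partial>\<^sub>2 \<phi>\<close> and \<open>- \<partial>\<^sub>1 \<phi>\<close>, then N maps \<open>\<partial>\<^sub>1 (u, \<phi>)\<close> to \<open>\<partial>\<^sub>2 (u, \<phi>)\<close>.\<close>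

definition N :: "'l::finite state endo" where
  "N = endo_of (\<lambda>x. let h = - inv (cmul A22) (cmul A12 (fst x) + snd x) in
     (h, cmul A11 (fst x) + cmul A12 h))"

text \<open>For \<open>g = 0\<close> the energy reduces to the form of \<open>A22\<close>.\<close>

lemma inj_cmul_A22: "inj (cmul A22)"
proof (rule linear_cmul[THEN linear_injective_0, THEN iffD2], intro allI impI)
  fix x assume "cmul A22 x = 0"
  then have "energy 0 x = 0"
    by (simp add: energy_def cmul_simps)
  with energy_pos[of 0 x] show "x = 0"
    by fastforce
qed

lemma cmul_A22_inverse:
  "bounded_linear (inv (cmul A22))" "inv (cmul A22) (cmul A22 x) = x" "cmul A22 (inv (cmul A22) x) = x"
proof -
  obtain f where f: "linear f" "\<And>x. f (cmul A22 x) = x" "\<And>x. cmul A22 (f x) = x"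
    using linear_injective_isomorphism[OF linear_cmul inj_cmul_A22] by metis
  then have inv: "inv (cmul A22) = f"
    by (intro inv_equality)
  from f(1) have "bounded_linear f"
    by (rule linear_conv_bounded_linear[THEN iffD1])
  then show "bounded_linear (inv (cmul A22))" "inv (cmul A22) (cmul A22 x) = x"
    "cmul A22 (inv (cmul A22) x) = x"
    unfolding inv using f by auto
qed

lemma N_eq:
  "N \<cdot> x = (- inv (cmul A22) (cmul A12 (fst x) + snd x),
     cmul A11 (fst x) + cmul A12 (- inv (cmul A22) (cmul A12 (fst x) + snd x)))"
proof -
  have c: "bounded_linear (\<lambda>x :: 'l state. cmul A (fst x))" for A :: "real^'l^'l"
    using bounded_linear_compose[OF bounded_linear_cmul bounded_linear_fst] .
  have "bounded_linear (\<lambda>x :: 'l state. cmul A12 (fst x) + snd x)"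
    by (rule bounded_linear_add[OF c bounded_linear_snd])
  from bounded_linear_minus[OF bounded_linear_compose[OF cmul_A22_inverse(1) this]]
  have h: "bounded_linear (\<lambda>x :: 'l state. - inv (cmul A22) (cmul A12 (fst x) + snd x))" .
  have "bounded_linear (\<lambda>x :: 'l state. let h = - inv (cmul A22) (cmul A12 (fst x) + snd x) in
     (h, cmul A11 (fst x) + cmul A12 h))"
    unfolding Let_def
    by (rule bounded_linear_Pair[OF h bounded_linear_add[OF c
          bounded_linear_compose[OF bounded_linear_cmul h]]])
  from endo_apply_endo_of[OF this] show ?thesis
    by (simp only: N_def Let_def)
qed

lemma N_apply: "N \<cdot> (g, - (cmul A12 g + cmul A22 h)) = (h, cmul A11 g + cmul A12 h)"
proof -
  have "- inv (cmul A22) (cmul A12 g + - (cmul A12 g + cmul A22 h)) = h"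
    using cmul_A22_inverse(2)[of "- h"] by (simp add: linear_neg[OF linear_cmul])
  then show ?thesis
    unfolding N_eq fst_conv snd_conv by simp
qed

text \<open>Every state comes from a gradient \<open>(g, h)\<close>, where \<open>h\<close> is found
  by inverting \<open>A22\<close>. With this parametrization the later computations avoid the
  inverse.\<close>

lemma N_cases:
  "\<exists>g h. x = (g, - (cmul A12 g + cmul A22 h)) \<and> N \<cdot> x = (h, cmul A11 g + cmul A12 h)"
proof -
  define g where "g = fst x"
  define h where "h = - inv (cmul A22) (cmul A12 g + snd x)"
  have "cmul A22 h = - (cmul A12 g + snd x)"
    unfolding h_def linear_neg[OF linear_cmul] cmul_A22_inverse(3) ..
  then have x: "x = (g, - (cmul A12 g + cmul A22 h))"
    by (simp add: g_def)
  moreover from x have "N \<cdot> x = (h, cmul A11 g + cmul A12 h)"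
    using N_apply by metis
  ultimately show ?thesis
    by blast
qed

text \<open>In terms of gradients \<open>(g, h)\<close> of \<open>x\<close> and
  \<open>(a, b)\<close> of \<open>y\<close> both sides equal
  \<open>g \<bullet> cmul A11 a - h \<bullet> cmul A22 b\<close>; the terms with \<open>A12\<close>
  cancel by symmetry.\<close>

lemma pairing_N: "pairing (N \<cdot> x) y = pairing x (N \<cdot> y)"
proof -
  obtain g h where x: "x = (g, - (cmul A12 g + cmul A22 h))" "N \<cdot> x = (h, cmul A11 g + cmul A12 h)"
    using N_cases by blast
  obtain a b where y: "y = (a, - (cmul A12 a + cmul A22 b))" "N \<cdot> y = (b, cmul A11 a + cmul A12 b)"
    using N_cases by blast
  show ?thesis
    unfolding x(2) y(2) unfolding x(1) y(1)
    using inner_cmul_symmetric[OF sym(1), of g a] inner_cmul_symmetric[OF sym(2), of h a]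
      inner_cmul_symmetric[OF sym(2), of g b] inner_cmul_symmetric[OF sym(3), of h b]
    by (simp add: pairing_def inner_add_left inner_add_right inner_diff_left inner_diff_right)
qed

section \<open>The pencil \<open>Q\<close> and its inverse\<close>

definition Q :: "complex \<Rightarrow> 'l::finite state endo" where
  "Q z = Re z *\<^sub>R 1 + Im z *\<^sub>R N"

text \<open>The two-sided inverse for \<open>z \<noteq> 0\<close>; at 0 the value is
  arbitrary.\<close>

definition R :: "complex \<Rightarrow> 'l::finite state endo" where
  "R z = (SOME Y. Y * Q z = 1 \<and> Q z * Y = 1)"

lemma Q_apply: "Q z \<cdot> x = Re z *\<^sub>R x + Im z *\<^sub>R (N \<cdot> x)"
  by (simp add: Q_def endo.add_left endo.scaleR_left)

lemma Q_add: "Q (z + w) = Q z + Q w" and Q_minus: "Q (- z) = - Q z"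
  and Q_scaleR: "Q (of_real r * z) = r *\<^sub>R Q z" and Q_1: "Q 1 = 1"
  by (simp_all add: Q_def algebra_simps)

text \<open>If a g + b h is the first component of x and the second one vanishes, then the stresses are
  a t and b t for some t, so that the pairing of x with c x + d N x is a multiple of the energy of
  (g, h).\<close>

lemma pairing_Q_aux:
  assumes z: "z \<noteq> 0" and y: "Q z \<cdot> y = (u, 0)"
  shows "\<exists>e. (y \<noteq> 0 \<longrightarrow> e > 0) \<and> (u = 0 \<longrightarrow> e = 0) \<and>
    (\<forall>w. pairing (u, 0) (Q w \<cdot> y) = Im (cnj z * w) * e)"
proof -
  obtain g h where x: "y = (g, - (cmul A12 g + cmul A22 h))" "N \<cdot> y = (h, cmul A11 g + cmul A12 h)"
    using N_cases by blast
  define s1 where "s1 = cmul A11 g + cmul A12 h"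
  define s2 where "s2 = cmul A12 g + cmul A22 h"
  define a where "a = Re z"
  define b where "b = Im z"
  define D where "D = a\<^sup>2 + b\<^sup>2"
  have ab: "D \<noteq> 0"
    using z by (simp add: D_def a_def b_def complex_eq_iff)
  have u: "u = a *\<^sub>R g + b *\<^sub>R h" and s: "b *\<^sub>R s1 = a *\<^sub>R s2"
    using y unfolding Q_apply x(2) unfolding x(1)
    by (simp_all add: a_def b_def s1_def s2_def scaleR_add_right scaleR_diff_right algebra_simps)
  \<comment> \<open>By \<open>s\<close> the stress \<open>(s1, s2)\<close> is parallel to
    \<open>(a, b)\<close>; \<open>t\<close> is its vector-valued coefficient.\<close>
  define t where "t = (1 / D) *\<^sub>R (a *\<^sub>R s1 + b *\<^sub>R s2)"
  have "a *\<^sub>R (a *\<^sub>R s1 + b *\<^sub>R s2) = D *\<^sub>R s1"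
    using arg_cong[OF s, of "scaleR b"] by (simp add: D_def algebra_simps power2_eq_square)
  from arg_cong[OF this, of "scaleR (1 / D)"] have s1: "s1 = a *\<^sub>R t"
    using ab by (simp add: t_def)
  have "b *\<^sub>R (a *\<^sub>R s1 + b *\<^sub>R s2) = D *\<^sub>R s2"
    using arg_cong[OF s, of "scaleR a"] by (simp add: D_def algebra_simps power2_eq_square)
  from arg_cong[OF this, of "scaleR (1 / D)"] have s2: "s2 = b *\<^sub>R t"
    using ab by (simp add: t_def)
  have "energy g h = g \<bullet> s1 + h \<bullet> s2"
    by (simp add: energy_def s1_def s2_def)
  also have "\<dots> = u \<bullet> t"
    by (simp add: s1 s2 u inner_add_left)
  finally have e: "energy g h = u \<bullet> t" .
  have "pairing (u, 0) (Q w \<cdot> y) = Im (cnj z * w) * energy g h" for w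
  proof -
    have "pairing (u, 0) (Q w \<cdot> y) = u \<bullet> (Im w *\<^sub>R s1 - Re w *\<^sub>R s2)"
      unfolding Q_apply x(2) unfolding x(1)
      by (simp add: pairing_def s1_def s2_def algebra_simps)
    also have "\<dots> = Im (cnj z * w) * energy g h"
      unfolding e by (simp add: s1 s2 a_def b_def inner_diff_right algebra_simps)
    finally show ?thesis .
  qed
  moreover have "g \<noteq> 0 \<or> h \<noteq> 0" if "y \<noteq> 0"
    using that x by (auto simp: cmul_simps zero_prod_def)
  ultimately show ?thesis
    using energy_pos[of g h] e by (intro exI[of _ "energy g h"]) auto
qed

text \<open>For \<open>u = 0\<close> the number \<open>e\<close> of the previous lemma is 0, yet
  positive unless \<open>y = 0\<close>. In particular \<open>N\<close> has no real
  eigenvalue.\<close>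

lemma Q_injective: "z \<noteq> 0 \<Longrightarrow> Q z \<cdot> y = 0 \<Longrightarrow> y = 0"
  using pairing_Q_aux[of z y 0] by (auto simp: zero_prod_def)

lemma R_inverse:
  assumes z: "z \<noteq> 0"
  shows "R z * Q z = 1" "Q z * R z = 1"
proof -
  have "\<exists>Y. Y * Q z = 1 \<and> Q z * Y = 1"
    by (rule bijective_endo) (rule Q_injective[OF z])
  from someI_ex[OF this] show "R z * Q z = 1" "Q z * R z = 1"
    by (simp_all add: R_def)
qed

lemma R_unique:
  assumes "z \<noteq> 0" "Y * Q z = 1"
  shows "Y = R z"
proof -
  have "Y = Y * (Q z * R z)"
    using R_inverse[OF assms(1)] by simp
  also have "\<dots> = R z"
    using assms(2) by (simp flip: mult.assoc)
  finally show ?thesis .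
qed

text \<open>The factor \<open>e\<close> is the energy of the gradient belonging to
  \<open>R z \<cdot> (u, 0)\<close> and is the same for all \<open>w\<close>, so the sign is decided
  by the oriented angle from \<open>z\<close> to \<open>w\<close>.\<close>

lemma pairing_Q_R:
  assumes z: "z \<noteq> 0" and u: "u \<noteq> 0"
  obtains e where "e > 0" "\<And>w. pairing (u, 0) ((Q w * R z) \<cdot> (u, 0)) = Im (cnj z * w) * e"
proof -
  have Qy: "Q z \<cdot> (R z \<cdot> (u, 0)) = (u, 0)"
    using R_inverse(2)[OF z] by (simp flip: endo_apply_times)
  then have "R z \<cdot> (u, 0) \<noteq> 0"
    using u by (metis endo.zero_right prod.inject zero_prod_def)
  with pairing_Q_aux[OF z Qy] obtain e where
    "e > 0" "\<forall>w. pairing (u, 0) (Q w \<cdot> (R z \<cdot> (u, 0))) = Im (cnj z * w) * e"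
    by blast
  then show thesis
    using that[of e] by (metis endo_apply_times)
qed

lemma R_scaleR:
  assumes "z \<noteq> 0" "r \<noteq> 0"
  shows "R (of_real r * z) = R z /\<^sub>R r"
  using assms R_inverse[OF assms(1)]
  by (intro R_unique[symmetric]) (simp_all add: Q_scaleR)

text \<open>By compactness \<open>Q z \<cdot> x\<close> is bounded below for unit \<open>z\<close>
  and unit \<open>x\<close>; homogeneity in both arguments does the rest.\<close>

lemma norm_R_le: "\<exists>c\<ge>0. \<forall>z. z \<noteq> 0 \<longrightarrow> norm (R z) \<le> c / norm z"
proof -
  let ?S = "sphere (0 :: complex) 1 \<times> sphere (0 :: 'l state) 1"
  let ?f = "\<lambda>p. norm (Q (fst p) \<cdot> snd p)"
  have cont: "continuous_on ?S ?f"
    unfolding Q_apply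
    by (intro continuous_on_norm continuous_on_add continuous_on_scaleR continuous_on_Re continuous_on_Im
        continuous_on_fst continuous_on_snd continuous_on_id
        bounded_linear.continuous_on[OF endo.bounded_linear_right])
  have "compact ?S"
    by (intro compact_Times compact_sphere)
  moreover have "?S \<noteq> {}"
    using vector_choose_size[of 1, where 'a = complex] vector_choose_size[of 1, where 'a = "'l state"]
    by fastforce
  ultimately obtain p where p: "p \<in> ?S" "\<And>q. q \<in> ?S \<Longrightarrow> ?f p \<le> ?f q"
    using continuous_attains_inf[OF _ _ cont] by blast
  have m: "?f p > 0"
  proof -
    have "fst p \<noteq> 0" "snd p \<noteq> 0"
      using p(1) by auto
    then show ?thesis
      using Q_injective[of "fst p" "snd p"] by fastforce
  qed
  have low: "?f p * norm x \<le> norm (Q z \<cdot> x)" if z: "norm z = 1" for z x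
  proof (cases "x = 0")
    case False
    then have "?f p \<le> norm (Q z \<cdot> (x /\<^sub>R norm x))"
      using p(2)[of "(z, x /\<^sub>R norm x)"] z by simp
    also have "\<dots> = norm (Q z \<cdot> x) / norm x"
      by (simp add: endo.scaleR_right divide_inverse mult.commute)
    finally show ?thesis
      using False by (simp add: field_simps)
  qed (simp add: endo.zero_right)
  have "norm (R z) \<le> (1 / ?f p) / norm z" if z: "z \<noteq> 0" for z
  proof -
    have z': "z = of_real (norm z) * sgn z" "sgn z \<noteq> 0" "norm (sgn z) = 1"
      using z by (simp add: sgn_div_norm scaleR_conv_of_real, simp add: sgn_zero_iff, simp add: norm_sgn)
    have "norm (R (sgn z)) \<le> 1 / ?f p"
    proof (rule norm_endo_le)
      show "norm (R (sgn z) \<cdot> x) \<le> 1 / ?f p * norm x" for x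
        using low[OF z'(3), of "R (sgn z) \<cdot> x"] m R_inverse(2)[OF z'(2)]
        by (simp add: field_simps flip: endo_apply_times)
    qed (use m in simp)
    moreover have "R z = R (sgn z) /\<^sub>R norm z"
      using R_scaleR[OF z'(2), of "norm z"] z z'(1) by simp
    ultimately show ?thesis
      using z by (simp add: field_simps)
  qed
  then show ?thesis
    using m by (intro exI[of _ "1 / ?f p"]) simp
qed

end

section \<open>Adjoints with respect to the pairing\<close>

definition adjoint_pair :: "'l::finite state endo \<Rightarrow> 'l state endo \<Rightarrow> bool" where
  "adjoint_pair X Y \<longleftrightarrow> (\<forall>x y. pairing (X \<cdot> x) y = pairing x (Y \<cdot> y))"

lemma adjoint_pairD: "adjoint_pair X Y \<Longrightarrow> pairing (X \<cdot> x) y = pairing x (Y \<cdot> y)"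
  unfolding adjoint_pair_def by blast

lemma adjoint_pair_1: "adjoint_pair 1 1"
  by (simp add: adjoint_pair_def)

lemma adjoint_pair_scaleR: "adjoint_pair X Y \<Longrightarrow> adjoint_pair (c *\<^sub>R X) (c *\<^sub>R Y)"
  by (simp add: adjoint_pair_def endo.scaleR_left pairing.scaleR_left pairing.scaleR_right)

lemma adjoint_pair_add:
  "adjoint_pair X Y \<Longrightarrow> adjoint_pair X' Y' \<Longrightarrow> adjoint_pair (X + X') (Y + Y')"
  by (simp add: adjoint_pair_def endo.add_left pairing.add_left pairing.add_right)

lemma adjoint_pair_mult:
  "adjoint_pair X Y \<Longrightarrow> adjoint_pair X' Y' \<Longrightarrow> adjoint_pair (X * X') (Y' * Y)"
  by (simp add: adjoint_pair_def del: split_paired_All)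

lemma adjoint_pair_power: "adjoint_pair X Y \<Longrightarrow> adjoint_pair (X ^ n) (Y ^ n)"
proof (induction n)
  case (Suc n)
  then show ?case
    using adjoint_pair_mult[of X Y "X ^ n" "Y ^ n"] by (simp add: power_commutes)
qed (simp add: adjoint_pair_1)

lemma bounded_linear_pairing_endo:
  "bounded_linear (\<lambda>Z. pairing (Z \<cdot> x) y)" "bounded_linear (\<lambda>Z. pairing x (Z \<cdot> y))"
  using bounded_linear_compose[OF pairing.bounded_linear_left endo.bounded_linear_left]
    bounded_linear_compose[OF pairing.bounded_linear_right endo.bounded_linear_left]
  by blast+

text \<open>Holds for each term of the exponential series and passes to the sum, since the pairing
  is continuous in the operator.\<close>

lemma adjoint_pair_exp:
  fixes X Y :: "'l::finite state endo"
  assumes "adjoint_pair X Y"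
  shows "adjoint_pair (exp X) (exp Y)"
  unfolding adjoint_pair_def
proof (intro allI)
  fix x y :: "'l state"
  note lin = bounded_linear_pairing_endo[of x y]
  have "pairing ((X ^ n /\<^sub>R fact n) \<cdot> x) y = pairing x ((Y ^ n /\<^sub>R fact n) \<cdot> y)" for n
    by (intro adjoint_pairD adjoint_pair_scaleR adjoint_pair_power assms)
  then show "pairing (exp X \<cdot> x) y = pairing x (exp Y \<cdot> y)"
    using bounded_linear.sums[OF lin(1) exp_converges[of X]]
      bounded_linear.sums[OF lin(2) exp_converges[of Y]]
    by (metis (no_types, lifting) sums_unique2 sums_cong)
qed

text \<open>Multiplication by \<i> is skew for the real inner product, whence the conjugate.\<close>

lemma adjoint_pair_cscale:
  "adjoint_pair (cscale c) (cscale (cnj c) :: 'l::finite state endo)"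
proof -
  have "(c *s x) \<bullet> y = x \<bullet> (cnj c *s y)" for x y :: "complex^'l"
    by (simp add: inner_vec_def inner_complex_def algebra_simps)
  then show ?thesis
    by (simp add: adjoint_pair_def pairing_def)
qed

lemma cscale_add: "cscale (c + d) = cscale c + cscale d"
  by (simp add: cscale_def algebra_simps)

lemma cscale_minus: "cscale (- c) = - cscale c"
  by (simp add: cscale_def)

lemma cscale_of_real: "cscale (of_real r) = r *\<^sub>R 1"
  by (simp add: cscale_def)

lemma cscale_1: "cscale 1 = 1"
  by (simp add: cscale_def)

lemma cscale_scaleR: "cscale (of_real r * c) = r *\<^sub>R cscale c"
  by (simp add: cscale_def scaleR_add_right)

context formally_positive_tuple
begin

section \<open>The bicommutant of the Stroh operator\<close>

text \<open>\<open>N\<close> is built from real matrices, hence it is complex linear.\<close>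

lemma N_iendo: "N * iendo = iendo * N"
proof (rule endo_eqI)
  fix x
  obtain g h where x: "x = (g, - (cmul A12 g + cmul A22 h))" "N \<cdot> x = (h, cmul A11 g + cmul A12 h)"
    using N_cases by blast
  have s: "\<i> *s a + \<i> *s b = \<i> *s (a + b)" "- (\<i> *s a) = \<i> *s (- a)" for a b :: "complex^'l"
    by (simp_all add: vec_eq_iff algebra_simps)
  have "iendo \<cdot> x = (\<i> *s g, - (cmul A12 (\<i> *s g) + cmul A22 (\<i> *s h)))"
    unfolding iendo_apply x(1) fst_conv snd_conv cmul_scale s ..
  then have "N \<cdot> (iendo \<cdot> x) = (\<i> *s h, cmul A11 (\<i> *s g) + cmul A12 (\<i> *s h))"
    using N_apply by metis
  also have "\<dots> = iendo \<cdot> (N \<cdot> x)"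
    unfolding iendo_apply x(2) fst_conv snd_conv cmul_scale s ..
  finally show "(N * iendo) \<cdot> x = (iendo * N) \<cdot> x"
    by simp
qed

text \<open>The commutant of the commutant of \<open>N\<close> and \<open>iendo\<close>: a
  commutative algebra closed under \<open>exp\<close> and integrals that contains \<open>Q\<close>
  and \<open>R\<close>. Commutation of all operators below is settled by membership.\<close>

definition bicomm :: "'l state endo set" where
  "bicomm = {Y. \<forall>X. X * N = N * X \<and> X * iendo = iendo * X \<longrightarrow> X * Y = Y * X}"

text \<open>Since \<open>N\<close> and \<open>iendo\<close> commute, they lie in their own
  commutant. So \<open>X\<close> commutes with both, and is thus among the operators with which
  \<open>Y\<close> commutes.\<close>

lemma bicomm_commute:
  assumes X: "X \<in> bicomm" and Y: "Y \<in> bicomm"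
  shows "X * Y = Y * X"
proof -
  have "N * X = X * N" "iendo * X = X * iendo"
    using X by (auto simp: bicomm_def N_iendo)
  then show ?thesis
    using Y by (auto simp: bicomm_def)
qed

lemma bicomm_1: "1 \<in> bicomm" and bicomm_N: "N \<in> bicomm" and bicomm_iendo: "iendo \<in> bicomm"
  by (simp_all add: bicomm_def)

lemma bicomm_add: "X \<in> bicomm \<Longrightarrow> Y \<in> bicomm \<Longrightarrow> X + Y \<in> bicomm"
  and bicomm_diff: "X \<in> bicomm \<Longrightarrow> Y \<in> bicomm \<Longrightarrow> X - Y \<in> bicomm"
  and bicomm_scaleR: "X \<in> bicomm \<Longrightarrow> c *\<^sub>R X \<in> bicomm"
  and bicomm_minus: "X \<in> bicomm \<Longrightarrow> - X \<in> bicomm"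
  by (simp_all add: bicomm_def algebra_simps)

lemma bicomm_mult: "X \<in> bicomm \<Longrightarrow> Y \<in> bicomm \<Longrightarrow> X * Y \<in> bicomm"
  unfolding bicomm_def
proof (clarsimp)
  fix Z
  assume "\<forall>X'. X' * N = N * X' \<and> X' * iendo = iendo * X' \<longrightarrow> X' * X = X * X'"
    and "\<forall>X. X * N = N * X \<and> X * iendo = iendo * X \<longrightarrow> X * Y = Y * X"
    and "Z * N = N * Z" "Z * iendo = iendo * Z"
  then have "Z * X = X * Z" "Z * Y = Y * Z"
    by blast+
  from this(1) have "Z * (X * Y) = X * (Z * Y)"
    by (simp flip: mult.assoc)
  also have "\<dots> = X * Y * Z"
    by (simp add: \<open>Z * Y = Y * Z\<close> mult.assoc)
  finally show "Z * (X * Y) = X * Y * Z" .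
qed

lemma bicomm_exp: "X \<in> bicomm \<Longrightarrow> exp X \<in> bicomm"
  unfolding bicomm_def using exp_commute by blast

lemma bicomm_Q: "Q z \<in> bicomm"
  unfolding Q_def by (intro bicomm_add bicomm_scaleR bicomm_1 bicomm_N)

lemma bicomm_cscale: "cscale c \<in> bicomm"
  unfolding cscale_def by (intro bicomm_add bicomm_scaleR bicomm_1 bicomm_iendo)

lemma bicomm_R:
  assumes "z \<noteq> 0"
  shows "R z \<in> bicomm"
  unfolding bicomm_def
proof (clarsimp)
  fix X assume "X * N = N * X" "X * iendo = iendo * X"
  then have "X * Q z = Q z * X"
    using bicomm_Q by (auto simp: bicomm_def)
  then have "R z * (X * Q z) * R z = R z * (Q z * X) * R z"
    by simp
  then have "R z * X * (Q z * R z) = (R z * Q z) * X * R z"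
    by (simp only: mult.assoc)
  then show "X * R z = R z * X"
    using R_inverse[OF assms] by simp
qed

lemma bicomm_integral:
  assumes "f integrable_on S" "\<And>t. t \<in> S \<Longrightarrow> f t \<in> bicomm"
  shows "integral S f \<in> bicomm"
  unfolding bicomm_def
proof (clarsimp)
  fix X assume "X * N = N * X" "X * iendo = iendo * X"
  then have "integral S (\<lambda>t. X * f t) = integral S (\<lambda>t. f t * X)"
    using assms(2) by (intro integral_cong) (simp add: bicomm_def)
  then show "X * integral S f = integral S f * X"
    using integral_linear[OF assms(1) bounded_linear_mult_right[of X]]
      integral_linear[OF assms(1) bounded_linear_mult_left[of X]]
    by (simp add: o_def)
qed

lemma bounded_linear_Q: "bounded_linear Q"
  unfolding Q_def
  by (intro bounded_linear_add bounded_linear_scaleR_const bounded_linear_Re bounded_linear_Im)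

text \<open>The lower bound \<open>m\<close> turns the estimate \<open>norm_R_le\<close> into the
  uniform bound that the derivative of an inverse requires.\<close>

lemma has_vector_derivative_R:
  assumes f: "(f has_vector_derivative f') (at t within S)" and t: "t \<in> S"
    and m: "m > 0" "\<And>s. s \<in> S \<Longrightarrow> m \<le> norm (f s)"
  shows "((\<lambda>s. R (f s)) has_vector_derivative - (R (f t) * Q f' * R (f t))) (at t within S)"
proof -
  obtain c where c: "c \<ge> 0" "\<And>z. z \<noteq> 0 \<Longrightarrow> norm (R z) \<le> c / norm z"
    using norm_R_le by blast
  have nz: "f s \<noteq> 0" if "s \<in> S" for s
    using m(1) m(2)[OF that] by auto
  show ?thesis
  proof (rule has_vector_derivative_right_inverse[where f = "\<lambda>s. Q (f s)" and c = "c / m"])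
    show "((\<lambda>s. Q (f s)) has_vector_derivative Q f') (at t within S)"
      by (rule bounded_linear.has_vector_derivative[OF bounded_linear_Q f])
    show "norm (R (f s)) \<le> c / m" if "s \<in> S" for s
      using c(2)[OF nz[OF that]] divide_left_mono[OF m(2)[OF that] c(1)] m nz[OF that]
      by (meson mult_pos_pos order_trans zero_less_norm_iff)
  qed (use R_inverse nz t in auto)
qed

section \<open>The rotated Stroh operators and their primitive\<close>

text \<open>The logarithmic derivative of \<open>Q (cis \<theta>)\<close>, which is also the
  operator \<open>N\<close> of the coordinate frame rotated by \<theta>.\<close>

definition H :: "real \<Rightarrow> 'l state endo" where
  "H \<theta> = Q (\<i> * cis \<theta>) * R (cis \<theta>)"

text \<open>A logarithm of \<open>Q (cis \<theta>)\<close> for \<open>\<theta> \<ge> 0\<close>; for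
  negative \<theta> the interval is empty and the value is 0.\<close>

definition K :: "real \<Rightarrow> 'l state endo" where
  "K \<theta> = integral {0..\<theta>} H"

lemma bicomm_H: "H \<theta> \<in> bicomm"
  unfolding H_def by (intro bicomm_mult bicomm_Q bicomm_R) simp

lemma has_vector_derivative_Q_cis:
  "((\<lambda>t. Q (cis t)) has_vector_derivative H t * Q (cis t)) (at t within S)"
proof -
  have "H t * Q (cis t) = Q (\<i> * cis t)"
    using R_inverse(1)[of "cis t"] by (simp add: H_def mult.assoc)
  with bounded_linear.has_vector_derivative[OF bounded_linear_Q has_vector_derivative_cis]
  show ?thesis by simp
qed

text \<open>A Riccati equation. It keeps all derivatives of \<open>H\<close> polynomial in
  \<open>H\<close>, which later gives smoothness of every order.\<close>

lemma has_vector_derivative_H: "(H has_vector_derivative - 1 - H t * H t) (at t within S)"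
proof -
  have R': "((\<lambda>t. R (cis t)) has_vector_derivative - (R (cis t) * Q (\<i> * cis t) * R (cis t))) (at t)"
    by (rule has_vector_derivative_R[OF has_vector_derivative_cis, where m = 1]) auto
  have Q': "((\<lambda>t. Q (\<i> * cis t)) has_vector_derivative Q (- cis t)) (at t)"
    by (rule bounded_linear.has_vector_derivative[OF bounded_linear_Q])
      (auto intro!: derivative_eq_intros has_vector_derivative_cis simp: mult.assoc[symmetric])
  have "(H has_vector_derivative
      Q (\<i> * cis t) * - (R (cis t) * Q (\<i> * cis t) * R (cis t)) + Q (- cis t) * R (cis t)) (at t)"
    unfolding H_def by (rule has_vector_derivative_mult[OF Q' R'])
  moreover have "Q (\<i> * cis t) * - (R (cis t) * Q (\<i> * cis t) * R (cis t)) + Q (- cis t) * R (cis t)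
      = - 1 - H t * H t"
    using R_inverse(2)[of "cis t"] by (simp add: H_def Q_minus mult.assoc)
  ultimately show ?thesis
    by (auto intro: has_vector_derivative_at_within)
qed

lemma continuous_on_H: "continuous_on S H"
  by (rule continuous_on_if_has_vector_derivative) (rule has_vector_derivative_H)

lemma H_integrable: "H integrable_on {a..b}"
  by (rule integrable_continuous_real) (rule continuous_on_H)

lemma bicomm_K: "K \<theta> \<in> bicomm"
  unfolding K_def by (intro bicomm_integral H_integrable bicomm_H)

lemma K_0: "K 0 = 0"
  by (simp add: K_def)

lemma has_vector_derivative_K:
  assumes "t \<in> {a..b}" "0 \<le> a"
  shows "(K has_vector_derivative H t) (at t within {a..b})"
proof -
  have "((\<lambda>u. integral {0..u} H) has_vector_derivative H t) (at t within {0..b})"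
    using assms by (intro integral_has_vector_derivative continuous_on_H) auto
  then show ?thesis
    unfolding K_def[abs_def] by (rule has_vector_derivative_within_subset) (use assms in auto)
qed

text \<open>Both factors of \<open>H\<close> change sign together with \<open>cis t\<close>.\<close>

lemma H_add_pi: "H (t + pi) = H t"
proof -
  have c: "cis (t + pi) = of_real (- 1) * cis t"
    by (simp flip: cis_mult)
  have i: "\<i> * cis (t + pi) = of_real (- 1) * (\<i> * cis t)"
    by (simp flip: cis_mult)
  have "Q (\<i> * cis (t + pi)) = - Q (\<i> * cis t)"
    unfolding i Q_scaleR by simp
  moreover have "R (cis (t + pi)) = - R (cis t)"
    unfolding c by (subst R_scaleR) simp_all
  ultimately show ?thesis
    by (simp add: H_def)
qed

lemma K_2pi: "K (2 * pi) = 2 *\<^sub>R K pi"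
proof -
  have "integral {0..pi} H + integral {pi..2 * pi} H = integral {0..2 * pi} H"
    by (rule Henstock_Kurzweil_Integration.integral_combine) (auto intro: H_integrable)
  moreover have "integral {pi..2 * pi} H = integral {0..pi} H"
    using integral_shift_Icc_real[of 0 pi H pi] H_add_pi by (simp add: o_def add.commute)
  ultimately show ?thesis
    by (simp add: K_def scaleR_2)
qed

section \<open>The flow of the first-order system\<close>

lemma exp_K_has_vector_derivative:
  assumes "t \<in> {a..b}" "0 \<le> a" "C \<in> bicomm"
  shows "((\<lambda>t. exp (C * K t)) has_vector_derivative exp (C * K t) * (C * H t)) (at t within {a..b})"
proof (rule has_vector_derivative_exp)
  show "((\<lambda>t. C * K t) has_vector_derivative C * H t) (at t within {a..b})"
    by (rule bounded_linear.has_vector_derivative[OF bounded_linear_mult_right])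
      (rule has_vector_derivative_K[OF assms(1,2)])
qed (use assms in \<open>auto intro!: bicomm_commute bicomm_mult bicomm_K\<close>)

text \<open>The product \<open>exp (- K s) * Q (cis s)\<close> starts at 1 and has derivative 0,
  because \<open>H\<close> is the logarithmic derivative of its second factor.\<close>

lemma exp_K:
  assumes "t \<ge> 0"
  shows "exp (K t) = Q (cis t)"
proof -
  let ?f = "\<lambda>s. exp (- K s) * Q (cis s)"
  have d: "(?f has_vector_derivative 0) (at s within {0..t})" if "s \<in> {0..t}" for s
  proof -
    have "((\<lambda>s. exp (- K s)) has_vector_derivative - (exp (- K s) * H s)) (at s within {0..t})"
      using exp_K_has_vector_derivative[OF that, of "- 1"] bicomm_minus[OF bicomm_1] by simp
    from has_vector_derivative_mult[OF this has_vector_derivative_Q_cis]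
    show ?thesis by (simp add: mult.assoc)
  qed
  have "?f t = ?f 0"
    by (rule constant_if_derivative_0[OF continuous_on_if_has_vector_derivative[OF d] d])
      (use assms in auto)
  then have "exp (K t) * (exp (- K t) * Q (cis t)) = exp (K t)"
    by (simp add: K_0 Q_1)
  then show ?thesis
    using exp_minus_inverse[of "K t"] by (simp flip: mult.assoc)
qed

text \<open>The power of \<open>Q (cis \<theta>)\<close> with exponent \<mu>, on the branch of the
  logarithm given by \<open>K\<close>. It is the solution operator of
  \<open>W' = \<mu> H W\<close>.\<close>

definition flow :: "complex \<Rightarrow> real \<Rightarrow> 'l state endo" where
  "flow \<mu> \<theta> = exp (cscale \<mu> * K \<theta>)"

lemma flow_has_vector_derivative:
  assumes "t \<in> {0..b}"
  shows "(flow \<mu> has_vector_derivative cscale \<mu> * H t * flow \<mu> t) (at t within {0..b})"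
proof -
  have "flow \<mu> t * (cscale \<mu> * H t) = cscale \<mu> * H t * flow \<mu> t"
    unfolding flow_def by (intro bicomm_commute bicomm_exp bicomm_mult bicomm_cscale bicomm_K bicomm_H)
  then show ?thesis
    using exp_K_has_vector_derivative[OF assms _ bicomm_cscale, of \<mu>] by (simp add: flow_def[abs_def])
qed

lemma flow_0: "flow \<mu> 0 = 1"
  by (simp add: flow_def K_0)

lemma flow_inverse: "flow \<mu> t * flow (- \<mu>) t = 1"
  by (simp add: flow_def exp_minus_inverse cscale_minus)

text \<open>The inverse flow applied to \<open>W\<close> has derivative 0. The equation is demanded
  only inside the interval, as that of the model problem holds only in the open sector.\<close>

lemma flow_unique:
  fixes W :: "real \<Rightarrow> 'l state"
  assumes "continuous_on {0..b} W"
    and "\<And>t. 0 < t \<Longrightarrow> t < b \<Longrightarrow> (W has_vector_derivative (cscale \<mu> * H t) \<cdot> W t) (at t within {0..b})"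
    and t: "t \<in> {0..b}"
  shows "W t = flow \<mu> t \<cdot> W 0"
proof -
  let ?f = "\<lambda>s. flow (- \<mu>) s \<cdot> W s"
  have "(?f has_vector_derivative 0) (at s within {0..b})" if s: "0 < s" "s < b" for s
  proof -
    have "cscale (- \<mu>) * H s * flow (- \<mu>) s = - (flow (- \<mu>) s * (cscale \<mu> * H s))"
    proof -
      have "cscale (- \<mu>) * H s * flow (- \<mu>) s = flow (- \<mu>) s * (cscale (- \<mu>) * H s)"
        unfolding flow_def
        by (intro bicomm_commute bicomm_exp bicomm_mult bicomm_cscale bicomm_K bicomm_H)
      then show ?thesis
        by (simp add: cscale_minus)
    qed
    then show ?thesis
      using endo.has_vector_derivative[OF flow_has_vector_derivative[of s b "- \<mu>"] assms(2)[OF s]] s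
      by (simp add: endo.minus_left)
  qed
  moreover have "continuous_on {0..b} ?f"
    by (intro endo.continuous_on assms(1) continuous_on_if_has_vector_derivative[OF flow_has_vector_derivative])
  ultimately have "?f t = ?f 0"
    using t by (intro constant_if_derivative_0[where b = b]) auto
  then have "flow \<mu> t \<cdot> (flow (- \<mu>) t \<cdot> W t) = flow \<mu> t \<cdot> W 0"
    by (simp add: flow_0)
  then show ?thesis
    using flow_inverse[of \<mu> t] by (simp flip: endo_apply_times)
qed

section \<open>Adjoints of the operators along the flow\<close>

lemma adjoint_pair_N: "adjoint_pair N N"
  by (simp add: adjoint_pair_def pairing_N)

lemma adjoint_pair_Q: "adjoint_pair (Q z) (Q z)"
  unfolding Q_def by (intro adjoint_pair_add adjoint_pair_scaleR adjoint_pair_1 adjoint_pair_N)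

lemma adjoint_pair_R:
  assumes "z \<noteq> 0"
  shows "adjoint_pair (R z) (R z)"
  unfolding adjoint_pair_def
proof (intro allI)
  fix x y
  have "pairing (R z \<cdot> x) (Q z \<cdot> R z \<cdot> y) = pairing (Q z \<cdot> R z \<cdot> x) (R z \<cdot> y)"
    by (rule adjoint_pairD[OF adjoint_pair_Q, symmetric])
  then show "pairing (R z \<cdot> x) y = pairing x (R z \<cdot> y)"
    using R_inverse(2)[OF assms] by (simp flip: endo_apply_times)
qed

text \<open>Taking adjoints reverses the order of the two factors, and these commute.\<close>

lemma adjoint_pair_H: "adjoint_pair (H t) (H t)"
proof -
  have "adjoint_pair (Q (\<i> * cis t) * R (cis t)) (R (cis t) * Q (\<i> * cis t))"
    by (intro adjoint_pair_mult adjoint_pair_Q adjoint_pair_R) simp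
  moreover have "R (cis t) * Q (\<i> * cis t) = H t"
    unfolding H_def by (intro bicomm_commute bicomm_Q bicomm_R) simp
  ultimately show ?thesis
    by (simp add: H_def)
qed

lemma adjoint_pair_K: "adjoint_pair (K t) (K t)"
  unfolding adjoint_pair_def
proof (intro allI)
  fix x y
  have "pairing (K t \<cdot> x) y = integral {0..t} (\<lambda>s. pairing (H s \<cdot> x) y)"
    using integral_linear[OF H_integrable[of 0 t] bounded_linear_pairing_endo(1)[of x y]]
    by (simp only: K_def o_def)
  also have "\<dots> = integral {0..t} (\<lambda>s. pairing x (H s \<cdot> y))"
    by (simp only: adjoint_pairD[OF adjoint_pair_H])
  also have "\<dots> = pairing x (K t \<cdot> y)"
    using integral_linear[OF H_integrable[of 0 t] bounded_linear_pairing_endo(2)[of x y]]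
    by (simp only: K_def o_def)
  finally show "pairing (K t \<cdot> x) y = pairing x (K t \<cdot> y)" .
qed

lemma flow_add: "flow (\<mu> + \<nu>) t = flow \<mu> t * flow \<nu> t"
proof -
  have "(cscale \<mu> * K t) * (cscale \<nu> * K t) = (cscale \<nu> * K t) * (cscale \<mu> * K t)"
    by (intro bicomm_commute bicomm_mult bicomm_cscale bicomm_K)
  from exp_add_commuting[OF this] show ?thesis
    by (simp add: flow_def cscale_add distrib_right)
qed

lemma flow_1: "t \<ge> 0 \<Longrightarrow> flow 1 t = Q (cis t)"
  by (simp add: flow_def exp_K cscale_1)

lemma flow_2pi: "flow \<mu> (2 * pi) = flow (2 * \<mu>) pi"
  by (simp add: flow_def K_2pi cscale_scaleR[of 2, simplified])

lemma adjoint_pair_flow: "adjoint_pair (flow \<mu> t) (flow (cnj \<mu>) t)"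
proof -
  have "adjoint_pair (cscale \<mu> * K t) (K t * cscale (cnj \<mu>))"
    by (intro adjoint_pair_mult adjoint_pair_cscale adjoint_pair_K)
  moreover have "K t * cscale (cnj \<mu>) = cscale (cnj \<mu>) * K t"
    by (intro bicomm_commute bicomm_K bicomm_cscale)
  ultimately show ?thesis
    by (simp add: flow_def adjoint_pair_exp)
qed


section \<open>Definiteness of fractional powers\<close>

text \<open>From the resolvent identity \<open>R w - R z = R w * Q (z - w) * R z\<close> and the
  bound on \<open>R\<close>.\<close>

lemma continuous_on_R: "continuous_on (- {0}) R"
  unfolding continuous_on_def
proof
  fix z :: complex assume "z \<in> - {0}"
  then have z: "z \<noteq> 0" by simp
  obtain c where c: "c \<ge> 0" "\<And>z. z \<noteq> 0 \<Longrightarrow> norm (R z) \<le> c / norm z"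
    using norm_R_le by blast
  have diff: "R w - R z = R w * Q (z - w) * R z" if "w \<noteq> 0" for w
  proof -
    have "R w * Q (z - w) * R z = R w * (Q z * R z) - R w * Q w * R z"
      by (simp add: linear_diff[OF bounded_linear.linear[OF bounded_linear_Q]] algebra_simps mult.assoc)
    then show ?thesis
      using R_inverse[OF z] R_inverse[OF that] by simp
  qed
  have "((\<lambda>w. c / norm w * norm (Q (z - w)) * norm (R z)) \<longlongrightarrow> c / norm z * norm (Q (z - z)) * norm (R z))
      (at z within - {0})"
    using z by (intro tendsto_intros bounded_linear.tendsto[OF bounded_linear_Q]) auto
  then have "((\<lambda>w. c / norm w * norm (Q (z - w)) * norm (R z)) \<longlongrightarrow> 0) (at z within - {0})"
    by (simp add: Q_def)
  then have "((\<lambda>w. R w - R z) \<longlongrightarrow> 0) (at z within - {0})"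
  proof (rule Lim_null_comparison[rotated], unfold eventually_at_filter, intro always_eventually allI impI)
    fix w :: complex assume "w \<in> - {0}"
    then have w: "w \<noteq> 0" by simp
    have "norm (R w - R z) \<le> norm (R w) * norm (Q (z - w)) * norm (R z)"
      unfolding diff[OF w]
      by (intro order_trans[OF norm_mult_ineq] mult_right_mono norm_mult_ineq norm_ge_zero)
    also have "\<dots> \<le> c / norm w * norm (Q (z - w)) * norm (R z)"
      by (intro mult_right_mono c(2) w norm_ge_zero)
    finally show "norm (R w - R z) \<le> c / norm w * norm (Q (z - w)) * norm (R z)" .
  qed
  then show "(R \<longlongrightarrow> R z) (at z within - {0})"
    by (simp add: LIM_zero_iff)
qed

context
  fixes \<mu> t0 t1 :: real
  assumes \<mu>: "0 < \<mu>" "\<mu> < 1" and t: "0 \<le> t0" "t0 < t1" "t1 < t0 + pi"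
begin

text \<open>With \<open>M = exp (K s - K t0)\<close>, \<open>Q (ray \<tau> s)\<close> equals
  \<open>Q (cis t0) * (\<tau> *\<^sub>R 1 + M)\<close>, so \<open>R (ray \<tau> s)\<close> is the
  resolvent of \<open>M\<close> up to a fixed factor.\<close>

definition ray :: "real \<Rightarrow> real \<Rightarrow> complex" where
  "ray \<tau> s = of_real \<tau> * cis t0 + cis s"

text \<open>Compensates this fixed factor and adds the power of the same \<open>M\<close> with
  exponent \<open>1 - \<mu>\<close>.\<close>

definition tail :: "real \<Rightarrow> 'l state endo" where
  "tail s = Q (cis t0) * exp ((1 - \<mu>) *\<^sub>R (K s - K t0))"

text \<open>After rotation by \<open>- t0\<close> the imaginary part is the sine of an angle in [0,
  pi). It vanishes only for \<open>s = t0\<close>, where the real part \<open>\<tau> + 1\<close> is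
  positive.\<close>

lemma ray_nonzero:
  assumes "0 \<le> \<tau>" "s \<in> {t0..t1}"
  shows "ray \<tau> s \<noteq> 0"
proof
  assume "ray \<tau> s = 0"
  moreover have "cis (- t0) * ray \<tau> s = of_real \<tau> * (cis (- t0) * cis t0) + cis (- t0) * cis s"
    by (simp only: ray_def distrib_left mult.left_commute)
  ultimately have eq: "of_real \<tau> + cis (s - t0) = 0"
    by (simp add: cis_mult)
  then have "sin (s - t0) = 0"
    by (simp add: complex_eq_iff)
  moreover have "sin (s - t0) > 0" if "s \<noteq> t0"
    using that assms t by (intro sin_gt_zero) auto
  ultimately have "s = t0"
    by (metis less_irrefl)
  with eq have "\<tau> + 1 = 0"
    by (simp add: complex_eq_iff)
  with assms show False by simp
qed

lemma bicomm_tail: "tail s \<in> bicomm"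
  unfolding tail_def by (intro bicomm_mult bicomm_Q bicomm_exp bicomm_scaleR bicomm_diff bicomm_K)

lemma tail_has_vector_derivative:
  assumes s: "s \<in> {t0..t1}"
  shows "(tail has_vector_derivative (1 - \<mu>) *\<^sub>R (H s * tail s)) (at s within {t0..t1})"
proof -
  let ?X = "\<lambda>s. (1 - \<mu>) *\<^sub>R (K s - K t0)"
  have X': "(?X has_vector_derivative (1 - \<mu>) *\<^sub>R (H s - 0)) (at s within {t0..t1})"
    by (intro bounded_linear.has_vector_derivative[OF bounded_linear_scaleR_right]
        has_vector_derivative_diff has_vector_derivative_K has_vector_derivative_const s t)
  have "((\<lambda>s. exp (?X s)) has_vector_derivative exp (?X s) * ((1 - \<mu>) *\<^sub>R (H s - 0))) (at s within {t0..t1})"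
    by (rule has_vector_derivative_exp[OF X' _ s])
      (intro bicomm_commute bicomm_scaleR bicomm_diff bicomm_K)
  then have "(tail has_vector_derivative Q (cis t0) * (exp (?X s) * ((1 - \<mu>) *\<^sub>R (H s - 0)))) (at s within {t0..t1})"
    unfolding tail_def[abs_def] by (rule bounded_linear.has_vector_derivative[OF bounded_linear_mult_right])
  moreover have "Q (cis t0) * (exp (?X s) * H s) = H s * tail s"
    using bicomm_commute[OF bicomm_H[of s] bicomm_tail[of s]] by (simp add: tail_def mult.assoc)
  ultimately show ?thesis by simp
qed

lemma continuous_on_R_ray:
  assumes "0 \<le> a"
  shows "continuous_on ({t0..t1} \<times> {a..b}) (\<lambda>p. R (ray (snd p) (fst p)))"
proof (rule continuous_on_compose2[OF continuous_on_R])
  show "continuous_on ({t0..t1} \<times> {a..b}) (\<lambda>p. ray (snd p) (fst p))"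
    unfolding ray_def by (intro continuous_intros)
qed (use ray_nonzero assms in auto)

text \<open>With \<open>M = exp (K s - K t0)\<close>, this is the integrand of \<open>\<integral> \<tau>\<^sup>\<mu>\<^sup>-\<^sup>1 (\<tau> + M)\<^sup>-\<^sup>1 d\<tau> = const * M\<^sup>\<mu>\<^sup>-\<^sup>1\<close>
  times \<open>M\<^sup>1\<^sup>-\<^sup>\<mu>\<close>. By homogeneity, its derivative in s is a derivative in \<open>\<tau>\<close>, so that the integral does
  not depend on s.\<close>

definition integrand :: "real \<Rightarrow> real \<Rightarrow> 'l state endo" where
  "integrand s \<tau> = \<tau> powr (\<mu> - 1) *\<^sub>R (R (ray \<tau> s) * tail s)"

text \<open>For \<open>\<tau> > 0\<close> this is \<open>- \<tau>\<close> times
  \<open>integrand s \<tau>\<close> times \<open>H s\<close>. The integrand has degree -1 in \<tau>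
  and \<open>M\<close> jointly, so Euler's relation turns its derivative in \<open>s\<close> into
  the \<tau>-derivative of this function.\<close>

definition primitive :: "real \<Rightarrow> real \<Rightarrow> 'l state endo" where
  "primitive s \<tau> = - (\<tau> powr \<mu> *\<^sub>R (R (ray \<tau> s) * (H s * tail s)))"

definition integrand_deriv :: "real \<Rightarrow> real \<Rightarrow> 'l state endo" where
  "integrand_deriv s \<tau> = \<tau> powr (\<mu> - 1) *\<^sub>R
     (R (ray \<tau> s) * (\<tau> *\<^sub>R (R (ray \<tau> s) * Q (cis t0)) - \<mu> *\<^sub>R 1) * (H s * tail s))"

lemma integrand_has_vector_derivative:
  assumes s: "s \<in> {t0..t1}" and \<tau>: "0 < \<tau>"
  shows "((\<lambda>s. integrand s \<tau>) has_vector_derivative integrand_deriv s \<tau>) (at s within {t0..t1})"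
proof -
  let ?r = "R (ray \<tau> s)" and ?q = "Q (cis t0)" and ?z = "Q (ray \<tau> s)"
  have nz: "ray \<tau> s \<noteq> 0"
    using ray_nonzero s \<tau> by simp
  have "continuous_on {t0..t1} (ray \<tau>)"
    unfolding ray_def by (intro continuous_intros)
  then obtain m where m: "m > 0" "\<And>s. s \<in> {t0..t1} \<Longrightarrow> m \<le> norm (ray \<tau> s)"
    using curve_lower_bound[of t0 t1 "ray \<tau>"] ray_nonzero t \<tau> by (metis less_imp_le)
  have "(ray \<tau> has_vector_derivative 0 + \<i> * cis s) (at s within {t0..t1})"
    unfolding ray_def[abs_def]
    by (intro has_vector_derivative_add has_vector_derivative_const has_vector_derivative_cis)
  then have "((\<lambda>s. R (ray \<tau> s)) has_vector_derivative - (?r * Q (\<i> * cis s) * ?r)) (at s within {t0..t1})"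
    using has_vector_derivative_R[OF _ s m] by simp
  from has_vector_derivative_mult[OF this tail_has_vector_derivative[OF s]]
  have "((\<lambda>s. R (ray \<tau> s) * tail s) has_vector_derivative
      ?r * ((1 - \<mu>) *\<^sub>R (H s * tail s)) + - (?r * Q (\<i> * cis s) * ?r) * tail s) (at s within {t0..t1})" .
  moreover have "?r * ((1 - \<mu>) *\<^sub>R (H s * tail s)) + - (?r * Q (\<i> * cis s) * ?r) * tail s
      = ?r * (\<tau> *\<^sub>R (?r * ?q) - \<mu> *\<^sub>R 1) * (H s * tail s)"
  proof -
    have "Q (\<i> * cis s) = H s * Q (cis s)"
      using R_inverse(1)[of "cis s"] by (simp add: H_def mult.assoc)
    \<comment> \<open>Expressed through the ray, so that \<open>Q (ray \<tau> s)\<close> cancels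
      against \<open>R (ray \<tau> s)\<close>.\<close>
    also have "Q (cis s) = ?z - \<tau> *\<^sub>R ?q"
      by (simp add: ray_def Q_add Q_scaleR)
    finally have "Q (\<i> * cis s) * ?r = H s * ((?z - \<tau> *\<^sub>R ?q) * ?r)"
      by (simp only: mult.assoc)
    also have "(?z - \<tau> *\<^sub>R ?q) * ?r = 1 - \<tau> *\<^sub>R (?q * ?r)"
      using R_inverse[OF nz] by (simp add: left_diff_distrib)
    also have "?q * ?r = ?r * ?q"
      by (intro bicomm_commute bicomm_Q bicomm_R nz)
    also have "H s * (1 - \<tau> *\<^sub>R (?r * ?q)) = (1 - \<tau> *\<^sub>R (?r * ?q)) * H s"
      by (intro bicomm_commute bicomm_H bicomm_diff bicomm_1 bicomm_scaleR bicomm_mult bicomm_Q bicomm_R nz)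
    finally have "?r * Q (\<i> * cis s) * ?r * tail s = ?r * (1 - \<tau> *\<^sub>R (?r * ?q)) * (H s * tail s)"
      by (simp add: mult.assoc)
    then show ?thesis
      by (simp add: algebra_simps)
  qed
  ultimately have "((\<lambda>s. R (ray \<tau> s) * tail s) has_vector_derivative
      ?r * (\<tau> *\<^sub>R (?r * ?q) - \<mu> *\<^sub>R 1) * (H s * tail s)) (at s within {t0..t1})"
    by simp
  from bounded_linear.has_vector_derivative[OF bounded_linear_scaleR_right this]
  show ?thesis
    by (simp only: integrand_def integrand_deriv_def)
qed

lemma primitive_has_vector_derivative:
  assumes s: "s \<in> {t0..t1}" and a: "0 < a" and \<tau>: "\<tau> \<in> {a..b}"
  shows "(primitive s has_vector_derivative integrand_deriv s \<tau>) (at \<tau> within {a..b})"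
proof -
  let ?r = "R (ray \<tau> s)" and ?q = "Q (cis t0)" and ?S = "H s * tail s"
  have nz: "ray \<tau> s \<noteq> 0"
    using ray_nonzero s \<tau> a by simp
  have "continuous_on {a..b} (\<lambda>\<tau>. ray \<tau> s)"
    unfolding ray_def by (intro continuous_intros)
  moreover have "ray \<tau>' s \<noteq> 0" if "\<tau>' \<in> {a..b}" for \<tau>'
    using ray_nonzero[of \<tau>' s] s a that by auto
  moreover have "a \<le> b"
    using \<tau> by auto
  ultimately obtain m where m: "m > 0" "\<And>\<tau>'. \<tau>' \<in> {a..b} \<Longrightarrow> m \<le> norm (ray \<tau>' s)"
    using curve_lower_bound[of a b "\<lambda>\<tau>. ray \<tau> s"] by blast
  have "((\<lambda>\<tau>. ray \<tau> s) has_vector_derivative cis t0) (at \<tau> within {a..b})"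
    unfolding ray_def[abs_def] by (auto intro!: derivative_eq_intros simp: scaleR_conv_of_real has_vector_derivative_def)
  from has_vector_derivative_R[OF this \<tau> m]
  have "((\<lambda>\<tau>. R (ray \<tau> s) * ?S) has_vector_derivative - (?r * ?q * ?r) * ?S) (at \<tau> within {a..b})"
    by (rule bounded_linear.has_vector_derivative[OF bounded_linear_mult_left])
  moreover have "((\<lambda>\<tau>. \<tau> powr \<mu>) has_field_derivative \<mu> * \<tau> powr (\<mu> - 1)) (at \<tau> within {a..b})"
    using \<tau> a by (intro has_field_derivative_at_within[OF has_real_derivative_powr]) auto
  ultimately have "((\<lambda>\<tau>. \<tau> powr \<mu> *\<^sub>R (R (ray \<tau> s) * ?S)) has_vector_derivative
      \<tau> powr \<mu> *\<^sub>R (- (?r * ?q * ?r) * ?S) + (\<mu> * \<tau> powr (\<mu> - 1)) *\<^sub>R (?r * ?S)) (at \<tau> within {a..b})"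
    by (intro has_vector_derivative_scaleR)
  from has_vector_derivative_minus[OF this]
  have "(primitive s has_vector_derivative
      - (\<tau> powr \<mu> *\<^sub>R (- (?r * ?q * ?r) * ?S) + (\<mu> * \<tau> powr (\<mu> - 1)) *\<^sub>R (?r * ?S))) (at \<tau> within {a..b})"
    by (simp only: primitive_def[abs_def])
  moreover have "- (\<tau> powr \<mu> *\<^sub>R (- (?r * ?q * ?r) * ?S) + (\<mu> * \<tau> powr (\<mu> - 1)) *\<^sub>R (?r * ?S)) = integrand_deriv s \<tau>"
  proof -
    have "\<tau> powr \<mu> = \<tau> powr (\<mu> - 1) * \<tau>"
      using \<tau> a by (simp add: powr_diff)
    moreover have "?q * ?r = ?r * ?q"
      by (intro bicomm_commute bicomm_Q bicomm_R nz)
    ultimately show ?thesis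
      unfolding integrand_deriv_def mult.assoc[of ?r ?q ?r] by (simp add: algebra_simps)
  qed
  ultimately show ?thesis by simp
qed

lemma continuous_on_H_tail: "continuous_on {t0..t1} (\<lambda>s. H s * tail s)"
  by (intro continuous_on_mult continuous_on_H continuous_on_if_has_vector_derivative[OF tail_has_vector_derivative])

lemma continuous_on_integrand_deriv:
  assumes "0 < a"
  shows "continuous_on ({t0..t1} \<times> {a..b}) (\<lambda>(s, \<tau>). integrand_deriv s \<tau>)"
proof -
  let ?U = "{t0..t1} \<times> {a..b}"
  have S: "continuous_on ?U (\<lambda>p. H (fst p) * tail (fst p))"
    by (rule continuous_on_compose2[OF continuous_on_H_tail]) (auto intro: continuous_intros)
  have p: "continuous_on ?U (\<lambda>p. snd p powr (\<mu> - 1))"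
    using assms by (intro continuous_intros) auto
  have r: "continuous_on ?U (\<lambda>p. R (ray (snd p) (fst p)))"
    using assms by (intro continuous_on_R_ray) simp
  have "continuous_on ?U (\<lambda>p. snd p *\<^sub>R (R (ray (snd p) (fst p)) * Q (cis t0)) - \<mu> *\<^sub>R 1)"
    by (intro continuous_on_diff continuous_on_scaleR continuous_on_mult[OF r] continuous_on_const
        continuous_on_snd continuous_on_id)
  from continuous_on_scaleR[OF p continuous_on_mult[OF continuous_on_mult[OF r this] S]]
  show ?thesis
    unfolding integrand_deriv_def split_beta .
qed

lemma continuous_on_integrand:
  assumes "0 < a" "s \<in> {t0..t1}"
  shows "continuous_on {a..b} (integrand s)"
proof -
  have "continuous_on {a..b} (\<lambda>\<tau>. R (ray \<tau> s))"
    using assms ray_nonzero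
    by (intro continuous_on_compose2[OF continuous_on_R, of _ "\<lambda>\<tau>. ray \<tau> s"])
      (auto simp: ray_def intro!: continuous_intros)
  then show ?thesis
    unfolding integrand_def[abs_def] using assms by (intro continuous_intros) auto
qed

lemma integrand_integrable:
  "0 < a \<Longrightarrow> s \<in> {t0..t1} \<Longrightarrow> integrand s integrable_on {a..b}"
  by (rule integrable_continuous_real) (rule continuous_on_integrand)

text \<open>Differentiation under the integral leaves only the boundary values of
  \<open>primitive\<close>; integrating their bound over \<open>s\<close> gives the factor
  \<open>t1 - t0\<close>.\<close>

lemma integral_integrand_diff_le:
  assumes ab: "0 < a" "a \<le> b"
    and B: "\<And>s. s \<in> {t0..t1} \<Longrightarrow> norm (primitive s b - primitive s a) \<le> B"
  shows "norm (integral {a..b} (integrand t1) - integral {a..b} (integrand t0)) \<le> B * (t1 - t0)"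
proof -
  let ?F = "\<lambda>s. integral {a..b} (integrand s)"
  have "(?F has_vector_derivative primitive s b - primitive s a) (at s within {t0..t1})"
    if s: "s \<in> {t0..t1}" for s
  proof -
    have "(?F has_vector_derivative integral {a..b} (integrand_deriv s)) (at s within {t0..t1})"
      using leibniz_rule_vector_derivative[where U = "{t0..t1}" and a = a and b = b and f = integrand
          and fx = integrand_deriv and ?x0.0 = s]
        integrand_has_vector_derivative continuous_on_integrand_deriv[of a b] integrand_integrable ab s
      by simp
    moreover have "(integrand_deriv s has_integral primitive s b - primitive s a) {a..b}"
      by (intro fundamental_theorem_of_calculus primitive_has_vector_derivative s ab)
    ultimately show ?thesis
      by (simp add: integral_unique)
  qed
  then have "((\<lambda>s. primitive s b - primitive s a) has_integral ?F t1 - ?F t0) {t0..t1}"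
    using t by (intro fundamental_theorem_of_calculus) auto
  moreover have "0 \<le> B"
    using order_trans[OF norm_ge_zero B[of t0]] t by simp
  ultimately show ?thesis
    using has_integral_bound[of B "\<lambda>s. primitive s b - primitive s a" _ t0 t1] B t
    by (simp add: cbox_interval)
qed

text \<open>At \<open>\<tau> = n\<close> the resolvent decays like \<open>1 / n\<close>, and at
  \<open>\<tau> = 1 / n\<close> it stays bounded. Both boundary values tend to 0 since \<mu> lies
  strictly between 0 and 1.\<close>

lemma primitive_bound:
  obtains M where "M \<ge> 0" "\<And>s n. s \<in> {t0..t1} \<Longrightarrow> n \<ge> 2 \<Longrightarrow>
    norm (primitive s n - primitive s (1 / n)) \<le> M * (n powr (\<mu> - 1) + n powr - \<mu>)"
proof -
  obtain c where c: "c \<ge> 0" "\<And>z. z \<noteq> 0 \<Longrightarrow> norm (R z) \<le> c / norm z"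
    using norm_R_le by blast
  have "bounded ((\<lambda>s. H s * tail s) ` {t0..t1})"
    by (intro compact_imp_bounded compact_continuous_image continuous_on_H_tail) simp
  then obtain M where M: "M > 0" "\<And>s. s \<in> {t0..t1} \<Longrightarrow> norm (H s * tail s) \<le> M"
    unfolding bounded_pos by auto
  have bound: "norm (primitive s \<tau>) \<le> \<tau> powr \<mu> * (c / d * M)"
    if "s \<in> {t0..t1}" "0 < \<tau>" "0 < d" "d \<le> norm (ray \<tau> s)" for s \<tau> d
  proof -
    have "norm (R (ray \<tau> s)) \<le> c / norm (ray \<tau> s)"
      using that by (intro c ray_nonzero) auto
    also have "\<dots> \<le> c / d"
      using that c(1) by (intro divide_left_mono mult_pos_pos) linarith+
    finally have "norm (R (ray \<tau> s)) * norm (H s * tail s) \<le> c / d * M"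
      using M that c by (intro mult_mono) auto
    then have "norm (R (ray \<tau> s) * (H s * tail s)) \<le> c / d * M"
      using norm_mult_ineq order_trans by blast
    then show ?thesis
      unfolding primitive_def norm_minus_cancel norm_scaleR by (intro mult_mono) auto
  qed
  show thesis
  \<comment> \<open>The factor 2 comes from \<open>norm (ray n s) \<ge> n / 2\<close> and
    \<open>norm (ray (1 / n) s) \<ge> 1 / 2\<close>, both valid for
    \<open>n \<ge> 2\<close>.\<close>
  proof (rule that[of "2 * c * M"])
    fix s n :: real
    assume s: "s \<in> {t0..t1}" and n: "n \<ge> 2"
    have "norm (primitive s n) \<le> n powr \<mu> * (c / (n / 2) * M)"
    proof (rule bound)
      show "n / 2 \<le> norm (ray n s)"
        using norm_triangle_ineq2[of "of_real n * cis t0" "- cis s"] n by (simp add: ray_def norm_mult)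
    qed (use s n in auto)
    also have "\<dots> = 2 * c * M * n powr (\<mu> - 1)"
      using n by (simp add: powr_diff)
    finally have 1: "norm (primitive s n) \<le> 2 * c * M * n powr (\<mu> - 1)" .
    have "norm (primitive s (1 / n)) \<le> (1 / n) powr \<mu> * (c / (1 / 2) * M)"
    proof (rule bound)
      have "1 / n \<le> 1 / 2"
        using n by (simp add: field_simps)
      moreover have "1 - 1 / n \<le> norm (ray (1 / n) s)"
        using norm_triangle_ineq2[of "cis s" "- (of_real (1 / n) * cis t0)"] n
        by (simp add: ray_def norm_mult norm_divide add.commute)
      ultimately show "1 / 2 \<le> norm (ray (1 / n) s)"
        by linarith
    qed (use s n in auto)
    also have "\<dots> = 2 * c * M * n powr - \<mu>"
      using n by (simp add: powr_divide powr_minus_divide)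
    finally have "norm (primitive s (1 / n)) \<le> 2 * c * M * n powr - \<mu>" .
    with 1 show "norm (primitive s n - primitive s (1 / n)) \<le> 2 * c * M * (n powr (\<mu> - 1) + n powr - \<mu>)"
      using norm_triangle_ineq4[of "primitive s n" "primitive s (1 / n)"] by (simp add: distrib_left)
  qed (use c M in simp)
qed

lemma integrals_tendsto:
  "(\<lambda>n. integral {1 / real n..real n} (integrand t1) - integral {1 / real n..real n} (integrand t0)) \<longlonglongrightarrow> 0"
proof -
  obtain M where M: "M \<ge> 0" "\<And>s n. s \<in> {t0..t1} \<Longrightarrow> n \<ge> 2 \<Longrightarrow>
    norm (primitive s n - primitive s (1 / n)) \<le> M * (n powr (\<mu> - 1) + n powr - \<mu>)"
    using primitive_bound by blast
  have "(\<lambda>n. M * (real n powr (\<mu> - 1) + real n powr - \<mu>) * (t1 - t0)) \<longlonglongrightarrow> M * (0 + 0) * (t1 - t0)"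
    using \<mu> by (intro tendsto_intros tendsto_neg_powr filterlim_real_sequentially) auto
  then have "(\<lambda>n. M * (real n powr (\<mu> - 1) + real n powr - \<mu>) * (t1 - t0)) \<longlonglongrightarrow> 0"
    by simp
  then show ?thesis
  proof (rule Lim_null_comparison[rotated], intro eventually_mono[OF eventually_ge_at_top[of 2]])
    fix n :: nat assume n: "2 \<le> n"
    then have "1 / real n \<le> real n"
      by (intro order_trans[of "1 / real n" 1 "real n"]) simp_all
    then show "norm (integral {1 / real n..real n} (integrand t1) - integral {1 / real n..real n} (integrand t0))
        \<le> M * (real n powr (\<mu> - 1) + real n powr - \<mu>) * (t1 - t0)"
      using n M(2)[of _ "real n"] by (intro integral_integrand_diff_le) auto
  qed
qed

text \<open>At \<open>s = t0\<close> the operator \<open>M\<close> is 1, so the integrand is a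
  positive scalar.\<close>

lemma integrand_t0: "0 < \<tau> \<Longrightarrow> integrand t0 \<tau> = (\<tau> powr (\<mu> - 1) / (\<tau> + 1)) *\<^sub>R 1"
proof -
  assume \<tau>: "0 < \<tau>"
  have ray: "ray \<tau> t0 = of_real (\<tau> + 1) * cis t0"
    by (simp add: ray_def algebra_simps)
  have "R (ray \<tau> t0) = R (cis t0) /\<^sub>R (\<tau> + 1)"
    unfolding ray using \<tau> by (intro R_scaleR) auto
  then show ?thesis
    using R_inverse(1)[of "cis t0"] by (simp add: integrand_def tail_def divide_inverse)
qed

text \<open>The claim is \<open>L 1 > 0\<close> for a functional \<open>L\<close> such that
  \<open>L (integrand t1 \<tau>)\<close> is positive and \<open>L (integrand t0 \<tau>)\<close> is a
  positive multiple of \<open>L 1\<close>. The difference of the truncated integrals tends to 0, so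
  \<open>L 1\<close> inherits the sign.\<close>

lemma pairing_pos_aux:
  assumes pos: "\<And>\<tau>. 0 < \<tau> \<Longrightarrow> pairing x ((Q w * R (ray \<tau> t1)) \<cdot> x) > 0"
  shows "pairing x ((exp ((\<mu> - 1) *\<^sub>R (K t1 - K t0)) * (Q w * R (cis t0))) \<cdot> x) > 0"
proof (rule ccontr)
  define D where "D = K t1 - K t0"
  \<comment> \<open>Up to the factor \<open>Q w\<close> this inverts \<open>tail t1\<close>, so that
    only \<open>Q w * R (ray \<tau> t1)\<close> survives in
    \<open>L (integrand t1 \<tau>)\<close>.\<close>
  define Y where "Y = exp ((\<mu> - 1) *\<^sub>R D) * (Q w * R (cis t0))"
  define L where "L = (\<lambda>X. pairing x ((Y * X) \<cdot> x))"
  define p where "p = (\<lambda>\<tau>. \<tau> powr (\<mu> - 1) * pairing x ((Q w * R (ray \<tau> t1)) \<cdot> x))"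
  define q where "q = (\<lambda>\<tau> :: real. \<tau> powr (\<mu> - 1) / (\<tau> + 1))"
  assume "\<not> ?thesis"
  then have L1: "L 1 \<le> 0"
    by (simp add: L_def Y_def D_def)
  have lin: "bounded_linear L"
    unfolding L_def
    by (rule bounded_linear_compose[OF bounded_linear_pairing_endo(2) bounded_linear_mult_right])
  have D: "D \<in> bicomm"
    unfolding D_def by (intro bicomm_diff bicomm_K)
  have Lp: "L (integrand t1 \<tau>) = p \<tau>" if \<tau>: "0 < \<tau>" for \<tau>
  proof -
    let ?r = "R (ray \<tau> t1)" and ?e = "exp ((\<mu> - 1) *\<^sub>R D)" and ?f = "exp ((1 - \<mu>) *\<^sub>R D)"
    have nz: "ray \<tau> t1 \<noteq> 0"
      using ray_nonzero \<tau> t by simp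
    have "?e * (Q w * R (cis t0)) * (?r * (Q (cis t0) * ?f)) = ?f * (?e * (Q w * R (cis t0)) * (?r * Q (cis t0)))"
      using bicomm_commute[of ?f "?e * (Q w * R (cis t0)) * (?r * Q (cis t0))"] D nz
      by (simp add: mult.assoc bicomm_mult bicomm_exp bicomm_scaleR bicomm_Q bicomm_R)
    also have "\<dots> = (?f * ?e) * (Q w * (R (cis t0) * (?r * Q (cis t0))))"
      by (simp add: mult.assoc)
    also have "?f * ?e = 1"
      using exp_minus_inverse[of "(1 - \<mu>) *\<^sub>R D"] by (simp flip: scaleR_minus_left)
    also have "?r * Q (cis t0) = Q (cis t0) * ?r"
      by (intro bicomm_commute bicomm_Q bicomm_R nz)
    also have "R (cis t0) * (Q (cis t0) * ?r) = ?r"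
      using R_inverse(1)[of "cis t0"] by (simp flip: mult.assoc)
    finally have "Y * (?r * tail t1) = Q w * ?r"
      by (simp add: Y_def tail_def D_def)
    then show ?thesis
      by (simp add: L_def integrand_def p_def endo.scaleR_left pairing.scaleR_right del: endo_apply_times)
  qed
  have Lq: "L (integrand t0 \<tau>) = q \<tau> * L 1" if "0 < \<tau>" for \<tau>
    using that by (simp add: integrand_t0 q_def linear_scale[OF bounded_linear.linear[OF lin]])
  define P where "P = (\<lambda>n. integral {1 / real n..real n} p)"
  define C where "C = (\<lambda>n. integral {1 / real n..real n} q)"
  have int: "integrand s integrable_on {1 / real n..real n}" if "n > 0" "s \<in> {t0..t1}" for n s
    using that by (intro integrand_integrable) auto
  have int_p: "p integrable_on {1 / real n..real n}" and P: "L (integral {1 / real n..real n} (integrand t1)) = P n"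
    and C: "L (integral {1 / real n..real n} (integrand t0)) = C n * L 1" if n: "n > 0" for n
  proof -
    have pos: "0 < \<tau>" if "\<tau> \<in> {1 / real n..real n}" for \<tau>
      using less_le_trans[of 0 "1 / real n" \<tau>] that n by simp
    have "t1 \<in> {t0..t1}" "t0 \<in> {t0..t1}"
      using t by auto
    from integrable_linear[OF int[OF n this(1)] lin]
    show "p integrable_on {1 / real n..real n}"
      by (rule integrable_eq) (simp add: Lp pos)
    have "L (integral {1 / real n..real n} (integrand t1)) = integral {1 / real n..real n} (L \<circ> integrand t1)"
      using integral_linear[OF int[OF n \<open>t1 \<in> _\<close>] lin] by simp
    also have "\<dots> = P n"
      unfolding P_def by (intro integral_cong) (simp add: Lp pos)
    finally show "L (integral {1 / real n..real n} (integrand t1)) = P n" .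
    have "L (integral {1 / real n..real n} (integrand t0)) = integral {1 / real n..real n} (L \<circ> integrand t0)"
      using integral_linear[OF int[OF n \<open>t0 \<in> _\<close>] lin] by simp
    also have "\<dots> = integral {1 / real n..real n} (\<lambda>\<tau>. q \<tau> * L 1)"
      by (intro integral_cong) (simp add: Lq pos)
    also have "\<dots> = C n * L 1"
      by (simp add: C_def)
    finally show "L (integral {1 / real n..real n} (integrand t0)) = C n * L 1" .
  qed
  have "(\<lambda>n. L (integral {1 / real n..real n} (integrand t1) - integral {1 / real n..real n} (integrand t0))) \<longlonglongrightarrow> L 0"
    by (rule bounded_linear.tendsto[OF lin integrals_tendsto])
  then have lim: "(\<lambda>n. P n - C n * L 1) \<longlonglongrightarrow> 0"
    unfolding linear_diff[OF bounded_linear.linear[OF lin]] linear_0[OF bounded_linear.linear[OF lin]]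
    by (rule Lim_transform_eventually) (intro eventually_mono[OF eventually_gt_at_top[of 0]], simp add: P C)
  have p_pos: "p \<tau> > 0" if "0 < \<tau>" for \<tau>
    using pos[OF that] that by (simp add: p_def)
  \<comment> \<open>If \<open>L 1 \<le> 0\<close>, the difference stays above \<open>P 2\<close>, a
    positive number, contrary to its limit 0.\<close>
  have P_ge: "P n - C n * L 1 \<ge> P 2" if n: "n \<ge> 2" for n
  proof -
    have le: "1 / real n \<le> 1 / 2" and "0 < 1 / real n"
      using n by (simp_all add: field_simps)
    have "P 2 \<le> P n"
      unfolding P_def
    proof (intro integral_subset_le ballI)
      show "0 \<le> p \<tau>" if "\<tau> \<in> {1 / real n..real n}" for \<tau>
        using less_le_trans[OF \<open>0 < 1 / real n\<close>, of \<tau>] that p_pos[of \<tau>] by simp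
    qed (use n le int_p[of n] int_p[of 2] in auto)
    moreover have "C n \<ge> 0"
    proof -
      have "0 < \<tau>" if "\<tau> \<in> {1 / real n..real n}" for \<tau>
        using less_le_trans[OF \<open>0 < 1 / real n\<close>, of \<tau>] that by simp
      then have "q integrable_on {1 / real n..real n}" "\<And>\<tau>. \<tau> \<in> {1 / real n..real n} \<Longrightarrow> 0 \<le> q \<tau>"
        unfolding q_def
        by (fastforce intro!: integrable_continuous_real continuous_intros, fastforce)
      then show ?thesis
        unfolding C_def by (rule Henstock_Kurzweil_Integration.integral_nonneg)
    qed
    ultimately show ?thesis
      using mult_nonneg_nonpos[of "C n" "L 1"] L1 by linarith
  qed
  have "P 2 > 0"
  proof -
    have "continuous_on {1 / 2..2} (\<lambda>\<tau>. L (integrand t1 \<tau>))"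
      using t by (intro bounded_linear.continuous_on[OF lin] continuous_on_integrand) auto
    then have cont: "continuous_on {1 / 2..2} p"
      by (rule continuous_on_eq) (simp add: Lp)
    then obtain \<tau>0 where \<tau>0: "\<tau>0 \<in> {1 / 2..2}" "\<And>\<tau>. \<tau> \<in> {1 / 2..2} \<Longrightarrow> p \<tau>0 \<le> p \<tau>"
      using continuous_attains_inf[of "{1 / 2..2 :: real}" p] by auto
    have "0 < p \<tau>0 * (2 - 1 / 2)"
      using \<tau>0(1) p_pos[of \<tau>0] by simp
    also have "\<dots> = integral {1 / 2..2 :: real} (\<lambda>\<tau>. p \<tau>0)"
      by simp
    also have "\<dots> \<le> P 2"
      using \<tau>0 int_p[of 2] by (simp only: P_def of_nat_numeral) (intro integral_le, auto)
    finally show ?thesis .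
  qed
  moreover have "P 2 \<le> 0"
    by (rule tendsto_lowerbound[OF lim]) (auto intro!: eventually_mono[OF eventually_ge_at_top[of 2]] P_ge)
  ultimately show False by simp
qed

end


lemma exp_K_diff:
  assumes "0 \<le> a" "0 \<le> b"
  shows "exp (K a - K b) = Q (cis a) * R (cis b)"
proof -
  have "exp (- K b) * Q (cis b) = 1"
    using exp_minus_inverse[of "- K b"] exp_K[OF assms(2)] by simp
  then have "exp (- K b) = R (cis b)"
    by (intro R_unique) simp_all
  moreover have "K a * - K b = - K b * K a"
    by (intro bicomm_commute bicomm_K bicomm_minus)
  ultimately show ?thesis
    using exp_add_commuting[of "K a" "- K b"] exp_K[OF assms(1)] by simp
qed

text \<open>For \<open>\<mu> = 1\<close> the operators have the form \<open>Q w * R z\<close>, and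
  \<open>pairing_Q_R\<close> decides. Smaller \<mu> follow from the integral formula, since for
  \<open>\<tau> > 0\<close> the direction of the ray lies strictly between the two angles.\<close>

lemma pairing_exp_sign:
  assumes \<mu>: "0 < \<mu>" "\<mu> \<le> 1" and t: "0 \<le> t0" "t0 < t1" "t1 < t0 + pi" and u: "u \<noteq> 0"
  shows "pairing (u, 0) (exp (\<mu> *\<^sub>R (K t1 - K t0)) \<cdot> (u, 0)) > 0" (is ?pos)
    and "pairing (u, 0) (exp (- \<mu> *\<^sub>R (K t1 - K t0)) \<cdot> (u, 0)) < 0" (is ?neg)
proof -
  let ?x = "(u, 0)" and ?D = "K t1 - K t0"
  have sin: "sin (t1 - t0) > 0"
    using t by (intro sin_gt_zero) auto
  have exp_D: "exp ?D = Q (cis t1) * R (cis t0)" "exp (- ?D) = Q (cis t0) * R (cis t1)"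
    using exp_K_diff[of t1 t0] exp_K_diff[of t0 t1] t by simp_all
  have key: "pairing ?x ((Q w * R z) \<cdot> ?x) > 0" if z: "z \<noteq> 0" "Im (cnj z * w) > 0" for z w
  proof -
    obtain e where e: "e > 0" "\<And>w. pairing ?x ((Q w * R z) \<cdot> ?x) = Im (cnj z * w) * e"
      using pairing_Q_R[OF z(1) u] by blast
    show ?thesis
      unfolding e(2) by (rule mult_pos_pos[OF z(2) e(1)])
  qed
  have Im1: "Im (cnj (of_real \<tau> * cis t0 + cis t1) * cis t1) = \<tau> * sin (t1 - t0)" for \<tau>
    by (simp add: sin_diff algebra_simps)
  have Im0: "Im (cnj (of_real \<tau> * cis t0 + cis t1) * - cis t0) = sin (t1 - t0)" for \<tau>
    by (simp add: sin_diff algebra_simps)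
  have pos1: ?pos if "\<mu> = 1"
  proof -
    have "Im (cnj (cis t0) * cis t1) > 0"
      using sin by (simp add: sin_diff algebra_simps)
    from key[OF _ this] show ?thesis
      using that exp_D(1) by simp
  qed
  have neg1: ?neg if "\<mu> = 1"
  proof -
    have "pairing ?x ((Q (- cis t0) * R (cis t1)) \<cdot> ?x) > 0"
      using Im0[of 0] sin by (intro key) simp_all
    then show ?thesis
      using that exp_D(2) by (simp add: Q_minus endo.minus_left pairing.minus_right)
  qed
  have pos2: ?pos if "\<mu> < 1"
  proof -
    have "pairing ?x ((exp ((\<mu> - 1) *\<^sub>R ?D) * (Q (cis t1) * R (cis t0))) \<cdot> ?x) > 0"
    proof (rule pairing_pos_aux[OF \<mu>(1) that t])
      fix \<tau> :: real assume "0 < \<tau>"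
      then show "pairing ?x ((Q (cis t1) * R (ray t0 \<tau> t1)) \<cdot> ?x) > 0"
        using ray_nonzero[OF \<mu>(1) that t, of \<tau> t1] t sin Im1[of \<tau>]
        by (intro key) (simp_all add: ray_def[OF \<mu>(1) that t])
    qed
    moreover have "exp ((\<mu> - 1) *\<^sub>R ?D) * exp ?D = exp (\<mu> *\<^sub>R ?D)"
      using exp_add_commuting[of "(\<mu> - 1) *\<^sub>R ?D" ?D] by (simp add: algebra_simps)
    ultimately show ?thesis
      by (simp only: exp_D(1)[symmetric])
  qed
  have neg2: ?neg if "\<mu> < 1"
  proof -
    have \<nu>: "0 < 1 - \<mu>" "1 - \<mu> < 1"
      using that \<mu> by auto
    \<comment> \<open>The formula with \<open>1 - \<mu>\<close> in place of \<mu> and with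
      \<open>w = - cis t0\<close>. Then \<open>Q w * R (cis t0) = - 1\<close>, and the operator is
      \<open>- exp (- \<mu> *\<^sub>R ?D)\<close>.\<close>
    have "pairing ?x ((exp ((1 - \<mu> - 1) *\<^sub>R ?D) * (Q (- cis t0) * R (cis t0))) \<cdot> ?x) > 0"
    proof (rule pairing_pos_aux[OF \<nu> t])
      fix \<tau> :: real assume "0 < \<tau>"
      then show "pairing ?x ((Q (- cis t0) * R (ray t0 \<tau> t1)) \<cdot> ?x) > 0"
        using ray_nonzero[OF \<nu> t, of \<tau> t1] t sin Im0[of \<tau>]
        by (intro key) (simp_all add: ray_def[OF \<nu> t])
    qed
    moreover have "Q (- cis t0) * R (cis t0) = - 1"
      using R_inverse(2)[of "cis t0"] by (simp add: Q_minus)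
    ultimately show ?thesis
      by (simp add: endo.minus_left pairing.minus_right)
  qed
  show ?pos using pos1 pos2 \<mu> by linarith
  show ?neg using neg1 neg2 \<mu> by linarith
qed

section \<open>Location of the spectrum\<close>

text \<open>The second component is the stress function; its vanishing at the angles 0 and \<alpha>
  expresses the two Neumann conditions.\<close>

definition spectral :: "real \<Rightarrow> complex \<Rightarrow> bool" where
  "spectral \<alpha> \<mu> \<longleftrightarrow> (\<exists>u. u \<noteq> 0 \<and> snd (flow \<mu> \<alpha> \<cdot> (u, 0)) = 0)"

lemma spectralE:
  assumes "spectral \<alpha> \<mu>"
  obtains u v where "u \<noteq> 0" "v \<noteq> 0" "flow \<mu> \<alpha> \<cdot> (u, 0) = (v, 0)" "flow (- \<mu>) \<alpha> \<cdot> (v, 0) = (u, 0)"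
proof -
  obtain u where u: "u \<noteq> 0" "snd (flow \<mu> \<alpha> \<cdot> (u, 0)) = 0"
    using assms by (auto simp: spectral_def)
  define v where "v = fst (flow \<mu> \<alpha> \<cdot> (u, 0))"
  have v: "flow \<mu> \<alpha> \<cdot> (u, 0) = (v, 0)"
    using u(2) by (simp add: v_def prod_eq_iff)
  have bwd: "flow (- \<mu>) \<alpha> \<cdot> (v, 0) = (u, 0)"
    unfolding v[symmetric] using flow_inverse[of "- \<mu>" \<alpha>] by (simp flip: endo_apply_times)
  have "v \<noteq> 0"
  proof
    assume "v = 0"
    with bwd have "(u, 0 :: complex^'l) = 0"
      by (simp add: endo.zero_right flip: zero_prod_def)
    with u(1) show False
      by (simp add: zero_prod_def)
  qed
  then show thesis
    by (rule that[OF u(1) _ v bwd])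
qed

text \<open>Moving one flow across the pairing conjugates its exponent, and
  \<open>cnj \<mu> + \<mu>\<close> is real. This reduces complex \<mu> to real powers, to which
  \<open>pairing_exp_sign\<close> applies.\<close>

lemma pairing_flow:
  assumes X: "X \<in> bicomm"
  shows "pairing (flow \<mu> a \<cdot> x) (X \<cdot> flow \<mu> a \<cdot> x) = pairing x ((exp ((2 * Re \<mu>) *\<^sub>R K a) * X) \<cdot> x)"
proof -
  have "flow \<mu> a * X = X * flow \<mu> a"
    unfolding flow_def by (intro bicomm_commute[OF _ X] bicomm_exp bicomm_mult bicomm_cscale bicomm_K)
  then have "flow (cnj \<mu>) a * (X * flow \<mu> a) = (flow (cnj \<mu>) a * flow \<mu> a) * X"
    by (simp add: mult.assoc)
  also have "flow (cnj \<mu>) a * flow \<mu> a = flow (of_real (2 * Re \<mu>)) a"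
  proof -
    have "cnj \<mu> + \<mu> = of_real (2 * Re \<mu>)"
      by (simp add: complex_eq_iff)
    then show ?thesis
      by (simp only: flow_add[symmetric])
  qed
  also have "\<dots> = exp ((2 * Re \<mu>) *\<^sub>R K a)"
    unfolding flow_def cscale_of_real by simp
  finally have eq: "flow (cnj \<mu>) a * (X * flow \<mu> a) = exp ((2 * Re \<mu>) *\<^sub>R K a) * X" .
  show ?thesis
    unfolding adjoint_pairD[OF adjoint_pair_flow[of \<mu> a]] eq[symmetric] endo_apply_times ..
qed

text \<open>The rotated form of \<open>N_cases\<close>: \<open>x\<close> is a derivative in the
  radial direction, and \<open>H \<theta>\<close> replaces it by the derivative in the angular
  direction.\<close>

lemma H_cases:
  "\<exists>g h. x = cos \<theta> *\<^sub>R (g, - (cmul A12 g + cmul A22 h)) + sin \<theta> *\<^sub>R (h, cmul A11 g + cmul A12 h)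
    \<and> H \<theta> \<cdot> x = - sin \<theta> *\<^sub>R (g, - (cmul A12 g + cmul A22 h)) + cos \<theta> *\<^sub>R (h, cmul A11 g + cmul A12 h)"
proof -
  define y where "y = H \<theta> \<cdot> x"
  \<comment> \<open>Rotates the pair \<open>x\<close>, \<open>y\<close> back to the fixed frame;
    \<open>z\<close> is to be the derivative in the first coordinate direction.\<close>
  define z where "z = cos \<theta> *\<^sub>R x - sin \<theta> *\<^sub>R y"
  define z' where "z' = sin \<theta> *\<^sub>R x + cos \<theta> *\<^sub>R y"
  have "H \<theta> * Q (cis \<theta>) = Q (cis \<theta>) * H \<theta>"
    by (intro bicomm_commute bicomm_H bicomm_Q)
  then have "Q (cis \<theta>) * H \<theta> = Q (\<i> * cis \<theta>)"
    using R_inverse(1)[of "cis \<theta>"] by (simp add: H_def mult.assoc)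
  then have "Q (cis \<theta>) \<cdot> y = Q (\<i> * cis \<theta>) \<cdot> x"
    unfolding y_def by (simp flip: endo_apply_times)
  then have Nz: "N \<cdot> z = z'"
    by (simp add: Q_apply z_def z'_def endo.diff_right endo.scaleR_right algebra_simps)
  obtain g h where gh: "z = (g, - (cmul A12 g + cmul A22 h))" "N \<cdot> z = (h, cmul A11 g + cmul A12 h)"
    using N_cases by blast
  have "x = cos \<theta> *\<^sub>R z + sin \<theta> *\<^sub>R z'" "y = - sin \<theta> *\<^sub>R z + cos \<theta> *\<^sub>R z'"
  proof -
    have cs: "cos \<theta> * cos \<theta> + sin \<theta> * sin \<theta> = 1"
      by (metis power2_eq_square sin_cos_squared_add2)
    have "cos \<theta> *\<^sub>R z + sin \<theta> *\<^sub>R z' = (cos \<theta> * cos \<theta> + sin \<theta> * sin \<theta>) *\<^sub>R x"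
      by (simp add: z_def z'_def algebra_simps del: sin_cos_squared_add3)
    then show "x = cos \<theta> *\<^sub>R z + sin \<theta> *\<^sub>R z'"
      by (simp only: cs scaleR_one)
    have "- sin \<theta> *\<^sub>R z + cos \<theta> *\<^sub>R z' = (cos \<theta> * cos \<theta> + sin \<theta> * sin \<theta>) *\<^sub>R y"
      by (simp add: z_def z'_def algebra_simps del: sin_cos_squared_add3)
    then show "y = - sin \<theta> *\<^sub>R z + cos \<theta> *\<^sub>R z'"
      by (simp only: cs scaleR_one)
  qed
  then show ?thesis
    unfolding Nz[symmetric] gh(2) unfolding gh(1) y_def by blast
qed

text \<open>The factor \<i> makes the real inner product an imaginary part of the Hermitian one. Its
  derivative is \<open>Im \<mu>\<close> times the energy of the gradient belonging to the
  state.\<close>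

lemma flow_imaginary_has_real_derivative:
  assumes \<mu>: "Re \<mu> = 0" and \<theta>: "\<theta> \<in> {0..b}"
  shows "\<exists>e. ((\<lambda>\<theta>. (\<i> *s fst (flow \<mu> \<theta> \<cdot> x)) \<bullet> snd (flow \<mu> \<theta> \<cdot> x)) has_real_derivative Im \<mu> * e)
      (at \<theta> within {0..b}) \<and> (flow \<mu> \<theta> \<cdot> x \<noteq> 0 \<longrightarrow> e > 0)"
proof -
  let ?W = "\<lambda>\<theta>. flow \<mu> \<theta> \<cdot> x"
  obtain g h where gh: "?W \<theta> = cos \<theta> *\<^sub>R (g, - (cmul A12 g + cmul A22 h)) + sin \<theta> *\<^sub>R (h, cmul A11 g + cmul A12 h)"
    "H \<theta> \<cdot> ?W \<theta> = - sin \<theta> *\<^sub>R (g, - (cmul A12 g + cmul A22 h)) + cos \<theta> *\<^sub>R (h, cmul A11 g + cmul A12 h)"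
    using H_cases by blast
  define s1 where "s1 = cmul A11 g + cmul A12 h"
  define s2 where "s2 = cmul A12 g + cmul A22 h"
  define c where "c = cos \<theta>"
  define s where "s = sin \<theta>"
  define u where "u = c *\<^sub>R g + s *\<^sub>R h"
  define \<phi> where "\<phi> = s *\<^sub>R s1 - c *\<^sub>R s2"
  define p where "p = c *\<^sub>R h - s *\<^sub>R g"
  define q where "q = c *\<^sub>R s1 + s *\<^sub>R s2"
  have cs: "c * c + s * s = 1"
    unfolding c_def s_def by (metis power2_eq_square sin_cos_squared_add2)
  have W: "?W \<theta> = (u, \<phi>)" and HW: "H \<theta> \<cdot> ?W \<theta> = (p, q)"
    by (subst gh(1), simp add: u_def \<phi>_def s1_def s2_def c_def s_def scaleR_diff_right scaleR_add_right)
      (subst gh(2), simp add: p_def q_def s1_def s2_def c_def s_def scaleR_diff_right scaleR_add_right)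
  have "(?W has_vector_derivative cscale \<mu> \<cdot> (p, q)) (at \<theta> within {0..b})"
    using bounded_linear.has_vector_derivative[OF endo.bounded_linear_left[of x] flow_has_vector_derivative[OF \<theta>, of \<mu>]]
    by (simp add: HW del: cscale_apply)
  then have W': "(?W has_vector_derivative (\<mu> *s p, \<mu> *s q)) (at \<theta> within {0..b})"
    by simp
  have "((\<lambda>\<theta>. \<i> *s fst (?W \<theta>)) has_vector_derivative \<i> *s (\<mu> *s p)) (at \<theta> within {0..b})"
    using bounded_linear.has_vector_derivative[OF bounded_linear_compose[OF bounded_linear_scale bounded_linear_fst] W']
    by simp
  moreover have "((\<lambda>\<theta>. snd (?W \<theta>)) has_vector_derivative \<mu> *s q) (at \<theta> within {0..b})"
    using bounded_linear.has_vector_derivative[OF bounded_linear_snd W'] by simp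
  ultimately have "((\<lambda>\<theta>. (\<i> *s fst (?W \<theta>)) \<bullet> snd (?W \<theta>)) has_vector_derivative
      (\<i> *s fst (?W \<theta>)) \<bullet> (\<mu> *s q) + (\<i> *s (\<mu> *s p)) \<bullet> snd (?W \<theta>)) (at \<theta> within {0..b})"
    by (rule bounded_bilinear.has_vector_derivative[OF bounded_bilinear_inner])
  then have "((\<lambda>\<theta>. (\<i> *s fst (?W \<theta>)) \<bullet> snd (?W \<theta>)) has_vector_derivative
      (\<i> *s u) \<bullet> (\<mu> *s q) + (\<i> *s (\<mu> *s p)) \<bullet> \<phi>) (at \<theta> within {0..b})"
    unfolding W fst_conv snd_conv .
  moreover have "(\<i> *s u) \<bullet> (\<mu> *s q) + (\<i> *s (\<mu> *s p)) \<bullet> \<phi> = Im \<mu> * energy g h"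
  proof -
    have 1: "(\<i> *s u) \<bullet> (\<mu> *s q) = Im \<mu> * (u \<bullet> q)"
      using \<mu> by (simp add: inner_vec_def inner_complex_def sum_distrib_left algebra_simps)
    have 2: "(\<i> *s (\<mu> *s p)) \<bullet> \<phi> = - Im \<mu> * (p \<bullet> \<phi>)"
      using \<mu> by (simp add: inner_vec_def inner_complex_def sum_distrib_left algebra_simps flip: sum_negf)
    \<comment> \<open>The mixed products cancel, so the energy is the same in every rotated
      frame.\<close>
    have "u \<bullet> q - p \<bullet> \<phi> = (c * c + s * s) * (g \<bullet> s1 + h \<bullet> s2)"
      by (simp add: u_def p_def q_def \<phi>_def inner_add_left inner_add_right inner_diff_left inner_diff_right
          algebra_simps)
    then show ?thesis
      unfolding 1 2 by (simp add: cs energy_def s1_def s2_def algebra_simps)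
  qed
  moreover have "energy g h > 0" if "?W \<theta> \<noteq> 0"
  proof (rule energy_pos)
    show "g \<noteq> 0 \<or> h \<noteq> 0"
    proof (rule ccontr)
      assume "\<not> (g \<noteq> 0 \<or> h \<noteq> 0)"
      then have "u = 0" "\<phi> = 0"
        by (simp_all add: u_def \<phi>_def s1_def s2_def linear_0[OF linear_cmul])
      with that W show False
        by (simp add: zero_prod_def)
    qed
  qed
  ultimately show ?thesis
    unfolding has_real_derivative_iff_has_vector_derivative by (intro exI[of _ "energy g h"]) simp
qed

text \<open>A strictly monotone function cannot vanish at both ends. The state stays nonzero on the
  way because the flow is invertible.\<close>

lemma not_spectral_imaginary:
  assumes \<alpha>: "0 < \<alpha>" and \<mu>: "\<mu> \<noteq> 0" "Re \<mu> = 0"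
  shows "\<not> spectral \<alpha> \<mu>"
proof
  assume "spectral \<alpha> \<mu>"
  then obtain u v where uv: "u \<noteq> 0" and v: "flow \<mu> \<alpha> \<cdot> (u, 0) = (v, 0)"
    by (rule spectralE)
  let ?W = "\<lambda>\<theta>. flow \<mu> \<theta> \<cdot> (u, 0)"
  let ?f = "\<lambda>\<theta>. (\<i> *s fst (?W \<theta>)) \<bullet> snd (?W \<theta>)"
  have "\<forall>\<theta>\<in>{0..\<alpha>}. \<exists>e. (?f has_real_derivative Im \<mu> * e) (at \<theta> within {0..\<alpha>}) \<and> (?W \<theta> \<noteq> 0 \<longrightarrow> e > 0)"
    using flow_imaginary_has_real_derivative[OF \<mu>(2)] by blast
  from bchoice[OF this] obtain e where e: "\<And>\<theta>. \<theta> \<in> {0..\<alpha>} \<Longrightarrow> (?f has_real_derivative Im \<mu> * e \<theta>) (at \<theta> within {0..\<alpha>})"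
    "\<And>\<theta>. \<theta> \<in> {0..\<alpha>} \<Longrightarrow> ?W \<theta> \<noteq> 0 \<Longrightarrow> e \<theta> > 0"
    by blast
  have "\<exists>\<theta>\<in>{0<..<\<alpha>}. ?f \<alpha> - ?f 0 = (\<lambda>h. h * (Im \<mu> * e \<theta>)) (\<alpha> - 0)"
  proof (rule mvt_simple[OF \<alpha>])
    fix \<theta> assume "0 \<le> \<theta>" "\<theta> \<le> \<alpha>"
    then show "(?f has_derivative (\<lambda>h. h * (Im \<mu> * e \<theta>))) (at \<theta> within {0..\<alpha>})"
      using e(1)[of \<theta>] unfolding has_field_derivative_def mult_commute_abs by simp
  qed
  then obtain \<theta> where \<theta>: "\<theta> \<in> {0<..<\<alpha>}" "?f \<alpha> - ?f 0 = \<alpha> * (Im \<mu> * e \<theta>)"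
    by auto
  have "?f \<alpha> = 0" "?f 0 = 0"
    by (simp_all add: v flow_0)
  with \<theta>(2) \<alpha> have "Im \<mu> * e \<theta> = 0"
    by simp
  moreover have "Im \<mu> \<noteq> 0"
    using \<mu> by (simp add: complex_eq_iff)
  moreover have "e \<theta> > 0"
  proof (rule e(2))
    show "?W \<theta> \<noteq> 0"
    proof
      assume "?W \<theta> = 0"
      then have "flow (- \<mu>) \<theta> \<cdot> ?W \<theta> = 0"
        by (simp add: endo.zero_right)
      then have "(u, 0 :: complex^'l) = 0"
        using flow_inverse[of "- \<mu>" \<theta>] by (simp flip: endo_apply_times)
      with uv show False
        by (simp add: zero_prod_def)
    qed
  qed (use \<theta> in auto)
  ultimately show False
    by simp
qed

text \<open>The state at the bisector is a forward flow from one ray and a backward flow from the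
  other, which gives its pairing with itself opposite signs. The bounds ensure
  \<open>\<bar>2 * Re \<mu>\<bar> \<le> 1\<close> and half the opening below pi.\<close>

lemma not_spectral_low:
  assumes \<alpha>: "0 < \<alpha>" "\<alpha> < 2 * pi" and \<mu>: "\<mu> \<noteq> 0" "\<bar>Re \<mu>\<bar> \<le> 1 / 2"
  shows "\<not> spectral \<alpha> \<mu>"
proof (cases "Re \<mu> = 0")
  case True
  with not_spectral_imaginary assms show ?thesis by blast
next
  case nz: False
  show ?thesis
  proof
    assume "spectral \<alpha> \<mu>"
    then obtain u v where uv: "u \<noteq> 0" "v \<noteq> 0" and v: "flow \<mu> \<alpha> \<cdot> (u, 0) = (v, 0)"
      and bwd: "flow (- \<mu>) \<alpha> \<cdot> (v, 0) = (u, 0)"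
      by (rule spectralE)
    let ?\<beta> = "\<alpha> / 2" and ?s = "2 * Re \<mu>"
    have eq: "pairing (u, 0) (exp (?s *\<^sub>R (K ?\<beta> - K 0)) \<cdot> (u, 0))
        = pairing (v, 0) (exp (- ?s *\<^sub>R (K \<alpha> - K ?\<beta>)) \<cdot> (v, 0))"
    proof -
      have b: "exp (?s *\<^sub>R K ?\<beta>) \<in> bicomm"
        by (intro bicomm_exp bicomm_scaleR bicomm_K)
      have "pairing (u, 0) (exp (?s *\<^sub>R (K ?\<beta> - K 0)) \<cdot> (u, 0))
          = pairing (v, 0) ((exp ((2 * Re (- \<mu>)) *\<^sub>R K \<alpha>) * exp (?s *\<^sub>R K ?\<beta>)) \<cdot> (v, 0))"
        using pairing_flow[OF b, of "- \<mu>" \<alpha> "(v, 0)"] unfolding bwd by (simp only: K_0 diff_zero)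
      also have "exp ((2 * Re (- \<mu>)) *\<^sub>R K \<alpha>) * exp (?s *\<^sub>R K ?\<beta>) = exp ((2 * Re (- \<mu>)) *\<^sub>R K \<alpha> + ?s *\<^sub>R K ?\<beta>)"
        by (intro exp_add_commuting[symmetric] bicomm_commute bicomm_scaleR bicomm_K)
      also have "(2 * Re (- \<mu>)) *\<^sub>R K \<alpha> + ?s *\<^sub>R K ?\<beta> = - ?s *\<^sub>R (K \<alpha> - K ?\<beta>)"
        by (simp add: scaleR_diff_right)
      finally show ?thesis .
    qed
    show False
    proof (cases "Re \<mu> > 0")
      case True
      then show False
        using pairing_exp_sign(1)[of ?s 0 ?\<beta> u] pairing_exp_sign(2)[of ?s ?\<beta> \<alpha> v] eq \<alpha> \<mu> uv
        by simp
    next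
      case False
      then show False
        using pairing_exp_sign(2)[of "- ?s" 0 ?\<beta> u] pairing_exp_sign(1)[of "- ?s" ?\<beta> \<alpha> v] eq \<alpha> \<mu> uv nz
        by simp
    qed
  qed
qed

text \<open>For \<open>\<alpha> < pi\<close> the sign lemma covers the whole angle. The exponents at
  \<open>v\<close> and \<open>u\<close> are -1 and \<open>2 * Re \<mu> - 1 > 0\<close> if
  \<open>Re \<mu> > 0\<close>, and 1 and \<open>2 * Re \<mu> + 1 < 0\<close> otherwise; all have
  modulus at most 1.\<close>

lemma not_spectral_convex:
  assumes \<alpha>: "0 < \<alpha>" "\<alpha> < pi" and \<mu>: "1 / 2 < \<bar>Re \<mu>\<bar>" "\<bar>Re \<mu>\<bar> \<le> 1"
  shows "\<not> spectral \<alpha> \<mu>"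
proof
  assume "spectral \<alpha> \<mu>"
  then obtain u v where uv: "u \<noteq> 0" "v \<noteq> 0" and v: "flow \<mu> \<alpha> \<cdot> (u, 0) = (v, 0)"
    by (rule spectralE)
  let ?s = "2 * Re \<mu>"
  have eq: "pairing (v, 0) (exp (c *\<^sub>R K \<alpha>) \<cdot> (v, 0)) = pairing (u, 0) (exp ((?s + c) *\<^sub>R K \<alpha>) \<cdot> (u, 0))" for c
  proof -
    have b: "exp (c *\<^sub>R K \<alpha>) \<in> bicomm"
      by (intro bicomm_exp bicomm_scaleR bicomm_K)
    have "exp (?s *\<^sub>R K \<alpha>) * exp (c *\<^sub>R K \<alpha>) = exp ((?s + c) *\<^sub>R K \<alpha>)"
      using exp_add_commuting[of "?s *\<^sub>R K \<alpha>" "c *\<^sub>R K \<alpha>"] by (simp add: scaleR_add_left)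
    then show ?thesis
      using pairing_flow[OF b, of \<mu> \<alpha> "(u, 0)"] unfolding v by (simp only:)
  qed
  show False
  proof (cases "Re \<mu> > 0")
    case True
    then show False
      using pairing_exp_sign(2)[of 1 0 \<alpha> v] pairing_exp_sign(1)[of "?s - 1" 0 \<alpha> u] eq[of "- 1"] \<mu> \<alpha> uv
      by (simp add: K_0)
  next
    case False
    then show False
      using pairing_exp_sign(1)[of 1 0 \<alpha> v] pairing_exp_sign(2)[of "- (?s + 1)" 0 \<alpha> u] eq[of 1] \<mu> \<alpha> uv
      by (simp add: K_0) (smt (verit))
  qed
qed

section \<open>The openings pi and 2 pi\<close>

lemma spectral_pi_shift: "spectral pi (\<mu> + of_int n) \<longleftrightarrow> spectral pi \<mu>"
proof -
  have step: "spectral pi (\<mu> + 1) \<longleftrightarrow> spectral pi \<mu>" for \<mu>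
  proof -
    \<comment> \<open>Here \<open>Q (cis pi) = Q (- 1) = - 1\<close>, and a sign does not affect the
      spectral condition.\<close>
    have "flow (\<mu> + 1) pi = - flow \<mu> pi"
      using Q_minus[of 1] by (simp add: flow_add flow_1 Q_1)
    then show ?thesis
      by (simp add: spectral_def endo.minus_left)
  qed
  show ?thesis
  proof (induction n rule: int_induct[where k = 0])
    case (step1 i)
    then show ?case
      using step[of "\<mu> + of_int i"] by (simp add: add.assoc)
  next
    case (step2 i)
    then show ?case
      using step[of "\<mu> + of_int (i - 1)"] by simp
  qed simp
qed

text \<open>The flow with exponent 0 is the identity, so any nonzero displacement serves;
  \<open>axis undefined 1\<close> is one of them.\<close>

lemma spectral_0: "spectral \<alpha> 0"
proof -
  have "snd (flow 0 \<alpha> \<cdot> (axis undefined 1, 0)) = 0"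
    by (simp add: flow_def cscale_def)
  then show ?thesis
    unfolding spectral_def by (intro exI[of _ "axis undefined 1"]) (simp add: axis_eq_0_iff)
qed

lemma spectral_pi: "spectral pi \<mu> \<longleftrightarrow> \<mu> \<in> \<int>"
proof
  assume sp: "spectral pi \<mu>"
  \<comment> \<open>Shifting by the nearest integer brings the real part into the range of
    \<open>not_spectral_low\<close>, which leaves only the exponent 0.\<close>
  define n where "n = round (Re \<mu>)"
  have "\<bar>Re (\<mu> + of_int (- n))\<bar> \<le> 1 / 2"
    using of_int_round_abs_le[of "Re \<mu>"] by (simp add: n_def abs_minus_commute)
  moreover have "spectral pi (\<mu> + of_int (- n))"
    using sp by (simp only: spectral_pi_shift)
  ultimately have "\<mu> + of_int (- n) = 0"
    using not_spectral_low[of pi "\<mu> + of_int (- n)"] by auto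
  then have "\<mu> = of_int n"
    by simp
  then show "\<mu> \<in> \<int>"
    by simp
next
  assume "\<mu> \<in> \<int>"
  then obtain n where "\<mu> = of_int n"
    by (auto elim: Ints_cases)
  then show "spectral pi \<mu>"
    using spectral_pi_shift[of 0 n] spectral_0 by simp
qed

lemma spectral_2pi: "spectral (2 * pi) \<mu> \<longleftrightarrow> 2 * \<mu> \<in> \<int>"
  by (simp add: spectral_def flow_2pi flip: spectral_pi)

end

section \<open>Homogeneous functions in polar coordinates\<close>

lemma bounded_bilinear_scale: "bounded_bilinear (\<lambda>c (x :: complex^'n). c *s x)"
proof
  show "\<exists>K. \<forall>c (x :: complex^'n). norm (c *s x) \<le> norm c * norm x * K"
    by (intro exI[of _ 1]) (simp add: norm_vec_def norm_mult L2_set_right_distrib)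
qed (simp_all add: vec_eq_iff algebra_simps)

lemma polar_nth [simp]: "polar r \<theta> $ 1 = r * cos \<theta>" "polar r \<theta> $ 2 = r * sin \<theta>"
  by (simp_all add: polar_def)

lemma norm_polar: "0 \<le> r \<Longrightarrow> norm (polar r \<theta>) = r"
proof -
  assume "0 \<le> r"
  have "(r * cos \<theta>)\<^sup>2 + (r * sin \<theta>)\<^sup>2 = r\<^sup>2 * ((cos \<theta>)\<^sup>2 + (sin \<theta>)\<^sup>2)"
    by (simp only: power_mult_distrib distrib_left)
  with \<open>0 \<le> r\<close> show ?thesis
    by (simp add: norm_vec_def L2_set_def UNIV_2)
qed

lemma power_fun_polar:
  assumes "0 < r" "0 \<le> \<theta>" "\<theta> < 2 * pi"
  shows "power_fun \<mu> v (polar r \<theta>) = of_real r powr \<mu> *s v \<theta>"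
proof -
  have "Complex (r * cos \<theta>) (r * sin \<theta>) = of_real r * exp (\<i> * of_real \<theta>)"
    by (simp add: complex_eq_iff flip: cis_conv_exp)
  then have "Arg2pi (Complex (r * cos \<theta>) (r * sin \<theta>)) = \<theta>"
    using assms by (intro Arg2pi_unique[of r]) simp_all
  with assms show ?thesis
    by (simp add: power_fun_def norm_polar)
qed

text \<open>In complex notation the line is the base point times \<open>1 + t * c\<close>, with
  \<open>c\<close> the direction divided by the base point. The principal logarithm of this factor
  is smooth near \<open>t = 0\<close>, so the angle can be followed across any branch cut.\<close>

lemma polar_line:
  assumes r: "0 < r" and \<theta>: "0 < \<theta>" "\<theta> < \<alpha>"
  obtains l \<phi> :: "real \<Rightarrow> real" where
    "(l has_vector_derivative Re (e * cis (- \<theta>)) / r) (at 0)" "l 0 = ln r"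
    "(\<phi> has_vector_derivative Im (e * cis (- \<theta>)) / r) (at 0)" "\<phi> 0 = \<theta>"
    "\<forall>\<^sub>F t in nhds 0. polar r \<theta> + t *\<^sub>R vector [Re e, Im e] = polar (exp (l t)) (\<phi> t) \<and> 0 < \<phi> t \<and> \<phi> t < \<alpha>"
proof -
  define c where "c = e * cis (- \<theta>) / of_real r"
  define M where "M = (\<lambda>t. Ln (1 + of_real t * c))"
  define l where "l = (\<lambda>t. ln r + Re (M t))"
  define \<phi> where "\<phi> = (\<lambda>t. \<theta> + Im (M t))"
  have "((\<lambda>s. Ln (1 + s * c)) has_field_derivative c) (at (of_real 0))"
    by (auto intro!: derivative_eq_intros)
  from has_vector_derivative_real_field[OF this]
  have M': "(M has_vector_derivative c) (at 0)"
    by (simp only: M_def)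
  have M0: "M 0 = 0"
    by (simp add: M_def)
  have l': "(l has_vector_derivative Re c) (at 0)"
    unfolding l_def
    using has_vector_derivative_add[OF has_vector_derivative_const
        bounded_linear.has_vector_derivative[OF bounded_linear_Re M']] by simp
  have \<phi>': "(\<phi> has_vector_derivative Im c) (at 0)"
    unfolding \<phi>_def
    using has_vector_derivative_add[OF has_vector_derivative_const
        bounded_linear.has_vector_derivative[OF bounded_linear_Im M']] by simp
  have \<phi>0: "\<phi> 0 = \<theta>"
    by (simp add: \<phi>_def M0)
  have "isCont \<phi> 0"
    using has_vector_derivative_continuous[OF \<phi>'] .
  then have lim: "(\<phi> \<longlongrightarrow> \<theta>) (nhds 0)"
    unfolding isCont_def tendsto_at_iff_tendsto_nhds unfolding \<phi>0 .
  have "((\<lambda>t. 1 + of_real t * c) \<longlongrightarrow> 1 + of_real 0 * c) (nhds 0)"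
    by (intro tendsto_intros filterlim_ident)
  then have "\<forall>\<^sub>F t in nhds 0. 1 + of_real t * c \<noteq> 0"
    by (rule tendsto_imp_eventually_ne) simp
  moreover have "\<forall>\<^sub>F t in nhds 0. 0 < \<phi> t" "\<forall>\<^sub>F t in nhds 0. \<phi> t < \<alpha>"
    using order_tendstoD[OF lim] \<theta> by auto
  ultimately have "\<forall>\<^sub>F t in nhds 0. polar r \<theta> + t *\<^sub>R vector [Re e, Im e] = polar (exp (l t)) (\<phi> t) \<and> 0 < \<phi> t \<and> \<phi> t < \<alpha>"
  proof eventually_elim
    case (elim t)
    have "of_real (exp (l t)) * cis (\<phi> t) = of_real r * cis \<theta> * (of_real (exp (Re (M t))) * cis (Im (M t)))"
      using r by (simp add: l_def \<phi>_def exp_add cis_mult[symmetric])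
    also have "of_real (exp (Re (M t))) * cis (Im (M t)) = exp (M t)"
      by (simp add: exp_eq_polar)
    also have "\<dots> = 1 + of_real t * c"
      using elim(1) by (simp add: M_def)
    also have "of_real r * cis \<theta> * (1 + of_real t * c) = of_real r * cis \<theta> + of_real t * e * (cis \<theta> * cis (- \<theta>))"
      using r by (simp only: c_def) (simp add: field_simps)
    also have "\<dots> = of_real r * cis \<theta> + of_real t * e"
      by (simp add: cis_mult)
    finally have eq: "of_real (exp (l t)) * cis (\<phi> t) = of_real r * cis \<theta> + of_real t * e" .
    have "polar r \<theta> + t *\<^sub>R vector [Re e, Im e] = polar (exp (l t)) (\<phi> t)"
      using arg_cong[OF eq, of Re] arg_cong[OF eq, of Im] by (simp add: vec_eq_iff forall_2)
    with elim show ?case by blast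
  qed
  moreover have "Re c = Re (e * cis (- \<theta>)) / r" "Im c = Im (e * cis (- \<theta>)) / r"
    by (simp_all only: c_def Re_divide_of_real Im_divide_of_real)
  ultimately show thesis
    using l' \<phi>' \<phi>0 by (intro that[of l \<phi>]) (simp_all add: l_def M0)
qed

text \<open>Chain rule along \<open>polar_line\<close>. The direction is a complex number
  \<open>e\<close>, whose rotation by \<open>- \<theta>\<close> has the radial and the angular
  component as real and imaginary part.\<close>

lemma line_derivative_homogeneous:
  fixes f :: "real \<Rightarrow> complex^'n"
  assumes w: "\<And>\<rho> \<phi>. 0 < \<rho> \<Longrightarrow> 0 < \<phi> \<Longrightarrow> \<phi> < \<alpha> \<Longrightarrow> w (polar \<rho> \<phi>) = of_real \<rho> powr \<mu> *s f \<phi>"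
    and f: "(f has_vector_derivative f') (at \<theta>)"
    and r: "0 < r" and \<theta>: "0 < \<theta>" "\<theta> < \<alpha>"
  shows "((\<lambda>t. w (polar r \<theta> + t *\<^sub>R vector [Re e, Im e])) has_vector_derivative
    of_real r powr (\<mu> - 1) *s (Re (e * cis (- \<theta>)) *\<^sub>R (\<mu> *s f \<theta>) + Im (e * cis (- \<theta>)) *\<^sub>R f')) (at 0)"
proof -
  obtain l \<phi> :: "real \<Rightarrow> real" where l: "(l has_vector_derivative Re (e * cis (- \<theta>)) / r) (at 0)" "l 0 = ln r"
    and \<phi>: "(\<phi> has_vector_derivative Im (e * cis (- \<theta>)) / r) (at 0)" "\<phi> 0 = \<theta>"
    and ev: "\<forall>\<^sub>F t in nhds 0. polar r \<theta> + t *\<^sub>R vector [Re e, Im e] = polar (exp (l t)) (\<phi> t) \<and> 0 < \<phi> t \<and> \<phi> t < \<alpha>"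
    by (rule polar_line[OF r \<theta>])
  define a where "a = Re (e * cis (- \<theta>))"
  define b where "b = Im (e * cis (- \<theta>))"
  let ?g = "\<lambda>t. exp (\<mu> * of_real (l t)) *s f (\<phi> t)"
  have exp_r: "exp (\<mu> * of_real (l 0)) = of_real r powr \<mu>"
    using r by (simp add: l(2) powr_def Ln_of_real)
  have 1: "((\<lambda>t. exp (\<mu> * of_real (l t))) has_vector_derivative (\<mu> * of_real (a / r)) * exp (\<mu> * of_real (l 0))) (at 0)"
  proof -
    have "((\<lambda>t. \<mu> * of_real (l t)) has_vector_derivative \<mu> * of_real (a / r)) (at 0)"
      using bounded_linear.has_vector_derivative[OF bounded_linear_compose[OF bounded_linear_mult_right bounded_linear_of_real] l(1)]
      by (simp only: a_def)
    moreover have "(exp has_field_derivative exp (\<mu> * of_real (l 0))) (at (\<mu> * of_real (l 0)))"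
      by (rule DERIV_exp)
    ultimately show ?thesis
      using field_vector_diff_chain_at[of "\<lambda>t. \<mu> * of_real (l t)" "\<mu> * of_real (a / r)" 0 exp] by (simp add: o_def)
  qed
  have 2: "((\<lambda>t. f (\<phi> t)) has_vector_derivative (b / r) *\<^sub>R f') (at 0)"
    using vector_diff_chain_at[OF \<phi>(1), of f f'] f by (simp add: o_def \<phi>(2) b_def)
  have "(?g has_vector_derivative exp (\<mu> * of_real (l 0)) *s ((b / r) *\<^sub>R f')
      + ((\<mu> * of_real (a / r)) * exp (\<mu> * of_real (l 0))) *s f (\<phi> 0)) (at 0)"
    by (rule bounded_bilinear.has_vector_derivative[OF bounded_bilinear_scale 1 2])
  moreover have "exp (\<mu> * of_real (l 0)) *s ((b / r) *\<^sub>R f')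
      + ((\<mu> * of_real (a / r)) * exp (\<mu> * of_real (l 0))) *s f (\<phi> 0)
      = of_real r powr (\<mu> - 1) *s (a *\<^sub>R (\<mu> *s f \<theta>) + b *\<^sub>R f')"
  proof -
    define P where "P = of_real r powr (\<mu> - 1)"
    have P: "of_real r powr \<mu> = of_real r * P"
      using r by (simp add: P_def powr_diff)
    show ?thesis
      using r unfolding exp_r \<phi>(2) scaleR_eq_scale P P_def[symmetric]
      by (simp add: vec_eq_iff field_simps)
  qed
  moreover have ev_g: "\<forall>\<^sub>F t in nhds 0. w (polar r \<theta> + t *\<^sub>R vector [Re e, Im e]) = ?g t"
    using ev
  proof eventually_elim
    case (elim t)
    then have "w (polar r \<theta> + t *\<^sub>R vector [Re e, Im e]) = of_real (exp (l t)) powr \<mu> *s f (\<phi> t)"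
      by (simp add: w)
    also have "of_real (exp (l t)) powr \<mu> = exp (\<mu> * of_real (l t))"
      by (simp add: powr_def Ln_of_real)
    finally show ?case .
  qed
  moreover have "w (polar r \<theta> + 0 *\<^sub>R vector [Re e, Im e]) = ?g 0"
    by (rule eventually_nhds_x_imp_x[OF ev_g])
  ultimately show ?thesis
    using has_vector_derivative_cong_ev[where S = UNIV and x = 0 and g = ?g
        and f = "\<lambda>t. w (polar r \<theta> + t *\<^sub>R vector [Re e, Im e])"] ev_g
    unfolding a_def b_def by simp
qed

lemma partial_deriv_homogeneous:
  fixes f :: "real \<Rightarrow> complex^'n"
  assumes w: "\<And>\<rho> \<phi>. 0 < \<rho> \<Longrightarrow> 0 < \<phi> \<Longrightarrow> \<phi> < \<alpha> \<Longrightarrow> w (polar \<rho> \<phi>) = of_real \<rho> powr \<mu> *s f \<phi>"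
    and f: "(f has_vector_derivative f') (at \<theta>)"
    and r: "0 < r" and \<theta>: "0 < \<theta>" "\<theta> < \<alpha>"
  shows "partial_deriv 1 w (polar r \<theta>) = of_real r powr (\<mu> - 1) *s (cos \<theta> *\<^sub>R (\<mu> *s f \<theta>) - sin \<theta> *\<^sub>R f')"
    and "partial_deriv 2 w (polar r \<theta>) = of_real r powr (\<mu> - 1) *s (sin \<theta> *\<^sub>R (\<mu> *s f \<theta>) + cos \<theta> *\<^sub>R f')"
proof -
  have axis: "axis 1 1 = (vector [Re 1, Im 1] :: real^2)" "axis 2 1 = (vector [Re \<i>, Im \<i>] :: real^2)"
    by (simp_all add: vec_eq_iff forall_2 axis_def)
  show "partial_deriv 1 w (polar r \<theta>) = of_real r powr (\<mu> - 1) *s (cos \<theta> *\<^sub>R (\<mu> *s f \<theta>) - sin \<theta> *\<^sub>R f')"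
    using vector_derivative_at[OF line_derivative_homogeneous[OF assms, of 1]]
    unfolding partial_deriv_def axis by simp
  show "partial_deriv 2 w (polar r \<theta>) = of_real r powr (\<mu> - 1) *s (sin \<theta> *\<^sub>R (\<mu> *s f \<theta>) + cos \<theta> *\<^sub>R f')"
    using vector_derivative_at[OF line_derivative_homogeneous[OF assms, of \<i>]]
    unfolding partial_deriv_def axis by simp
qed

text \<open>Makes limits from inside unique.\<close>

lemma at_boundary_ray_nontrivial:
  fixes \<alpha> r \<phi> :: real
  assumes "0 < \<alpha>" "0 < r" "\<phi> = 0 \<or> \<phi> = \<alpha>"
  shows "at (r, \<phi>) within {0<..} \<times> {0<..<\<alpha>} \<noteq> bot"
proof -
  have "(r, \<phi>) \<in> closure ({0<..} \<times> {0<..<\<alpha>})"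
  proof -
    have "r \<in> closure {0<..}" "\<phi> \<in> closure {0<..<\<alpha>}"
      using closure_subset[of "{0 :: real<..}"] closure_greaterThanLessThan[OF assms(1)] assms by auto
    then show ?thesis
      by (simp add: closure_Times)
  qed
  moreover have "(r, \<phi>) \<notin> {0<..} \<times> {0<..<\<alpha>}"
    using assms by auto
  ultimately show ?thesis
    by (auto simp: closure_def trivial_limit_within)
qed

text \<open>The limit is the value of the continuous extension to the closed range of angles. As it
  is taken in polar parameters, the two sides of a slit stay apart.\<close>

lemma has_inner_limit_homogeneous_iff:
  fixes f :: "real \<Rightarrow> complex^'n"
  assumes w: "\<And>\<rho> \<phi>. 0 < \<rho> \<Longrightarrow> 0 < \<phi> \<Longrightarrow> \<phi> < \<alpha> \<Longrightarrow> w (polar \<rho> \<phi>) = of_real \<rho> powr \<mu> *s f \<phi>"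
    and f: "continuous_on {0..\<alpha>} f"
    and \<alpha>: "0 < \<alpha>" and r: "0 < r" and \<phi>: "\<phi> = 0 \<or> \<phi> = \<alpha>"
  shows "has_inner_limit \<alpha> w d r \<phi> \<longleftrightarrow> d = of_real r powr \<mu> *s f \<phi>"
proof -
  let ?F = "at (r, \<phi>) within {0<..} \<times> {0<..<\<alpha>}"
  let ?g = "\<lambda>p. of_real (fst p) powr \<mu> *s f (snd p)"
  have "continuous_on ({0<..} \<times> {0..\<alpha>}) ?g"
  proof (rule bounded_bilinear.continuous_on[OF bounded_bilinear_scale])
    have "continuous_on ({0<..} \<times> {0..\<alpha>}) (\<lambda>p. exp (\<mu> * of_real (ln (fst p))))"
      by (intro continuous_on_exp continuous_on_mult continuous_on_const continuous_on_of_real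
          continuous_on_ln continuous_on_fst continuous_on_id) simp
    then show "continuous_on ({0<..} \<times> {0..\<alpha>}) (\<lambda>p. complex_of_real (fst p) powr \<mu>)"
      by (rule continuous_on_eq) (simp add: mem_Times_iff powr_def Ln_of_real)
    show "continuous_on ({0<..} \<times> {0..\<alpha>}) (\<lambda>p :: real \<times> real. f (snd p))"
      by (rule continuous_on_compose2[OF f continuous_on_snd[OF continuous_on_id]]) auto
  qed
  moreover have "(r, \<phi>) \<in> {0<..} \<times> {0..\<alpha>}"
    using r \<phi> \<alpha> by auto
  ultimately have "(?g \<longlongrightarrow> ?g (r, \<phi>)) (at (r, \<phi>) within {0<..} \<times> {0..\<alpha>})"
    unfolding continuous_on_def by (rule bspec)
  then have "(?g \<longlongrightarrow> of_real r powr \<mu> *s f \<phi>) ?F"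
    unfolding fst_conv snd_conv by (rule tendsto_within_subset) auto
  moreover have "\<forall>\<^sub>F p in ?F. ?g p = (\<lambda>(\<rho>, \<theta>). w (polar \<rho> \<theta>)) p"
    unfolding eventually_at_filter by (intro always_eventually) (auto simp: w)
  ultimately have lim: "((\<lambda>(\<rho>, \<theta>). w (polar \<rho> \<theta>)) \<longlongrightarrow> of_real r powr \<mu> *s f \<phi>) ?F"
    by (rule Lim_transform_eventually)
  show ?thesis
    unfolding has_inner_limit_def
    using tendsto_unique[OF at_boundary_ray_nontrivial[OF \<alpha> r \<phi>] _ lim] lim by blast
qed

section \<open>Smoothness\<close>

text \<open>By induction every iterated derivative agrees on the interval with a member of
  \<open>F\<close>.\<close>

lemma smooth_on_interval_if_closed:
  assumes closed: "\<And>g. g \<in> F \<Longrightarrow> \<exists>g'\<in>F. \<forall>t\<in>{a..b}. (g has_vector_derivative g' t) (at t within {a..b})"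
    and v: "v \<in> F" and ab: "a < b"
  shows "smooth_on_interval a b v"
proof -
  let ?D = "\<lambda>f t. vector_derivative f (at t within {a..b})"
  have "\<exists>g\<in>F. \<forall>t\<in>{a..b}. (?D ^^ k) v t = g t" for k
  proof (induction k)
    case (Suc k)
    then obtain g where g: "g \<in> F" "\<And>t. t \<in> {a..b} \<Longrightarrow> (?D ^^ k) v t = g t"
      by blast
    obtain g' where g': "g' \<in> F" "\<And>t. t \<in> {a..b} \<Longrightarrow> (g has_vector_derivative g' t) (at t within {a..b})"
      using closed[OF g(1)] by blast
    have "(?D ^^ Suc k) v t = g' t" if t: "t \<in> {a..b}" for t
    proof -
      have "((?D ^^ k) v has_vector_derivative g' t) (at t within {a..b})"
        by (rule has_vector_derivative_transform[OF t g(2) g'(2)[OF t]])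
      then show ?thesis
        using vector_derivative_within_cbox[OF ab, of t] t by (simp add: cbox_interval)
    qed
    with g'(1) show ?case by blast
  qed (use v in auto)
  moreover have "f differentiable_on {a..b}" if g: "g \<in> F" "\<forall>t\<in>{a..b}. f t = g t" for f g
  proof -
    obtain g' where "g' \<in> F" "\<forall>t\<in>{a..b}. (g has_vector_derivative g' t) (at t within {a..b})"
      using closed[OF g(1)] by blast
    then have "(f has_vector_derivative g' t) (at t within {a..b})" if "t \<in> {a..b}" for t
      using g(2) that by (intro has_vector_derivative_transform[of t "{a..b}" f g "g' t"]) auto
    then show ?thesis
      unfolding differentiable_on_def differentiable_def has_vector_derivative_def by blast
  qed
  ultimately show ?thesis
    unfolding smooth_on_interval_def by blast
qed

lemma smooth_on_interval_derivatives:
  assumes v: "smooth_on_interval a b v"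
  obtains v1 v2 where "\<And>t. t \<in> {a..b} \<Longrightarrow> (v has_vector_derivative v1 t) (at t within {a..b})"
    "\<And>t. t \<in> {a..b} \<Longrightarrow> (v1 has_vector_derivative v2 t) (at t within {a..b})"
proof -
  let ?D = "\<lambda>f t. vector_derivative f (at t within {a..b})"
  have "((?D ^^ k) v has_vector_derivative (?D ^^ Suc k) v t) (at t within {a..b})" if "t \<in> {a..b}" for t k
    using v that vector_derivative_works[of "(?D ^^ k) v" "at t within {a..b}"]
    by (simp add: smooth_on_interval_def differentiable_on_def)
  from this[of _ 0] this[of _ 1] show thesis
    by (intro that[of "?D v" "?D (?D v)"]) simp_all
qed

section \<open>The model problem as a first-order system\<close>

text \<open>Angular factor of the first partial derivative of a function of degree \<mu>; the radial
  factor has exponent \<open>\<mu> - 1\<close>.\<close>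

definition grad1 :: "complex \<Rightarrow> (real \<Rightarrow> complex^'n) \<Rightarrow> (real \<Rightarrow> complex^'n) \<Rightarrow> real \<Rightarrow> complex^'n" where
  "grad1 \<mu> v v' \<theta> = cos \<theta> *\<^sub>R (\<mu> *s v \<theta>) - sin \<theta> *\<^sub>R v' \<theta>"

definition grad2 :: "complex \<Rightarrow> (real \<Rightarrow> complex^'n) \<Rightarrow> (real \<Rightarrow> complex^'n) \<Rightarrow> real \<Rightarrow> complex^'n" where
  "grad2 \<mu> v v' \<theta> = sin \<theta> *\<^sub>R (\<mu> *s v \<theta>) + cos \<theta> *\<^sub>R v' \<theta>"

lemma grad_has_vector_derivative:
  assumes "(v has_vector_derivative v1 t) (at t within S)" "(v1 has_vector_derivative v2 t) (at t within S)"
  shows "(grad1 \<mu> v v1 has_vector_derivative grad1 \<mu> v1 v2 t - grad2 \<mu> v v1 t) (at t within S)"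
    and "(grad2 \<mu> v v1 has_vector_derivative grad2 \<mu> v1 v2 t + grad1 \<mu> v v1 t) (at t within S)"
proof -
  have sc: "((\<lambda>t. sin t) has_field_derivative cos t) (at t within S)"
    "((\<lambda>t. cos t) has_field_derivative - sin t) (at t within S)"
    by (auto intro!: derivative_eq_intros)
  have \<mu>v: "((\<lambda>t. \<mu> *s v t) has_vector_derivative \<mu> *s v1 t) (at t within S)"
    by (rule bounded_linear.has_vector_derivative[OF bounded_linear_scale assms(1)])
  have "((\<lambda>t. cos t *\<^sub>R (\<mu> *s v t) - sin t *\<^sub>R v1 t) has_vector_derivative
      (cos t *\<^sub>R (\<mu> *s v1 t) + - sin t *\<^sub>R (\<mu> *s v t)) - (sin t *\<^sub>R v2 t + cos t *\<^sub>R v1 t)) (at t within S)"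
    by (intro has_vector_derivative_diff has_vector_derivative_scaleR sc \<mu>v assms)
  then show "(grad1 \<mu> v v1 has_vector_derivative grad1 \<mu> v1 v2 t - grad2 \<mu> v v1 t) (at t within S)"
    by (simp add: grad1_def[abs_def] grad2_def algebra_simps)
  have "((\<lambda>t. sin t *\<^sub>R (\<mu> *s v t) + cos t *\<^sub>R v1 t) has_vector_derivative
      (sin t *\<^sub>R (\<mu> *s v1 t) + cos t *\<^sub>R (\<mu> *s v t)) + (cos t *\<^sub>R v2 t + - sin t *\<^sub>R v1 t)) (at t within S)"
    by (intro has_vector_derivative_add has_vector_derivative_scaleR sc \<mu>v assms)
  then show "(grad2 \<mu> v v1 has_vector_derivative grad2 \<mu> v1 v2 t + grad1 \<mu> v v1 t) (at t within S)"
    by (simp add: grad1_def grad2_def[abs_def] algebra_simps)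
qed

context formally_positive_tuple
begin

definition traction :: "complex^'l \<Rightarrow> complex^'l \<Rightarrow> real \<Rightarrow> complex^'l" where
  "traction g h \<theta> = - sin \<theta> *\<^sub>R (cmul A11 g + cmul A12 h) + cos \<theta> *\<^sub>R (cmul A12 g + cmul A22 h)"

definition radial_stress :: "complex^'l \<Rightarrow> complex^'l \<Rightarrow> real \<Rightarrow> complex^'l" where
  "radial_stress g h \<theta> = cos \<theta> *\<^sub>R (cmul A11 g + cmul A12 h) + sin \<theta> *\<^sub>R (cmul A12 g + cmul A22 h)"

text \<open>Counterpart of \<open>H_cases\<close> for prescribed gradients: the radial derivatives
  of displacement and stress function go to the angular ones. The traction is minus the radial
  derivative of the stress function.\<close>

lemma H_rotate:
  "H \<theta> \<cdot> (cos \<theta> *\<^sub>R g + sin \<theta> *\<^sub>R h, - traction g h \<theta>) = (cos \<theta> *\<^sub>R h - sin \<theta> *\<^sub>R g, radial_stress g h \<theta>)"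
proof -
  define z where "z = (g, - (cmul A12 g + cmul A22 h))"
  define z' where "z' = (h, cmul A11 g + cmul A12 h)"
  have N: "N \<cdot> z = z'"
    unfolding z_def z'_def by (rule N_apply)
  define x where "x = cos \<theta> *\<^sub>R z + sin \<theta> *\<^sub>R z'"
  define y where "y = cos \<theta> *\<^sub>R z' - sin \<theta> *\<^sub>R z"
  have cs: "cos \<theta> * cos \<theta> + sin \<theta> * sin \<theta> = 1"
    by (metis power2_eq_square sin_cos_squared_add2)
  have "cos \<theta> *\<^sub>R x - sin \<theta> *\<^sub>R y = (cos \<theta> * cos \<theta> + sin \<theta> * sin \<theta>) *\<^sub>R z"
    by (simp add: x_def y_def algebra_simps del: sin_cos_squared_add3)
  then have z: "cos \<theta> *\<^sub>R x - sin \<theta> *\<^sub>R y = z"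
    by (simp only: cs scaleR_one)
  have "sin \<theta> *\<^sub>R x + cos \<theta> *\<^sub>R y = (cos \<theta> * cos \<theta> + sin \<theta> * sin \<theta>) *\<^sub>R z'"
    by (simp add: x_def y_def algebra_simps del: sin_cos_squared_add3)
  then have z': "sin \<theta> *\<^sub>R x + cos \<theta> *\<^sub>R y = z'"
    by (simp only: cs scaleR_one)
  have "N \<cdot> (cos \<theta> *\<^sub>R x - sin \<theta> *\<^sub>R y) = sin \<theta> *\<^sub>R x + cos \<theta> *\<^sub>R y"
    unfolding z z' by (rule N)
  then have "Q (\<i> * cis \<theta>) \<cdot> x = Q (cis \<theta>) \<cdot> y"
    by (simp add: Q_apply endo.diff_right endo.scaleR_right algebra_simps)
  moreover have "H \<theta> = R (cis \<theta>) * Q (\<i> * cis \<theta>)"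
    unfolding H_def by (intro bicomm_commute bicomm_Q bicomm_R) simp
  ultimately have "H \<theta> \<cdot> x = y"
    using R_inverse(1)[of "cis \<theta>"] by (metis cis_neq_zero endo_apply_one endo_apply_times)
  moreover have "x = (cos \<theta> *\<^sub>R g + sin \<theta> *\<^sub>R h, - traction g h \<theta>)"
    by (simp add: x_def z_def z'_def traction_def scaleR_diff_right scaleR_add_right)
  moreover have "y = (cos \<theta> *\<^sub>R h - sin \<theta> *\<^sub>R g, radial_stress g h \<theta>)"
    by (simp add: y_def z_def z'_def radial_stress_def scaleR_diff_right scaleR_add_right)
  ultimately show ?thesis by simp
qed

text \<open>Angular factor of the differential operator applied to \<open>power_fun \<mu> v\<close>;
  the radial factor has exponent \<open>\<mu> - 2\<close>. Here \<open>g'\<close> and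
  \<open>h'\<close> are the \<theta>-derivatives of \<open>g\<close> and \<open>h\<close>.\<close>

definition residual :: "complex \<Rightarrow> (real \<Rightarrow> complex^'l) \<Rightarrow> (real \<Rightarrow> complex^'l) \<Rightarrow> (real \<Rightarrow> complex^'l) \<Rightarrow> real \<Rightarrow> complex^'l" where
  "residual \<mu> v v1 v2 \<theta> =
     (let g = grad1 \<mu> v v1 \<theta>; h = grad2 \<mu> v v1 \<theta>;
        g' = grad1 \<mu> v1 v2 \<theta> - h; h' = grad2 \<mu> v1 v2 \<theta> + g in
      cmul A11 (cos \<theta> *\<^sub>R ((\<mu> - 1) *s g) - sin \<theta> *\<^sub>R g')
      + 2 *\<^sub>R cmul A12 (cos \<theta> *\<^sub>R ((\<mu> - 1) *s h) - sin \<theta> *\<^sub>R h')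
      + cmul A22 (sin \<theta> *\<^sub>R ((\<mu> - 1) *s h) + cos \<theta> *\<^sub>R h'))"

text \<open>The divergence of the stresses in polar coordinates.\<close>

lemma traction_has_vector_derivative:
  assumes "(v has_vector_derivative v1 t) (at t within S)" "(v1 has_vector_derivative v2 t) (at t within S)"
  shows "((\<lambda>t. traction (grad1 \<mu> v v1 t) (grad2 \<mu> v v1 t) t) has_vector_derivative
    residual \<mu> v v1 v2 t - \<mu> *s radial_stress (grad1 \<mu> v v1 t) (grad2 \<mu> v v1 t) t) (at t within S)"
proof -
  define g where "g = grad1 \<mu> v v1 t"
  define h where "h = grad2 \<mu> v v1 t"
  define g' where "g' = grad1 \<mu> v1 v2 t - h"
  define h' where "h' = grad2 \<mu> v1 v2 t + g"
  have d: "(grad1 \<mu> v v1 has_vector_derivative g') (at t within S)"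
    "(grad2 \<mu> v v1 has_vector_derivative h') (at t within S)"
    using grad_has_vector_derivative[of v v1 t S v2, OF assms] by (simp_all add: g_def h_def g'_def h'_def)
  have c: "((\<lambda>t. cmul A (f t)) has_vector_derivative cmul A f') (at t within S)"
    if "(f has_vector_derivative f') (at t within S)" for f f' and A :: "real^'l^'l"
    by (rule bounded_linear.has_vector_derivative[OF bounded_linear_cmul that])
  have sc: "((\<lambda>t. - sin t) has_field_derivative - cos t) (at t within S)"
    "((\<lambda>t. cos t) has_field_derivative - sin t) (at t within S)"
    by (auto intro!: derivative_eq_intros)
  have "((\<lambda>t. traction (grad1 \<mu> v v1 t) (grad2 \<mu> v v1 t) t) has_vector_derivative
      (- sin t *\<^sub>R (cmul A11 g' + cmul A12 h') + - cos t *\<^sub>R (cmul A11 g + cmul A12 h))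
      + (cos t *\<^sub>R (cmul A12 g' + cmul A22 h') + - sin t *\<^sub>R (cmul A12 g + cmul A22 h))) (at t within S)"
    unfolding traction_def g_def h_def
    by (intro has_vector_derivative_add has_vector_derivative_scaleR sc c d)
  \<comment> \<open>Equality of the mixed second derivatives; it splits the doubled
    \<open>A12\<close> term evenly between the divergences of the two stresses.\<close>
  moreover have "sin t *\<^sub>R ((\<mu> - 1) *s g) + cos t *\<^sub>R g' = cos t *\<^sub>R ((\<mu> - 1) *s h) - sin t *\<^sub>R h'"
    unfolding g_def h_def g'_def h'_def grad1_def grad2_def scaleR_eq_scale
    by (simp add: vec_eq_iff algebra_simps)
  then have "residual \<mu> v v1 v2 t =
      cmul A11 (cos t *\<^sub>R ((\<mu> - 1) *s g) - sin t *\<^sub>R g')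
      + cmul A12 (cos t *\<^sub>R ((\<mu> - 1) *s h) - sin t *\<^sub>R h')
      + cmul A12 (sin t *\<^sub>R ((\<mu> - 1) *s g) + cos t *\<^sub>R g')
      + cmul A22 (sin t *\<^sub>R ((\<mu> - 1) *s h) + cos t *\<^sub>R h')"
    by (simp add: residual_def Let_def g_def h_def g'_def h'_def scaleR_2)
  then have "residual \<mu> v v1 v2 t - \<mu> *s radial_stress g h t =
      (- sin t *\<^sub>R (cmul A11 g' + cmul A12 h') + - cos t *\<^sub>R (cmul A11 g + cmul A12 h))
      + (cos t *\<^sub>R (cmul A12 g' + cmul A22 h') + - sin t *\<^sub>R (cmul A12 g + cmul A22 h))"
    unfolding radial_stress_def
    by (simp only: cmul_simps cmul_scale) (simp add: scaleR_eq_scale vec_eq_iff algebra_simps)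
  ultimately show ?thesis
    by (simp add: g_def h_def)
qed

section \<open>The model problem in terms of the angular function\<close>

context
  fixes \<mu> :: complex and \<alpha> :: real and v v1 v2 :: "real \<Rightarrow> complex^'l"
  assumes \<alpha>: "0 < \<alpha>" "\<alpha> \<le> 2 * pi"
    and v: "\<And>t. t \<in> {0..\<alpha>} \<Longrightarrow> (v has_vector_derivative v1 t) (at t within {0..\<alpha>})"
    and v1: "\<And>t. t \<in> {0..\<alpha>} \<Longrightarrow> (v1 has_vector_derivative v2 t) (at t within {0..\<alpha>})"
begin

lemma partial_deriv_power_fun:
  assumes "0 < r" "0 < \<theta>" "\<theta> < \<alpha>"
  shows "partial_deriv 1 (power_fun \<mu> v) (polar r \<theta>) = of_real r powr (\<mu> - 1) *s grad1 \<mu> v v1 \<theta>"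
    and "partial_deriv 2 (power_fun \<mu> v) (polar r \<theta>) = of_real r powr (\<mu> - 1) *s grad2 \<mu> v v1 \<theta>"
proof -
  have w: "power_fun \<mu> v (polar \<rho> \<phi>) = of_real \<rho> powr \<mu> *s v \<phi>" if "0 < \<rho>" "0 < \<phi>" "\<phi> < \<alpha>" for \<rho> \<phi>
    using that \<alpha> by (intro power_fun_polar) auto
  have d: "(v has_vector_derivative v1 \<theta>) (at \<theta>)"
    using assms v[of \<theta>] by (intro has_vector_derivative_at_interior) auto
  show "partial_deriv 1 (power_fun \<mu> v) (polar r \<theta>) = of_real r powr (\<mu> - 1) *s grad1 \<mu> v v1 \<theta>"
    "partial_deriv 2 (power_fun \<mu> v) (polar r \<theta>) = of_real r powr (\<mu> - 1) *s grad2 \<mu> v v1 \<theta>"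
    using partial_deriv_homogeneous[OF w d assms] by (simp_all only: grad1_def grad2_def)
qed

lemma solves_equation_iff:
  "solves_equation A11 A12 A22 \<alpha> (power_fun \<mu> v) \<longleftrightarrow> (\<forall>\<theta>\<in>{0<..<\<alpha>}. residual \<mu> v v1 v2 \<theta> = 0)"
proof -
  let ?u = "power_fun \<mu> v"
  let ?op = "\<lambda>x. cmul A11 (partial_deriv 1 (partial_deriv 1 ?u) x)
      + 2 *\<^sub>R (cmul A12 (partial_deriv 1 (partial_deriv 2 ?u) x)) + cmul A22 (partial_deriv 2 (partial_deriv 2 ?u) x)"
  have op: "?op (polar r \<theta>) = of_real r powr (\<mu> - 1 - 1) *s residual \<mu> v v1 v2 \<theta>"
    if r: "0 < r" and \<theta>: "0 < \<theta>" "\<theta> < \<alpha>" for r \<theta>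
  proof -
    have d: "(v has_vector_derivative v1 \<theta>) (at \<theta>)" "(v1 has_vector_derivative v2 \<theta>) (at \<theta>)"
      using \<theta> v[of \<theta>] v1[of \<theta>] by (auto intro!: has_vector_derivative_at_interior)
    define g where "g = grad1 \<mu> v v1 \<theta>"
    define h where "h = grad2 \<mu> v v1 \<theta>"
    define g' where "g' = grad1 \<mu> v1 v2 \<theta> - h"
    define h' where "h' = grad2 \<mu> v1 v2 \<theta> + g"
    have dg: "(grad1 \<mu> v v1 has_vector_derivative g') (at \<theta>)"
      and dh: "(grad2 \<mu> v v1 has_vector_derivative h') (at \<theta>)"
      using grad_has_vector_derivative[of v v1 \<theta> UNIV v2, OF d] by (simp_all add: g_def h_def g'_def h'_def)
    let ?c = "of_real r powr (\<mu> - 1 - 1)"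
    have 11: "partial_deriv 1 (partial_deriv 1 ?u) (polar r \<theta>) = ?c *s (cos \<theta> *\<^sub>R ((\<mu> - 1) *s g) - sin \<theta> *\<^sub>R g')"
      unfolding g_def by (rule partial_deriv_homogeneous(1)[OF partial_deriv_power_fun(1) dg r \<theta>])
    have 12: "partial_deriv 1 (partial_deriv 2 ?u) (polar r \<theta>) = ?c *s (cos \<theta> *\<^sub>R ((\<mu> - 1) *s h) - sin \<theta> *\<^sub>R h')"
      unfolding h_def by (rule partial_deriv_homogeneous(1)[OF partial_deriv_power_fun(2) dh r \<theta>])
    have 22: "partial_deriv 2 (partial_deriv 2 ?u) (polar r \<theta>) = ?c *s (sin \<theta> *\<^sub>R ((\<mu> - 1) *s h) + cos \<theta> *\<^sub>R h')"
      unfolding h_def by (rule partial_deriv_homogeneous(2)[OF partial_deriv_power_fun(2) dh r \<theta>])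
    have lin: "c *s x + 2 *\<^sub>R (c *s y) + c *s z = c *s (x + 2 *\<^sub>R y + z)" for c and x y z :: "complex^'l"
      by (simp add: scaleR_eq_scale vec_eq_iff algebra_simps)
    show ?thesis
      unfolding 11 12 22 cmul_scale lin
      by (simp add: residual_def Let_def g_def h_def g'_def h'_def)
  qed
  have "solves_equation A11 A12 A22 \<alpha> ?u \<longleftrightarrow> (\<forall>r>0. \<forall>\<theta>\<in>{0<..<\<alpha>}. ?op (polar r \<theta>) = 0)"
    unfolding solves_equation_def sector_def by fastforce
  also have "\<dots> \<longleftrightarrow> (\<forall>r>(0 :: real). \<forall>\<theta>\<in>{0<..<\<alpha>}. residual \<mu> v v1 v2 \<theta> = 0)"
    by (simp add: op vec_eq_iff)
  also have "\<dots> \<longleftrightarrow> (\<forall>\<theta>\<in>{0<..<\<alpha>}. residual \<mu> v v1 v2 \<theta> = 0)"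
    using zero_less_one by blast
  finally show ?thesis .
qed

lemma neumann_on_ray_iff:
  assumes \<phi>: "\<phi> = 0 \<or> \<phi> = \<alpha>"
  shows "neumann_on_ray A11 A12 A22 \<alpha> \<phi> (power_fun \<mu> v) \<longleftrightarrow>
    traction (grad1 \<mu> v v1 \<phi>) (grad2 \<mu> v v1 \<phi>) \<phi> = 0"
proof -
  let ?u = "power_fun \<mu> v" and ?g = "grad1 \<mu> v v1" and ?h = "grad2 \<mu> v v1"
  have cont: "continuous_on {0..\<alpha>} ?g" "continuous_on {0..\<alpha>} ?h"
    by (rule continuous_on_if_has_vector_derivative, rule grad_has_vector_derivative[of v v1 _ _ v2, OF v v1], assumption+)+
  have lim: "has_inner_limit \<alpha> (partial_deriv 1 ?u) d r \<phi> \<longleftrightarrow> d = of_real r powr (\<mu> - 1) *s ?g \<phi>"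
    "has_inner_limit \<alpha> (partial_deriv 2 ?u) d r \<phi> \<longleftrightarrow> d = of_real r powr (\<mu> - 1) *s ?h \<phi>" if "0 < r" for d r
    using has_inner_limit_homogeneous_iff[OF partial_deriv_power_fun(1) cont(1) \<alpha>(1) that \<phi>]
      has_inner_limit_homogeneous_iff[OF partial_deriv_power_fun(2) cont(2) \<alpha>(1) that \<phi>] by auto
  have "neumann_on_ray A11 A12 A22 \<alpha> \<phi> ?u \<longleftrightarrow>
      (\<forall>r>0. of_real r powr (\<mu> - 1) *s traction (?g \<phi>) (?h \<phi>) \<phi> = 0)"
  proof -
    have "of_real r powr (\<mu> - 1) *s traction (?g \<phi>) (?h \<phi>) \<phi> =
      - sin \<phi> *\<^sub>R (cmul A11 (of_real r powr (\<mu> - 1) *s ?g \<phi>) + cmul A12 (of_real r powr (\<mu> - 1) *s ?h \<phi>))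
      + cos \<phi> *\<^sub>R (cmul A12 (of_real r powr (\<mu> - 1) *s ?g \<phi>) + cmul A22 (of_real r powr (\<mu> - 1) *s ?h \<phi>))" for r :: real
      unfolding traction_def cmul_scale scaleR_eq_scale by (simp add: vec_eq_iff algebra_simps)
    then show ?thesis
      unfolding neumann_on_ray_def Let_def vector_2 by (simp add: lim)
  qed
  also have "\<dots> \<longleftrightarrow> (\<forall>r::real>0. traction (?g \<phi>) (?h \<phi>) \<phi> = 0)"
    by (simp add: vec_eq_iff)
  also have "\<dots> \<longleftrightarrow> traction (?g \<phi>) (?h \<phi>) \<phi> = 0"
    using zero_less_one by blast
  finally show ?thesis .
qed

end


section \<open>Smoothness of the flow\<close>

inductive_set operator_polynomials :: "(real \<Rightarrow> 'l state endo) set" where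
  const: "(\<lambda>_. C) \<in> operator_polynomials"
| H: "H \<in> operator_polynomials"
| add: "X \<in> operator_polynomials \<Longrightarrow> Y \<in> operator_polynomials \<Longrightarrow> (\<lambda>t. X t + Y t) \<in> operator_polynomials"
| mult: "X \<in> operator_polynomials \<Longrightarrow> Y \<in> operator_polynomials \<Longrightarrow> (\<lambda>t. X t * Y t) \<in> operator_polynomials"

text \<open>The case of \<open>H\<close> is its Riccati equation; the others are the sum and product
  rules.\<close>

lemma operator_polynomials_deriv:
  assumes "X \<in> operator_polynomials"
  shows "\<exists>X'\<in>operator_polynomials. \<forall>t. (X has_vector_derivative X' t) (at t within S)"
  using assms
proof induction
  case (const C)
  show ?case
    by (rule bexI[OF _ operator_polynomials.const[of 0]]) (simp add: has_vector_derivative_const)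
next
  case H
  have "(\<lambda>t. - 1 + - 1 * (H t * H t)) \<in> operator_polynomials"
    by (intro operator_polynomials.intros)
  then show ?case
    by (rule bexI[rotated]) (use has_vector_derivative_H in simp)
next
  case (add X Y)
  then obtain X' Y' where XY: "X' \<in> operator_polynomials" "Y' \<in> operator_polynomials"
    and d: "\<And>t. (X has_vector_derivative X' t) (at t within S)" "\<And>t. (Y has_vector_derivative Y' t) (at t within S)"
    by blast
  show ?case
    by (rule bexI[OF _ operator_polynomials.add[OF XY]]) (intro allI has_vector_derivative_add d)
next
  case (mult X Y)
  then obtain X' Y' where XY: "X' \<in> operator_polynomials" "Y' \<in> operator_polynomials"
    and d: "\<And>t. (X has_vector_derivative X' t) (at t within S)" "\<And>t. (Y has_vector_derivative Y' t) (at t within S)"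
    by blast
  have "(\<lambda>t. X t * Y' t + X' t * Y t) \<in> operator_polynomials"
    by (intro operator_polynomials.add operator_polynomials.mult mult.hyps XY)
  then show ?case
    by (rule bexI[rotated]) (intro allI has_vector_derivative_mult d)
qed

lemma smooth_flow:
  assumes "0 < \<alpha>"
  shows "smooth_on_interval 0 \<alpha> (\<lambda>t. fst (flow \<mu> t \<cdot> x))"
proof (rule smooth_on_interval_if_closed)
  \<comment> \<open>Operator polynomials times the flow are closed under differentiation, as the
    flow only contributes the further factor \<open>cscale \<mu> * H t\<close>.\<close>
  let ?F = "(\<lambda>X t. fst ((X t * flow \<mu> t) \<cdot> x)) ` operator_polynomials"
  show "(\<lambda>t. fst (flow \<mu> t \<cdot> x)) \<in> ?F"
    by (rule image_eqI[of _ _ "\<lambda>_. 1"]) (simp_all add: operator_polynomials.const)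
  fix g assume "g \<in> ?F"
  then obtain X where X: "X \<in> operator_polynomials" "g = (\<lambda>t. fst ((X t * flow \<mu> t) \<cdot> x))"
    by blast
  obtain X' where X': "X' \<in> operator_polynomials" "\<And>t. (X has_vector_derivative X' t) (at t within {0..\<alpha>})"
    using operator_polynomials_deriv[OF X(1)] by blast
  let ?Y = "\<lambda>t. X t * (cscale \<mu> * H t) + X' t"
  have Y: "?Y \<in> operator_polynomials"
    by (intro operator_polynomials.add operator_polynomials.mult operator_polynomials.const
        operator_polynomials.H X(1) X'(1))
  have g': "(g has_vector_derivative fst ((?Y t * flow \<mu> t) \<cdot> x)) (at t within {0..\<alpha>})" if t: "t \<in> {0..\<alpha>}" for t
  proof -
    have eq: "X t * (cscale \<mu> * H t * flow \<mu> t) + X' t * flow \<mu> t = ?Y t * flow \<mu> t"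
      by (simp add: distrib_right mult.assoc)
    have "((\<lambda>t. X t * flow \<mu> t) has_vector_derivative ?Y t * flow \<mu> t) (at t within {0..\<alpha>})"
      unfolding eq[symmetric]
      by (rule has_vector_derivative_mult[OF X'(2) flow_has_vector_derivative[OF t]])
    from bounded_linear.has_vector_derivative[OF bounded_linear_fst
        bounded_linear.has_vector_derivative[OF endo.bounded_linear_left[of x] this]]
    show ?thesis
      unfolding X(2) .
  qed
  show "\<exists>g'\<in>?F. \<forall>t\<in>{0..\<alpha>}. (g has_vector_derivative g' t) (at t within {0..\<alpha>})"
    by (rule bexI[OF _ imageI[OF Y]]) (rule ballI, rule g')
qed (rule assms)

section \<open>The model problem and the spectral condition\<close>

lemma spectral_if_solution:
  assumes \<alpha>: "0 < \<alpha>" "\<alpha> \<le> 2 * pi" and \<mu>: "\<mu> \<noteq> 0"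
    and smooth: "smooth_on_interval 0 \<alpha> v" and nz: "\<exists>x\<in>sector \<alpha>. power_fun \<mu> v x \<noteq> 0"
    and sol: "solves_neumann_problem A11 A12 A22 \<alpha> (power_fun \<mu> v)"
  shows "spectral \<alpha> \<mu>"
proof -
  obtain v1 v2 where v: "\<And>t. t \<in> {0..\<alpha>} \<Longrightarrow> (v has_vector_derivative v1 t) (at t within {0..\<alpha>})"
    and v1: "\<And>t. t \<in> {0..\<alpha>} \<Longrightarrow> (v1 has_vector_derivative v2 t) (at t within {0..\<alpha>})"
    using smooth_on_interval_derivatives[OF smooth] by blast
  let ?g = "grad1 \<mu> v v1" and ?h = "grad2 \<mu> v v1"
  define T where "T = (\<lambda>t. traction (?g t) (?h t) t)"
  have res: "residual \<mu> v v1 v2 t = 0" if "0 < t" "t < \<alpha>" for t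
    using sol solves_equation_iff[OF \<alpha> v v1] that by (simp add: solves_neumann_problem_def)
  have T0: "T 0 = 0" "T \<alpha> = 0"
    using sol neumann_on_ray_iff[OF \<alpha> v v1] by (simp_all add: solves_neumann_problem_def T_def)
  have T': "(T has_vector_derivative residual \<mu> v v1 v2 t - \<mu> *s radial_stress (?g t) (?h t) t) (at t within {0..\<alpha>})"
    if "t \<in> {0..\<alpha>}" for t
    unfolding T_def by (rule traction_has_vector_derivative[of v v1 t "{0..\<alpha>}" v2, OF v[OF that] v1[OF that]])
  \<comment> \<open>The second component is the stress function: by homogeneity \<mu> times it is
    its radial derivative, which has to be minus the traction. Here \<open>\<mu> \<noteq> 0\<close>
    enters.\<close>
  define W where "W = (\<lambda>t. (v t, - (1 / \<mu>) *s T t))"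
  have W': "(W has_vector_derivative (v1 t, - (1 / \<mu>) *s (residual \<mu> v v1 v2 t - \<mu> *s radial_stress (?g t) (?h t) t))) (at t within {0..\<alpha>})"
    if "t \<in> {0..\<alpha>}" for t
    unfolding W_def
    by (intro has_vector_derivative_Pair v that
        bounded_linear.has_vector_derivative[OF bounded_linear_scale T'])
  have cs: "cos t * cos t + sin t * sin t = 1" for t :: real
    by (metis power2_eq_square sin_cos_squared_add2)
  have scaled: "cscale \<mu> \<cdot> W t = (cos t *\<^sub>R ?g t + sin t *\<^sub>R ?h t, - traction (?g t) (?h t) t)" for t
  proof -
    have "cos t *\<^sub>R ?g t + sin t *\<^sub>R ?h t = (cos t * cos t + sin t * sin t) *\<^sub>R (\<mu> *s v t)"
      by (simp add: grad1_def grad2_def algebra_simps del: sin_cos_squared_add3)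
    then have "cos t *\<^sub>R ?g t + sin t *\<^sub>R ?h t = \<mu> *s v t"
      by (simp only: cs scaleR_one)
    moreover have "\<mu> *s (- (1 / \<mu>) *s T t) = - T t"
      using \<mu> by (simp add: vec_eq_iff)
    ultimately show ?thesis
      by (simp add: W_def T_def)
  qed
  have v1_eq: "cos t *\<^sub>R ?h t - sin t *\<^sub>R ?g t = v1 t" for t
  proof -
    have "cos t *\<^sub>R ?h t - sin t *\<^sub>R ?g t = (cos t * cos t + sin t * sin t) *\<^sub>R v1 t"
      by (simp add: grad1_def grad2_def algebra_simps del: sin_cos_squared_add3)
    then show ?thesis
      by (simp only: cs scaleR_one)
  qed
  have "(W has_vector_derivative (cscale \<mu> * H t) \<cdot> W t) (at t within {0..\<alpha>})" if t: "0 < t" "t < \<alpha>" for t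
  proof -
    have "(cscale \<mu> * H t) \<cdot> W t = H t \<cdot> (cscale \<mu> \<cdot> W t)"
      unfolding bicomm_commute[OF bicomm_cscale bicomm_H] by (rule endo_apply_times)
    also have "\<dots> = (v1 t, radial_stress (?g t) (?h t) t)"
      unfolding scaled H_rotate v1_eq ..
    also have "radial_stress (?g t) (?h t) t = - (1 / \<mu>) *s (residual \<mu> v v1 v2 t - \<mu> *s radial_stress (?g t) (?h t) t)"
      using \<mu> by (simp add: res[OF t] vec_eq_iff)
    finally show ?thesis
      using W'[of t] t by simp
  qed
  moreover have "continuous_on {0..\<alpha>} W"
    by (rule continuous_on_if_has_vector_derivative[OF W'])
  ultimately have flow: "W t = flow \<mu> t \<cdot> W 0" if "t \<in> {0..\<alpha>}" for t
    using that by (intro flow_unique)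
  have W0: "W 0 = (v 0, 0)" "snd (W \<alpha>) = 0"
    by (simp_all add: W_def T0)
  \<comment> \<open>The starting state is \<open>(v 0, 0)\<close>, so \<open>v 0 = 0\<close> would
    make the whole solution vanish.\<close>
  moreover have "v 0 \<noteq> 0"
  proof
    assume v0: "v 0 = 0"
    obtain r \<theta> where r: "0 < r" "0 < \<theta>" "\<theta> < \<alpha>" "power_fun \<mu> v (polar r \<theta>) \<noteq> 0"
      using nz by (auto simp: sector_def)
    then have "v \<theta> \<noteq> 0"
      using power_fun_polar[of r \<theta> \<mu> v] \<alpha> by auto
    moreover have "W \<theta> = 0"
      using flow[of \<theta>] r W0(1) v0 by (simp add: endo.zero_right flip: zero_prod_def)
    ultimately show False
      by (simp add: W_def zero_prod_def)
  qed
  ultimately show ?thesis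
    using flow[of \<alpha>] \<alpha> unfolding spectral_def by (intro exI[of _ "v 0"]) simp
qed

text \<open>The first component of the flow is the angular function. The second one is its traction
  up to the factor \<open>- \<mu>\<close>, so that the flow equation makes the residual
  vanish.\<close>

lemma solution_if_spectral:
  assumes \<alpha>: "0 < \<alpha>" "\<alpha> \<le> 2 * pi" and sp: "spectral \<alpha> \<mu>" and \<mu>: "\<mu> \<noteq> 0"
  shows "\<exists>v. smooth_on_interval 0 \<alpha> v \<and> (\<exists>x\<in>sector \<alpha>. power_fun \<mu> v x \<noteq> 0) \<and>
    solves_neumann_problem A11 A12 A22 \<alpha> (power_fun \<mu> v)"
proof -
  obtain u where u: "u \<noteq> 0" "snd (flow \<mu> \<alpha> \<cdot> (u, 0)) = 0"
    using sp by (auto simp: spectral_def)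
  define W where "W = (\<lambda>t. flow \<mu> t \<cdot> (u, 0))"
  define v where "v = (\<lambda>t. fst (W t))"
  have W0: "W 0 = (u, 0)"
    by (simp add: W_def flow_0)
  have smooth: "smooth_on_interval 0 \<alpha> v"
    unfolding v_def W_def by (rule smooth_flow[OF \<alpha>(1)])
  obtain w1 v2 where w: "\<And>t. t \<in> {0..\<alpha>} \<Longrightarrow> (v has_vector_derivative w1 t) (at t within {0..\<alpha>})"
    and w1: "\<And>t. t \<in> {0..\<alpha>} \<Longrightarrow> (w1 has_vector_derivative v2 t) (at t within {0..\<alpha>})"
    using smooth_on_interval_derivatives[OF smooth] by blast
  let ?g = "grad1 \<mu> v w1" and ?h = "grad2 \<mu> v w1"
  have W': "(W has_vector_derivative (cscale \<mu> * H t) \<cdot> W t) (at t within {0..\<alpha>})" if "t \<in> {0..\<alpha>}" for t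
    unfolding W_def endo_apply_times[symmetric]
    by (rule bounded_linear.has_vector_derivative[OF endo.bounded_linear_left flow_has_vector_derivative[OF that]])
  have unique: "D = D'" if "(f has_vector_derivative D) (at t within {0..\<alpha>})" "(f has_vector_derivative D') (at t within {0..\<alpha>})" "t \<in> {0..\<alpha>}"
    for f :: "real \<Rightarrow> complex^'l" and t D D'
    using vector_derivative_unique_within_closed_interval[of 0 \<alpha> t f D D'] that \<alpha> by (simp add: cbox_interval)
  have w1_eq: "w1 t = \<mu> *s fst (H t \<cdot> W t)" if t: "t \<in> {0..\<alpha>}" for t
  proof (rule unique[OF w[OF t] _ t])
    show "(v has_vector_derivative \<mu> *s fst (H t \<cdot> W t)) (at t within {0..\<alpha>})"
      using bounded_linear.has_vector_derivative[OF bounded_linear_fst W'[OF t]] by (simp add: v_def)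
  qed
  have snd_W: "traction (?g t) (?h t) t = - \<mu> *s snd (W t) \<and> radial_stress (?g t) (?h t) t = \<mu> *s snd (H t \<cdot> W t)"
    if t: "t \<in> {0..\<alpha>}" for t
  proof -
    obtain g h where gh: "W t = cos t *\<^sub>R (g, - (cmul A12 g + cmul A22 h)) + sin t *\<^sub>R (h, cmul A11 g + cmul A12 h)"
      "H t \<cdot> W t = - sin t *\<^sub>R (g, - (cmul A12 g + cmul A22 h)) + cos t *\<^sub>R (h, cmul A11 g + cmul A12 h)"
      using H_cases by blast
    have cs: "cos t * cos t + sin t * sin t = 1"
      by (metis power2_eq_square sin_cos_squared_add2)
    have vt: "v t = cos t *\<^sub>R g + sin t *\<^sub>R h"
      unfolding v_def gh(1) by simp
    have w1t: "w1 t = \<mu> *s (cos t *\<^sub>R h - sin t *\<^sub>R g)"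
      unfolding w1_eq[OF t] gh(2) by simp
    \<comment> \<open>The gradient of the homogeneous function is \<mu> times
      \<open>(g, h)\<close>.\<close>
    have "?g t = \<mu> *s ((cos t * cos t + sin t * sin t) *\<^sub>R g)"
      unfolding grad1_def vt w1t scaleR_eq_scale by (simp add: vec_eq_iff algebra_simps del: sin_cos_squared_add3)
    then have g: "?g t = \<mu> *s g"
      by (simp only: cs scaleR_one)
    have "?h t = \<mu> *s ((cos t * cos t + sin t * sin t) *\<^sub>R h)"
      unfolding grad2_def vt w1t scaleR_eq_scale by (simp add: vec_eq_iff algebra_simps del: sin_cos_squared_add3)
    then have h: "?h t = \<mu> *s h"
      by (simp only: cs scaleR_one)
    show ?thesis
      unfolding g h traction_def radial_stress_def cmul_scale gh(2) unfolding gh(1) scaleR_eq_scale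
      by (simp add: vec_eq_iff scaleR_conv_of_real[where 'a = complex] algebra_simps)
  qed
  have res: "residual \<mu> v w1 v2 t = 0" if t: "0 < t" "t < \<alpha>" for t
  proof -
    have t': "t \<in> {0..\<alpha>}"
      using t by simp
    have "((\<lambda>t. - \<mu> *s snd (W t)) has_vector_derivative - \<mu> *s (\<mu> *s snd (H t \<cdot> W t))) (at t within {0..\<alpha>})"
      using bounded_linear.has_vector_derivative[OF bounded_linear_compose[OF bounded_linear_scale bounded_linear_snd] W'[OF t'], of "- \<mu>"]
      by simp
    then have "((\<lambda>t. traction (?g t) (?h t) t) has_vector_derivative - \<mu> *s (\<mu> *s snd (H t \<cdot> W t))) (at t within {0..\<alpha>})"
      by (rule has_vector_derivative_transform[OF t', rotated]) (simp add: snd_W)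
    from unique[OF traction_has_vector_derivative[of v w1 t "{0..\<alpha>}" v2 \<mu>, OF w[OF t'] w1[OF t']] this t']
    show ?thesis
      using snd_W[OF t'] by simp
  qed
  have "solves_neumann_problem A11 A12 A22 \<alpha> (power_fun \<mu> v)"
    unfolding solves_neumann_problem_def
    using solves_equation_iff[OF \<alpha> w w1] neumann_on_ray_iff[OF \<alpha> w w1] res snd_W[of 0] snd_W[of \<alpha>] u(2) \<alpha>
    by (simp add: W0) (simp add: W_def)
  \<comment> \<open>Since \<open>v 0 = u\<close> is nonzero, \<open>v\<close> cannot vanish on the
    whole open interval, by continuity.\<close>
  moreover have "\<exists>x\<in>sector \<alpha>. power_fun \<mu> v x \<noteq> 0"
  proof (rule ccontr)
    assume "\<not> ?thesis"
    moreover have "polar 1 t \<in> sector \<alpha>" if "t \<in> {0<..<\<alpha>}" for t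
      using that zero_less_one unfolding sector_def by fastforce
    ultimately have zero: "power_fun \<mu> v (polar 1 t) = 0" if "t \<in> {0<..<\<alpha>}" for t
      using that by blast
    have vz: "v t = 0" if "t \<in> {0<..<\<alpha>}" for t
      using zero[OF that] power_fun_polar[of 1 t \<mu> v] that \<alpha> by simp
    have cl: "closure {0<..<\<alpha>} = {0..\<alpha>}"
      using closure_greaterThanLessThan[OF \<alpha>(1)] .
    have "continuous_on (closure {0<..<\<alpha>}) v"
      unfolding cl by (rule continuous_on_if_has_vector_derivative[OF w])
    then have "v 0 = 0"
      by (rule continuous_constant_on_closure[OF _ vz]) (use cl \<alpha> in auto)
    with u(1) show False
      by (simp add: v_def W0)
  qed
  ultimately show ?thesis
    using smooth by blast
qed

lemma Lambda_eq:
  assumes "0 < \<alpha>" "\<alpha> \<le> 2 * pi"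
  shows "Lambda A11 A12 A22 \<alpha> = {\<mu>. \<mu> \<noteq> 0 \<and> spectral \<alpha> \<mu>}"
  unfolding Lambda_def using spectral_if_solution solution_if_spectral assms by blast

end

theorem theorem6p3:
  fixes A11 A12 A22 :: "real^'l^'l"
  assumes "symmetric_mat A11" and "symmetric_mat A12" and "symmetric_mat A22"
    and "elliptic A11 A12 A22"
    and "formal_positive A11 A12 A22"
  shows "(\<forall>\<alpha>. 0 < \<alpha> \<and> \<alpha> < pi \<longrightarrow> Lambda A11 A12 A22 \<alpha> \<subseteq> {\<mu>. \<bar>Re \<mu>\<bar> > 1})
    \<and> Lambda A11 A12 A22 pi = \<int> - {0}
    \<and> (\<forall>\<alpha>. pi < \<alpha> \<and> \<alpha> < 2 * pi \<longrightarrow> Lambda A11 A12 A22 \<alpha> \<subseteq> {\<mu>. \<bar>Re \<mu>\<bar> > 1 / 2})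
    \<and> Lambda A11 A12 A22 (2 * pi) = {z / 2 | z. z \<in> \<int>} - {0}"
proof -
  interpret formally_positive_tuple A11 A12 A22
    using assms by unfold_locales
  \<comment> \<open>The bisector argument excludes the range up to 1/2, the argument for convex
    angles the rest up to 1.\<close>
  have "1 < \<bar>Re \<mu>\<bar>" if "0 < \<alpha>" "\<alpha> < pi" "\<mu> \<noteq> 0" "spectral \<alpha> \<mu>" for \<alpha> \<mu>
    using not_spectral_low[of \<alpha> \<mu>] not_spectral_convex[of \<alpha> \<mu>] that by fastforce
  moreover have "1 / 2 < \<bar>Re \<mu>\<bar>" if "pi < \<alpha>" "\<alpha> < 2 * pi" "\<mu> \<noteq> 0" "spectral \<alpha> \<mu>" for \<alpha> \<mu>
    using not_spectral_low[of \<alpha> \<mu>] that pi_gt_zero by fastforce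
  moreover have "2 * \<mu> \<in> \<int> \<longleftrightarrow> (\<exists>z. \<mu> = z / 2 \<and> z \<in> \<int>)" for \<mu> :: complex
    by (auto simp: mult.commute intro!: exI[of _ "2 * \<mu>"])
  ultimately show ?thesis
    by (auto simp: Lambda_eq spectral_pi spectral_2pi)
qed

end
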